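(* Let $q>2$ be a prime power. Suppose there exists an $[[n,n-k-l,k+1;k-l]]_q$ MDS EAQECC constructed by the Hermitian construction from an $[n,k]_{q^2}$ GRS code with $l$-dimensional Hermitian hull, where $0\le2k\le n$ and $0\le l\le k$. Then for any integers $0\le i\le\min\{l,q^2+1-n,n-2k\}$ and $0\le s\le l-i$, there exists an $[[n+i,n-k-s,k+i+1;k+i-s]]_q$ MDS EAQECC.
   Context: Classical codes: for a linear code $\mathcal C\subseteq\mathbb F_{q^2}^n$, $\mathcal C^{\perp_H}=\{\bm x:\sum_i y_ix_i^q=0\ \forall\bm y\in\mathcal C\}$ and $\mathrm{Hull}_H(\mathcal C)=\mathcal C\cap\mathcal C^{\perp_H}$. An $[n,k]_{q^2}$ GRS code is a code $\{(v_1f(a_1),\dots,v_nf(a_n)):f\in\mathbb F_{q^2}[x],\deg f\le k-1\}$ with distinct $a_j\in\mathbb F_{q^2}$ and $v_j\in\mathbb F_{q^2}^*$. EAQECCs: a $q$-ary entanglement-assisted quantum error-correcting code $[[n,\kappa,d;c]]_q$ encodes $\kappa$ information qudits into $n$ channel qudits with the help of $c$ pre-shared pairs of maximally entangled qudits, with minimum distance $d$. Explicitly (standard definition): there is an isometry $U:(\mathbb C^q)^{\otimes\kappa}\otimes(\mathbb C^q)^{\otimes c}\to(\mathbb C^q)^{\otimes n}$ such that, with $|\Phi\rangle=q^{-1/2}\sum_{x}|x\rangle|x\rangle$, the code space $Q=\{(U\otimes I)(|\varphi\rangle\otimes|\Phi\rangle^{\otimes c})\}\subseteq(\mathbb C^q)^{\otimes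 n}\otimes(\mathbb C^q)^{\otimes c}$ (where $U$ acts on the information qudits and the sender's halves of the pairs) detects every error $E\otimes I$ with $E$ acting nontrivially on at most $d-1$ of the $n$ channel qudits, i.e. $P(E\otimes I)P\in\mathbb C P$ for the projector $P$ onto $Q$. MDS: an $[[n,\kappa,d;c]]_q$ EAQECC with $2d\le n+2$ is MDS if $\kappa=c+n-2d+2$ (equality in the bound $\kappa\le c+\max\{0,n-2d+2\}$). Hermitian construction (known result, referred to in the claim): if $\mathcal C$ is an $[n,k,d]_{q^2}$ linear code, $\mathcal C^{\perp_H}$ has minimum distance $d^{\perp_H}$, and $r=\dim\mathrm{Hull}_H(\mathcal C)$, then there exist EAQECCs with parameters $[[n,k-r,d;n-k-r]]_q$ and $[[n,n-k-r,d^{\perp_H};k-r]]_q$. *)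

theory Defs
  imports
    Complex_Main
    "HOL-Library.Function_Algebras"
    "HOL-Computational_Algebra.Polynomial"
    "HOL-Number_Theory.Prime_Powers"
begin

section \<open>Classical codes\<close>

text \<open>
  A word of length \<open>n\<close> over a field is a function on \<open>nat\<close> that vanishes outside \<open>{..<n}\<close>; a code
  is a set of such words. Functions form a vector space under the pointwise operations, and
  dimensions of codes are taken there.
\<close>

global_interpretation word_space: vector_space "\<lambda>(c::'a::field) (x::nat \<Rightarrow> 'a) j. c * x j"
  by unfold_locales (auto simp: fun_eq_iff algebra_simps)

definition words_over :: "nat \<Rightarrow> (nat \<Rightarrow> 'a::zero) set" where
  "words_over n = {x. \<forall>j\<ge>n. x j = 0}"

definition hermitian_dual :: "nat \<Rightarrow> nat \<Rightarrow> (nat \<Rightarrow> 'a::field) set \<Rightarrow> (nat \<Rightarrow> 'a) set" where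
  "hermitian_dual q n C = {x \<in> words_over n. \<forall>y\<in>C. (\<Sum>j<n. y j * x j ^ q) = 0}"

definition hermitian_hull :: "nat \<Rightarrow> nat \<Rightarrow> (nat \<Rightarrow> 'a::field) set \<Rightarrow> (nat \<Rightarrow> 'a) set" where
  "hermitian_hull q n C = C \<inter> hermitian_dual q n C"

definition hamming_dist :: "nat \<Rightarrow> (nat \<Rightarrow> 'a) \<Rightarrow> (nat \<Rightarrow> 'a) \<Rightarrow> nat" where
  "hamming_dist n x y = card {j. j < n \<and> x j \<noteq> y j}"

definition min_distance :: "nat \<Rightarrow> (nat \<Rightarrow> 'a) set \<Rightarrow> nat" where
  "min_distance n C = Inf {hamming_dist n x y | x y. x \<in> C \<and> y \<in> C \<and> x \<noteq> y}"

text \<open>The disjunct \<open>f = 0\<close> makes the code zero for \<open>k = 0\<close>, where \<open>deg f \<le> k - 1 = -1\<close>.\<close>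

definition is_grs_code :: "nat \<Rightarrow> nat \<Rightarrow> (nat \<Rightarrow> 'a::field) set \<Rightarrow> bool" where
  "is_grs_code n k C \<longleftrightarrow>
     (\<exists>a v. inj_on a {..<n} \<and> (\<forall>j<n. v j \<noteq> 0) \<and>
        C = {(\<lambda>j. if j < n then v j * poly f (a j) else 0) | f. f = 0 \<or> degree f < k})"

section \<open>Finite-dimensional Hilbert spaces and operators\<close>

text \<open>
  For a finite set \<open>A\<close>, the Hilbert space with orthonormal basis \<open>A\<close> consists of the coefficient
  functions supported on \<open>A\<close>, and a linear operator from the space over \<open>B\<close> to the space over \<open>A\<close>
  is given by its matrix, supported on \<open>A \<times> B\<close>. The tensor product of two such spaces is the space
  over the product of the bases.
\<close>

definition hilb :: "'a set \<Rightarrow> ('a \<Rightarrow> complex) set" where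
  "hilb A = {\<psi>. \<forall>x. x \<notin> A \<longrightarrow> \<psi> x = 0}"

definition opers :: "'a set \<Rightarrow> 'b set \<Rightarrow> ('a \<Rightarrow> 'b \<Rightarrow> complex) set" where
  "opers A B = {K. \<forall>x y. x \<notin> A \<or> y \<notin> B \<longrightarrow> K x y = 0}"

definition op_apply :: "'b set \<Rightarrow> ('a \<Rightarrow> 'b \<Rightarrow> complex) \<Rightarrow> ('b \<Rightarrow> complex) \<Rightarrow> 'a \<Rightarrow> complex" where
  "op_apply B K \<psi> = (\<lambda>x. \<Sum>y\<in>B. K x y * \<psi> y)"

definition op_mult ::
  "'b set \<Rightarrow> ('a \<Rightarrow> 'b \<Rightarrow> complex) \<Rightarrow> ('b \<Rightarrow> 'c \<Rightarrow> complex) \<Rightarrow> 'a \<Rightarrow> 'c \<Rightarrow> complex" where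
  "op_mult B K L = (\<lambda>x z. \<Sum>y\<in>B. K x y * L y z)"

definition op_adjoint :: "('a \<Rightarrow> 'b \<Rightarrow> complex) \<Rightarrow> 'b \<Rightarrow> 'a \<Rightarrow> complex" where
  "op_adjoint K = (\<lambda>y x. cnj (K x y))"

definition op_id :: "'a set \<Rightarrow> 'a \<Rightarrow> 'a \<Rightarrow> complex" where
  "op_id A = (\<lambda>x y. if x \<in> A \<and> x = y then 1 else 0)"

definition op_tensor ::
  "('a \<Rightarrow> 'b \<Rightarrow> complex) \<Rightarrow> ('c \<Rightarrow> 'd \<Rightarrow> complex) \<Rightarrow> 'a \<times> 'c \<Rightarrow> 'b \<times> 'd \<Rightarrow> complex" where
  "op_tensor K L = (\<lambda>(x, u) (y, v). K x y * L u v)"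

definition is_isometry :: "'a set \<Rightarrow> 'b set \<Rightarrow> ('a \<Rightarrow> 'b \<Rightarrow> complex) \<Rightarrow> bool" where
  "is_isometry A B U \<longleftrightarrow> U \<in> opers A B \<and> op_mult A (op_adjoint U) U = op_id B"

definition is_projector_onto ::
  "'a set \<Rightarrow> ('a \<Rightarrow> 'a \<Rightarrow> complex) \<Rightarrow> ('a \<Rightarrow> complex) set \<Rightarrow> bool" where
  "is_projector_onto A P Q \<longleftrightarrow>
     P \<in> opers A A \<and> op_adjoint P = P \<and> op_mult A P P = P \<and> op_apply A P ` hilb A = Q"

section \<open>Entanglement-assisted quantum codes\<close>

text \<open>The standard basis of $(\mathbb{C}^q)^{\otimes m}$.\<close>

definition qbasis :: "nat \<Rightarrow> nat \<Rightarrow> nat list set" where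
  "qbasis q m = {w. length w = m \<and> set w \<subseteq> {..<q}}"

text \<open>
  The coefficients of $|\Phi\rangle^{\otimes c}$, where $|\Phi\rangle = q^{-1/2}\sum_x |x\rangle|x\rangle$;
  the first components of the \<open>c\<close> pairs are collected in \<open>z\<close> and the second ones in \<open>y\<close>.
\<close>

definition max_entangled :: "nat \<Rightarrow> nat \<Rightarrow> nat list \<Rightarrow> nat list \<Rightarrow> complex" where
  "max_entangled q c z y =
     (if z \<in> qbasis q c \<and> y \<in> qbasis q c
      then \<Prod>j<c. (if z ! j = y ! j then 1 / complex_of_real (sqrt (real q)) else 0) else 0)"

text \<open>
  The information qudits and the sender's halves of the pairs form the first tensor factor,
  the receiver's halves the second one.
\<close>

definition code_space ::
  "nat \<Rightarrow> nat \<Rightarrow> nat \<Rightarrow> (nat list \<Rightarrow> nat list \<times> nat list \<Rightarrow> complex)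
     \<Rightarrow> (nat list \<times> nat list \<Rightarrow> complex) set" where
  "code_space q \<kappa> c U =
     {op_apply ((qbasis q \<kappa> \<times> qbasis q c) \<times> qbasis q c) (op_tensor U (op_id (qbasis q c)))
        (\<lambda>((w, z), y). \<phi> w * max_entangled q c z y) | \<phi>. \<phi> \<in> hilb (qbasis q \<kappa>)}"

text \<open>
  \<open>E\<close> is an arbitrary operator \<open>M\<close> on the qudits with position in \<open>S\<close>, tensored with the identity
  on the other ones.
\<close>

definition acts_only_on ::
  "nat \<Rightarrow> nat \<Rightarrow> nat set \<Rightarrow> (nat list \<Rightarrow> nat list \<Rightarrow> complex) \<Rightarrow> bool" where
  "acts_only_on q n S E \<longleftrightarrow>
     E \<in> opers (qbasis q n) (qbasis q n) \<and>
     (\<exists>M. \<forall>x\<in>qbasis q n. \<forall>y\<in>qbasis q n.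
        E x y = (if \<forall>j<n. j \<notin> S \<longrightarrow> x ! j = y ! j then M (nths x S) (nths y S) else 0))"

definition detects_errors ::
  "nat \<Rightarrow> nat \<Rightarrow> nat \<Rightarrow> nat \<Rightarrow> (nat list \<times> nat list \<Rightarrow> nat list \<times> nat list \<Rightarrow> complex) \<Rightarrow> bool" where
  "detects_errors q n c d P \<longleftrightarrow>
     (let B = qbasis q n \<times> qbasis q c in
      \<forall>S E. S \<subseteq> {..<n} \<and> card S < d \<and> acts_only_on q n S E \<longrightarrow>
        (\<exists>\<mu>. op_mult B P (op_mult B (op_tensor E (op_id (qbasis q c))) P) = (\<lambda>x y. \<mu> * P x y)))"

definition eaqecc_exists :: "nat \<Rightarrow> nat \<Rightarrow> nat \<Rightarrow> nat \<Rightarrow> nat \<Rightarrow> bool" where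
  "eaqecc_exists q n \<kappa> d c \<longleftrightarrow>
     (\<exists>U P. is_isometry (qbasis q n) (qbasis q \<kappa> \<times> qbasis q c) U \<and>
        is_projector_onto (qbasis q n \<times> qbasis q c) P (code_space q \<kappa> c U) \<and>
        detects_errors q n c d P)"

text \<open>\<open>\<kappa> = c + n - 2d + 2\<close> is written without subtraction.\<close>

definition mds_eaqecc_exists :: "nat \<Rightarrow> nat \<Rightarrow> nat \<Rightarrow> nat \<Rightarrow> nat \<Rightarrow> bool" where
  "mds_eaqecc_exists q n \<kappa> d c \<longleftrightarrow>
     eaqecc_exists q n \<kappa> d c \<and> 2 * d \<le> n + 2 \<and> \<kappa> + 2 * d = c + n + 2"

text \<open>
  The parameters that the Hermitian construction assigns to \<open>C\<close>:
  $[[n, n-k-r, d^{\perp_H}; k-r]]_q$ with \<open>k\<close> the dimension of \<open>C\<close> and \<open>r\<close> that of its hull.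
\<close>

definition hermitian_construction_params ::
  "nat \<Rightarrow> nat \<Rightarrow> (nat \<Rightarrow> 'a::field) set \<Rightarrow> nat \<Rightarrow> nat \<Rightarrow> nat \<Rightarrow> bool" where
  "hermitian_construction_params q n C \<kappa> d c \<longleftrightarrow>
     \<kappa> + word_space.dim C + word_space.dim (hermitian_hull q n C) = n \<and>
     d = min_distance n (hermitian_dual q n C) \<and>
     c + word_space.dim (hermitian_hull q n C) = word_space.dim C"

end

theory Submission
  imports Defs "HOL-Number_Theory.Cong"
begin

text \<open>
  Classical part. A GRS code of length \<open>n\<close> and dimension \<open>k\<close> is, up to column multipliers, the
  subcode of a GRS code of length \<open>n + i\<close> and dimension \<open>k + i\<close> (with the point at infinity allowed)
  that vanishes at the \<open>i\<close> new points. A hull word of the small code needs to satisfy only \<open>i\<close> further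
  equations to lie in the hull of the large one, whose hull therefore has dimension at least \<open>l - i\<close>.
  For \<open>q > 2\<close>, rescaling one coordinate lowers the dimension of the hull by exactly one, so every
  \<open>s \<le> l - i\<close> is reached.

  Quantum part. An orthonormal basis \<open>u\<close> of \<open>C\<close> modulo its hull yields a self-orthogonal extension
  of \<open>C\<close> by the \<open>k - r\<close> receiver coordinates, and an orthonormal basis of the Hermitian dual modulo the
  hull labels logical operators. The code space is spanned by joint eigenvectors of the Weyl operators
  of the extended code. Wherever that code takes all values on a set of coordinates, averaging over these
  operators turns any error supported there into a scalar; for an MDS code this covers all sets of \<open>k\<close>
  sender coordinates (detection) and the receiver's coordinates (maximal entanglement, which
  makes the encoder an isometry).
\<close>

section \<open>Additive maps and characters\<close>

text \<open>Sizes stand in for dimensions: a code of dimension k has (q^2)^k words, sizes of kernels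
  and images multiply, and the estimates for hulls are inequalities between powers of q^2. The value
  q = 2 is excluded because every nonzero element of the field with four elements has norm 1, so
  that rescaling a coordinate never changes the Hermitian form. On the quantum side the obstacle is
  phases: a product of Weyl operators is a Weyl operator only up to a phase, and in characteristic 2
  even the square of one can be -1. These phases are never computed. The eigenvalues of a joint
  eigenvector have modulus 1, and in every expectation an eigenvalue meets its own conjugate. The
  distance enters as the property that the code takes all values on small sets of positions, which
  is the form that averaging can use. The bound i <= n - 2k amounts to 2d <= n + 2 for the new
  distance d = k + i + 1.\<close>

text \<open>All fibres are translates of the kernel. Asking only for additivity makes this counting
  form of rank-nullity apply to x ^ q - x as well as to linear functionals.\<close>

lemma card_eq_card_kernel_times_card_image:
  fixes f :: "'b::ab_group_add \<Rightarrow> 'c::ab_group_add"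
  assumes "finite V" and diff: "\<And>x y. x \<in> V \<Longrightarrow> y \<in> V \<Longrightarrow> x - y \<in> V"
    and add: "\<And>x y. x \<in> V \<Longrightarrow> y \<in> V \<Longrightarrow> x + y \<in> V"
    and f_diff: "\<And>x y. x \<in> V \<Longrightarrow> y \<in> V \<Longrightarrow> f (x - y) = f x - f y"
    and f_add: "\<And>x y. x \<in> V \<Longrightarrow> y \<in> V \<Longrightarrow> f (x + y) = f x + f y"
  shows "card V = card {x \<in> V. f x = 0} * card (f ` V)"
proof -
  have fibre: "card {x \<in> V. f x = z} = card {x \<in> V. f x = 0}" if "z \<in> f ` V" for z
  proof -
    obtain x0 where x0: "x0 \<in> V" "f x0 = z"
      using \<open>z \<in> f ` V\<close> by auto
    have "bij_betw (\<lambda>x. x - x0) {x \<in> V. f x = z} {x \<in> V. f x = 0}"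
      by (rule bij_betw_byWitness[where f' = "\<lambda>x. x + x0"]) (use x0 in \<open>auto simp: diff add f_diff f_add\<close>)
    then show ?thesis
      by (rule bij_betw_same_card)
  qed
  have "card V = (\<Sum>x\<in>V. 1)"
    by simp
  also have "\<dots> = (\<Sum>z\<in>f ` V. \<Sum>x\<in>{x \<in> V. f x = z}. 1)"
    by (rule sum.image_gen) fact
  also have "\<dots> = (\<Sum>z\<in>f ` V. card {x \<in> V. f x = 0})"
    by (intro sum.cong) (simp_all add: fibre)
  finally show ?thesis
    by simp
qed

text \<open>Translation by \<open>g\<close> permutes \<open>G\<close> and multiplies the sum by
  \<open>\<chi> g\<close>.\<close>

lemma sum_nontrivial_character:
  fixes \<chi> :: "'b::ab_group_add \<Rightarrow> complex"
  assumes diff: "\<And>x y. x \<in> G \<Longrightarrow> y \<in> G \<Longrightarrow> x - y \<in> G"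
    and add: "\<And>x y. x \<in> G \<Longrightarrow> y \<in> G \<Longrightarrow> x + y \<in> G"
    and \<chi>: "\<And>x y. x \<in> G \<Longrightarrow> y \<in> G \<Longrightarrow> \<chi> (x + y) = \<chi> x * \<chi> y"
    and "g \<in> G" and "\<chi> g \<noteq> 1"
  shows "(\<Sum>x\<in>G. \<chi> x) = 0"
proof -
  have "(\<Sum>x\<in>G. \<chi> x) = (\<Sum>x\<in>G. \<chi> (x + g))"
    by (rule sum.reindex_bij_witness[of _ "\<lambda>x. x + g" "\<lambda>x. x - g"]) (use \<open>g \<in> G\<close> diff add in auto)
  also have "\<dots> = (\<Sum>x\<in>G. \<chi> x) * \<chi> g"
    by (simp add: \<chi> \<open>g \<in> G\<close> sum_distrib_right)
  finally show ?thesis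
    using \<open>\<chi> g \<noteq> 1\<close> by (metis mult_cancel_left mult.right_neutral)
qed

section \<open>Joint eigenvectors of commuting monomial operators\<close>

text \<open>Weighted substitutions. The class contains translations, Weyl operators and, since
  \<open>m\<close> may vanish, restriction to a set of points; linearity can be read off from the
  shape.\<close>

definition monomial_op :: "(('b \<Rightarrow> complex) \<Rightarrow> 'b \<Rightarrow> complex) \<Rightarrow> bool" where
  "monomial_op A \<longleftrightarrow> (\<exists>m \<sigma>. A = (\<lambda>f u. m u * f (\<sigma> u)))"

lemma monomial_opI: "monomial_op (\<lambda>f u. m u * f (\<sigma> u))"
  by (auto simp: monomial_op_def)

lemma monomial_op_sum:
  assumes "monomial_op A"
  shows "A (\<lambda>u. \<Sum>j\<in>J. c j * f j u) = (\<lambda>u. \<Sum>j\<in>J. c j * A (f j) u)"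
  using assms by (auto simp: monomial_op_def fun_eq_iff sum_distrib_left mult_ac)

lemma monomial_op_scale:
  assumes "monomial_op A"
  shows "A (\<lambda>u. c * f u) = (\<lambda>u. c * A f u)"
  using assms by (auto simp: monomial_op_def fun_eq_iff mult_ac)

lemma sum_cyclic_shift:
  fixes g :: "nat \<Rightarrow> 'b::ab_group_add"
  assumes "g n = g 0"
  shows "(\<Sum>j<n. g (Suc j)) = (\<Sum>j<n. g j)"
proof -
  have "(\<Sum>j<n. g (Suc j)) - (\<Sum>j<n. g j) = (\<Sum>j<n. g (Suc j) - g j)"
    by (simp add: sum_subtractf)
  also have "\<dots> = g n - g 0"
    by (rule sum_lessThan_telescope)
  finally show ?thesis
    using assms by simp
qed

text \<open>
  The discrete Fourier transform of the orbit of \<open>g\<close> under \<open>A\<close> consists of eigenvectors whose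
  sum is a multiple of \<open>g\<close>, so one of them does not vanish.
\<close>

lemma cyclic_eigenvector:
  fixes A :: "('b \<Rightarrow> complex) \<Rightarrow> 'b \<Rightarrow> complex"
  assumes A: "monomial_op A" and "n > 0" and An: "(A ^^ n) g = g" and "g \<noteq> (\<lambda>_. 0)"
  obtains h \<mu> where "h \<noteq> (\<lambda>_. 0)" and "A h = (\<lambda>u. \<mu> * h u)"
    and "\<forall>B \<beta>. monomial_op B \<and> (\<forall>f. A (B f) = B (A f)) \<and> B g = (\<lambda>u. \<beta> * g u)
           \<longrightarrow> B h = (\<lambda>u. \<beta> * h u)"
proof -
  define \<zeta> where "\<zeta> = cis (2 * pi / real n)"
  have \<zeta>_nz: "\<zeta> \<noteq> 0"
    by (simp add: \<zeta>_def)
  have \<zeta>_power: "\<zeta> ^ j = cis (2 * pi * real j / real n)" for j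
    by (simp add: \<zeta>_def DeMoivre mult_ac)
  have \<zeta>_n: "\<zeta> ^ n = 1"
    using \<open>n > 0\<close> by (simp add: \<zeta>_power)
  have \<zeta>_ne: "\<zeta> ^ j \<noteq> 1" if "0 < j" "j < n" for j
  proof
    assume "\<zeta> ^ j = 1"
    then have "cis (2 * pi * real j / real n) = cis (2 * pi * real 0 / real n)"
      by (simp add: \<zeta>_power)
    moreover have "inj_on (\<lambda>k. cis (2 * pi * real k / real n)) {..<n}"
      using bij_betw_roots_unity[OF \<open>n > 0\<close>] by (simp add: bij_betw_def)
    ultimately show False
      using that by (metis inj_onD lessThan_iff less_trans less_irrefl)
  qed
  define h where "h k = (\<lambda>u. \<Sum>j<n. inverse \<zeta> ^ (k * j) * (A ^^ j) g u)" for k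
  have eig: "A (h k) = (\<lambda>u. \<zeta> ^ k * h k u)" for k
  proof
    fix u
    have "A (h k) u = (\<Sum>j<n. inverse \<zeta> ^ (k * j) * (A ^^ Suc j) g u)"
      unfolding h_def by (simp add: monomial_op_sum[OF A])
    also have "\<dots> = \<zeta> ^ k * (\<Sum>j<n. inverse \<zeta> ^ (k * Suc j) * (A ^^ Suc j) g u)"
      unfolding sum_distrib_left
      by (intro sum.cong) (simp_all add: power_add power_inverse \<zeta>_nz)
    also have "(\<Sum>j<n. inverse \<zeta> ^ (k * Suc j) * (A ^^ Suc j) g u) = h k u"
      unfolding h_def
    proof (rule sum_cyclic_shift)
      have "inverse \<zeta> ^ (k * n) = 1"
        by (simp add: mult.commute[of k] power_mult power_inverse \<zeta>_n)
      then show "inverse \<zeta> ^ (k * n) * (A ^^ n) g u = inverse \<zeta> ^ (k * 0) * (A ^^ 0) g u"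
        by (simp add: An)
    qed
    finally show "A (h k) u = \<zeta> ^ k * h k u" .
  qed
  have total: "(\<Sum>k<n. h k u) = of_nat n * g u" for u
  proof -
    have "(\<Sum>k<n. h k u) = (\<Sum>j<n. (\<Sum>k<n. (inverse \<zeta> ^ j) ^ k) * (A ^^ j) g u)"
      unfolding h_def by (subst sum.swap) (simp add: sum_distrib_right mult.commute[of k for k :: nat] flip: power_mult)
    also have "\<dots> = (\<Sum>j<n. if j = 0 then of_nat n * g u else 0)"
    proof (intro sum.cong refl)
      fix j assume j: "j \<in> {..<n}"
      have "(\<Sum>k<n. (inverse \<zeta> ^ j) ^ k) = 0" if "j \<noteq> 0"
      proof -
        have ne: "inverse \<zeta> ^ j \<noteq> 1"
          using \<zeta>_ne[of j] that j by (simp add: power_inverse)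
        have "(inverse \<zeta> ^ j) ^ n = 1"
          by (metis \<zeta>_n inverse_1 mult.commute power_inverse power_mult power_one)
        then show ?thesis
          using ne by (subst geometric_sum) auto
      qed
      then show "(\<Sum>k<n. (inverse \<zeta> ^ j) ^ k) * (A ^^ j) g u = (if j = 0 then of_nat n * g u else 0)"
        by simp
    qed
    also have "\<dots> = of_nat n * g u"
      using \<open>n > 0\<close> by simp
    finally show ?thesis .
  qed
  have "\<exists>k. h k \<noteq> (\<lambda>_. 0)"
  proof (rule ccontr)
    assume "\<not> ?thesis"
    then have "of_nat n * g u = 0" for u
      using total[of u] by simp
    then show False
      using \<open>g \<noteq> (\<lambda>_. 0)\<close> \<open>n > 0\<close> by auto
  qed
  then obtain k where k: "h k \<noteq> (\<lambda>_. 0)" ..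
  \<comment> \<open>\<open>h k\<close> is a combination of the orbit of \<open>g\<close> under
    \<open>A\<close>, and an operator commuting with \<open>A\<close> scales the whole orbit by the
    factor by which it scales \<open>g\<close>. Thus known eigenvalues survive when an eigenvector
    is refined.\<close>
  have "B (h k) = (\<lambda>u. \<beta> * h k u)"
    if B: "monomial_op B" and comm: "\<And>f. A (B f) = B (A f)" and Bg: "B g = (\<lambda>u. \<beta> * g u)" for B \<beta>
  proof -
    have "B ((A ^^ j) g) = (\<lambda>u. \<beta> * (A ^^ j) g u)" for j
      by (induction j) (simp_all add: Bg monomial_op_scale[OF A] flip: comm)
    then show ?thesis
      unfolding h_def by (subst monomial_op_sum[OF B]) (simp add: sum_distrib_left mult_ac)
  qed
  then have "\<forall>B \<beta>. monomial_op B \<and> (\<forall>f. A (B f) = B (A f)) \<and> B g = (\<lambda>u. \<beta> * g u)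
           \<longrightarrow> B (h k) = (\<lambda>u. \<beta> * h k u)"
    by simp
  with that[OF k eig] show ?thesis .
qed

text \<open>One operator is treated at a time. The last clause says that the result keeps every
  eigenvalue that \<open>f0\<close> already had for an operator commuting with \<open>L\<close>. It
  is both the invariant of the induction and a means to steer the outcome: a suitable
  \<open>f0\<close> prescribes an eigenvalue or confines the support of \<open>f\<close>.\<close>

lemma joint_eigenvector:
  fixes W :: "'s \<Rightarrow> ('b \<Rightarrow> complex) \<Rightarrow> 'b \<Rightarrow> complex"
  assumes "finite L" and "f0 \<noteq> (\<lambda>_. 0)"
    and "\<And>s. s \<in> L \<Longrightarrow> monomial_op (W s)"
    and "\<And>s t f. s \<in> L \<Longrightarrow> t \<in> L \<Longrightarrow> W s (W t f) = W t (W s f)"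
    and "\<And>s. s \<in> L \<Longrightarrow> \<exists>n>0. \<forall>f. (W s ^^ n) f = f"
  shows "\<exists>f. f \<noteq> (\<lambda>_. 0) \<and> (\<forall>s\<in>L. \<exists>\<mu>. W s f = (\<lambda>u. \<mu> * f u)) \<and>
    (\<forall>B \<beta>. monomial_op B \<and> (\<forall>s\<in>L. \<forall>f. W s (B f) = B (W s f)) \<and> B f0 = (\<lambda>u. \<beta> * f0 u)
       \<longrightarrow> B f = (\<lambda>u. \<beta> * f u))"
  using assms
proof (induction L rule: finite_induct)
  case empty
  then show ?case
    by auto
next
  case (insert s L)
  from insert.IH[OF insert.prems(1) insert.prems(2)[OF insertI2] insert.prems(3)[OF insertI2 insertI2]
      insert.prems(4)[OF insertI2]]
  obtain g where g: "g \<noteq> (\<lambda>_. 0)" "\<forall>t\<in>L. \<exists>\<mu>. W t g = (\<lambda>u. \<mu> * g u)"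
    and gB: "\<forall>B \<beta>. monomial_op B \<and> (\<forall>t\<in>L. \<forall>f. W t (B f) = B (W t f)) \<and>
      B f0 = (\<lambda>u. \<beta> * f0 u) \<longrightarrow> B g = (\<lambda>u. \<beta> * g u)"
    by auto
  have gB: "B g = (\<lambda>u. \<beta> * g u)"
    if "monomial_op B" "\<forall>t\<in>L. \<forall>f. W t (B f) = B (W t f)" "B f0 = (\<lambda>u. \<beta> * f0 u)" for B \<beta>
    using that gB by meson
  obtain n where n: "n > 0" "\<And>f. (W s ^^ n) f = f"
    using insert.prems(4) by blast
  obtain h \<mu> where h: "h \<noteq> (\<lambda>_. 0)" "W s h = (\<lambda>u. \<mu> * h u)"
    and hB: "\<forall>B \<beta>. monomial_op B \<and> (\<forall>f. W s (B f) = B (W s f)) \<and> B g = (\<lambda>u. \<beta> * g u)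
           \<longrightarrow> B h = (\<lambda>u. \<beta> * h u)"
    by (rule cyclic_eigenvector[OF insert.prems(2)[OF insertI1] n(1) n(2)[of g] g(1)])
  have hB: "B h = (\<lambda>u. \<beta> * h u)"
    if "monomial_op B" "\<forall>f. W s (B f) = B (W s f)" "B g = (\<lambda>u. \<beta> * g u)" for B \<beta>
    using that hB by meson
  have "\<exists>\<mu>. W t h = (\<lambda>u. \<mu> * h u)" if "t \<in> insert s L" for t
  proof (cases "t = s")
    case True
    then show ?thesis
      using h(2) by (intro exI[of _ \<mu>]) simp
  next
    case False
    with that have "t \<in> L"
      by simp
    from bspec[OF g(2) this] obtain \<nu> where "W t g = (\<lambda>u. \<nu> * g u)" ..
    \<comment> \<open>\<open>W t\<close> commutes with \<open>W s\<close>, so passing from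
      \<open>g\<close> to \<open>h\<close> preserves its eigenvalue.\<close>
    then have "W t h = (\<lambda>u. \<nu> * h u)"
      by (intro hB[of "W t" \<nu>] allI insert.prems(2)[OF that] insert.prems(3)[OF insertI1 that])
    then show ?thesis ..
  qed
  moreover have "B h = (\<lambda>u. \<beta> * h u)"
    if "monomial_op B" "\<forall>t\<in>insert s L. \<forall>f. W t (B f) = B (W t f)" "B f0 = (\<lambda>u. \<beta> * f0 u)" for B \<beta>
  proof (rule hB[of B \<beta>])
    show "B g = (\<lambda>u. \<beta> * g u)"
      by (rule gB[of B \<beta>]) (use that in blast)+
  qed (use that in blast)+
  ultimately show ?case
    using h(1) by blast
qed

section \<open>Finite fields of square order\<close>

locale quadratic_field =
  fixes q :: nat and ty :: "'a::{field,finite} itself"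
  assumes primepow_q: "primepow q" and card_field: "card (UNIV :: 'a set) = q ^ 2"
begin

text \<open>The subfield of order q, as the fixed points of conjugation.\<close>

definition base_field :: "'a set" where
  "base_field = {x. x ^ q = x}"

lemma q_gt_1: "q > 1"
  using primepow_gt_Suc_0[OF primepow_q] by simp

lemma char_power: "prime CHAR('a)" "\<exists>m. q = CHAR('a) ^ m"
proof -
  obtain p m where p: "prime p" "q = p ^ m"
    using primepow_q by (auto simp: primepow_def)
  \<comment> \<open>Shifting the summation variable by 1 adds q^2 ones to the sum of all elements,
    so q^2 vanishes in the field and the characteristic divides a power of \<open>p\<close>.\<close>
  have "(\<Sum>x\<in>UNIV. x) = (\<Sum>x\<in>UNIV. x + 1 :: 'a)"
    by (rule sum.reindex_bij_witness[of _ "\<lambda>x. x + 1" "\<lambda>x. x - 1"]) auto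
  then have "of_nat (q ^ 2) = (0 :: 'a)"
    by (simp add: sum.distrib card_field)
  then have "CHAR('a) dvd p ^ (m * 2)"
    by (simp only: of_nat_eq_0_iff_char_dvd p power_mult)
  then obtain j where "CHAR('a) = p ^ j"
    using divides_primepow_nat[OF p(1)] by blast
  moreover show "prime CHAR('a)"
    by (meson prime_CHAR_semidom finite_imp_CHAR_pos finite)
  ultimately have "CHAR('a) = p"
    using p(1) by (metis dvd_refl prime_dvd_power primes_dvd_imp_eq)
  with p show "\<exists>m. q = CHAR('a) ^ m"
    by blast
qed

section \<open>Conjugation x -> x^q as an additive involution\<close>

lemma frob_add: "(x + y :: 'a) ^ q = x ^ q + y ^ q"
  using freshmans_dream' char_power by blast

lemma frob_sum: "(sum f A :: 'a) ^ q = (\<Sum>i\<in>A. f i ^ q)"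
  using freshmans_dream_sum' char_power by blast

lemma frob_minus: "(- x :: 'a) ^ q = - (x ^ q)"
  using frob_add[of x "- x"] q_gt_1 by (simp add: eq_neg_iff_add_eq_0 add.commute zero_power)

lemma frob_diff: "(x - y :: 'a) ^ q = x ^ q - y ^ q"
  using frob_add[of x "- y"] by (simp add: frob_minus)

lemma frob_frob: "((x :: 'a) ^ q) ^ q = x"
proof (cases "x = 0")
  case False
  have "x ^ (q ^ 2 - 1) * (\<Prod>y\<in>UNIV-{0}. y) = (\<Prod>y\<in>UNIV-{0}. x * y)"
    by (simp add: prod.distrib card_field card_Diff_singleton)
  also have "\<dots> = (\<Prod>y\<in>UNIV-{0}. y)"
    by (rule prod.reindex_bij_witness[of _ "\<lambda>y. y / x" "\<lambda>y. x * y"]) (use False in auto)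
  finally have "x ^ (q ^ 2 - 1) = 1"
    by simp
  then have "x ^ Suc (q ^ 2 - 1) = x"
    by simp
  moreover have "Suc (q ^ 2 - 1) = q * q"
    using q_gt_1 by (simp add: power2_eq_square)
  ultimately show ?thesis
    by (metis power_mult)
qed (use q_gt_1 in auto)

section \<open>Root counts, the subfield and the norm map\<close>

lemma card_power_fibre: "card {x :: 'a. x ^ m = c} \<le> m" if "m > 0"
proof -
  have "monom 1 m - [:c:] \<noteq> 0"
    using that by (metis coeff_monom degree_pCons_0 degree_monom_eq eq_iff_diff_eq_0 less_irrefl one_neq_zero)
  then have "card {x. poly (monom 1 m - [:c:]) x = 0} \<le> degree (monom 1 m - [:c:])"
    by (intro card_poly_roots_bound)
  also have "\<dots> \<le> m"
    by (intro degree_diff_le) (auto simp: degree_monom_le)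
  finally show ?thesis
    by (simp add: poly_monom)
qed

lemma card_linear_roots: "card {x :: 'a. x ^ q = c * x} \<le> q"
proof -
  define p where "p = monom 1 q - [:0, c:]"
  have "coeff p q = 1"
    using q_gt_1 by (auto simp: p_def coeff_pCons split: nat.splits)
  then have "p \<noteq> 0"
    by auto
  then have "card {x. poly p x = 0} \<le> degree p"
    by (intro card_poly_roots_bound)
  also have "\<dots> \<le> q"
    unfolding p_def using q_gt_1 by (intro degree_diff_le) (auto simp: degree_monom_le)
  finally show ?thesis
    by (simp add: p_def poly_monom mult.commute)
qed

text \<open>The additive map x -> x ^ q - x has kernel \<open>base_field\<close>, and its image lies
  in the solutions of y ^ q = -y. Both sets have at most q elements while the sizes of kernel and
  image multiply to q^2, so neither bound is strict.\<close>

lemma card_base_field: "card base_field = q"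
proof -
  have "card (UNIV :: 'a set) = card {x \<in> UNIV :: 'a set. x ^ q - x = 0} * card (range (\<lambda>x :: 'a. x ^ q - x))"
    by (rule card_eq_card_kernel_times_card_image) (auto simp: frob_add frob_diff)
  then have eq: "q ^ 2 = card base_field * card (range (\<lambda>x :: 'a. x ^ q - x))"
    by (simp add: base_field_def card_field)
  have "card (range (\<lambda>x :: 'a. x ^ q - x)) \<le> card {y :: 'a. y ^ q = - 1 * y}"
    by (intro card_mono) (auto simp: frob_diff frob_frob)
  also have "\<dots> \<le> q"
    by (rule card_linear_roots)
  finally have 1: "card (range (\<lambda>x :: 'a. x ^ q - x)) \<le> q" .
  have 2: "card base_field \<le> q"
    using card_linear_roots[of 1] by (simp add: base_field_def)
  have "q * q \<le> card base_field * q"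
    using mult_le_mono2[OF 1, of "card base_field"] eq by (simp only: power2_eq_square)
  with 2 q_gt_1 show ?thesis
    by simp
qed

lemma base_field_closed:
  "0 \<in> base_field" "1 \<in> base_field"
  "x \<in> base_field \<Longrightarrow> y \<in> base_field \<Longrightarrow> x + y \<in> base_field"
  "x \<in> base_field \<Longrightarrow> y \<in> base_field \<Longrightarrow> x - y \<in> base_field"
  "x \<in> base_field \<Longrightarrow> y \<in> base_field \<Longrightarrow> x * y \<in> base_field"
  "x \<in> base_field \<Longrightarrow> y \<in> base_field \<Longrightarrow> x / y \<in> base_field"
  "x \<in> base_field \<Longrightarrow> - x \<in> base_field"
  using q_gt_1 by (auto simp: base_field_def frob_add frob_diff frob_minus power_mult_distrib power_divide)

lemma exists_not_base_field: "\<exists>\<gamma> :: 'a. \<gamma> ^ q \<noteq> \<gamma>"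
proof (rule ccontr)
  assume "\<not> ?thesis"
  then have "base_field = UNIV"
    by (auto simp: base_field_def)
  then have "q ^ 2 = q"
    using card_base_field card_field by simp
  then show False
    using q_gt_1 by (simp add: power2_eq_square)
qed

text \<open>Each value of the norm is taken at most q + 1 times, so the q^2 - 1 nonzero elements
  have at least q - 1 norms, as many as there are nonzero elements of the subfield.\<close>

lemma norm_surj:
  assumes "z \<in> base_field"
  shows "\<exists>\<alpha>. \<alpha> ^ (q + 1) = z"
proof (cases "z = 0")
  case False
  let ?N = "\<lambda>x :: 'a. x ^ (q + 1)"
  have "q ^ 2 - 1 = (\<Sum>x\<in>UNIV - {0 :: 'a}. 1)"
    by (simp add: card_field card_Diff_singleton)
  also have "\<dots> = (\<Sum>y\<in>?N ` (UNIV - {0}). \<Sum>x\<in>{x \<in> UNIV - {0}. ?N x = y}. 1)"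
    by (rule sum.image_gen) simp
  also have "\<dots> \<le> (\<Sum>y\<in>?N ` (UNIV - {0}). q + 1)"
  proof (rule sum_mono)
    fix y :: 'a
    have "card {x \<in> UNIV - {0}. ?N x = y} \<le> card {x. ?N x = y}"
      by (intro card_mono) auto
    also have "\<dots> \<le> q + 1"
      by (rule card_power_fibre) simp
    finally show "(\<Sum>x\<in>{x \<in> UNIV - {0}. ?N x = y}. 1) \<le> q + 1"
      by simp
  qed
  finally have "(q - 1) * (q + 1) \<le> card (?N ` (UNIV - {0})) * (q + 1)"
    by (simp add: algebra_simps power2_eq_square)
  then have "q - 1 \<le> card (?N ` (UNIV - {0}))"
    by (metis mult_le_cancel2 add_gr_0 zero_less_one)
  moreover have sub: "?N ` (UNIV - {0}) \<subseteq> base_field - {0}"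
    by (auto simp: base_field_def power_mult_distrib frob_frob)
  moreover have "card (base_field - {0}) = q - 1"
    using base_field_closed(1) by (simp add: card_base_field card_Diff_singleton)
  ultimately have "?N ` (UNIV - {0}) = base_field - {0}"
    by (intro card_seteq) auto
  then show ?thesis
    using assms False by (metis (no_types, lifting) DiffI imageE singletonD)
qed (use q_gt_1 in auto)

text \<open>Otherwise x ^ (q + 1) = 1 would have q^2 - 1 > q + 1 solutions. For q = 2 both sides
  equal 3; this is where q > 2 enters.\<close>

lemma norm_not_one:
  assumes "q > 2"
  shows "\<exists>\<alpha> :: 'a. \<alpha> \<noteq> 0 \<and> \<alpha> ^ (q + 1) \<noteq> 1"
proof (rule ccontr)
  assume "\<not> ?thesis"
  then have "UNIV - {0} \<subseteq> {\<alpha> :: 'a. \<alpha> ^ (q + 1) = 1}"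
    by auto
  then have "card (UNIV - {0 :: 'a}) \<le> card {\<alpha> :: 'a. \<alpha> ^ (q + 1) = 1}"
    by (intro card_mono) auto
  also have "\<dots> \<le> q + 1"
    by (rule card_power_fibre) simp
  finally have "q * q \<le> q + 2"
    by (simp add: card_field card_Diff_singleton power2_eq_square)
  moreover have "3 * q \<le> q * q"
    using assms by simp
  ultimately show False
    using assms by linarith
qed

text \<open>The eigenvalues of a joint eigenvector of all translations form an additive character.
  This replaces the usual formula through the trace to the prime field; nontriviality is arranged by
  the choice of the start function.\<close>

lemma exists_character:
  "\<exists>\<psi> :: 'a \<Rightarrow> complex. (\<forall>x y. \<psi> (x + y) = \<psi> x * \<psi> y) \<and> (\<forall>x. norm (\<psi> x) = 1) \<and>
     (\<exists>x\<in>base_field. \<psi> x \<noteq> 1)"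
proof -
  let ?p = "CHAR('a)"
  have p: "prime ?p" "?p > 0"
    using char_power prime_gt_0_nat by auto
  \<comment> \<open>The factor 1 gives the translation the shape required by
    \<open>monomial_op\<close>.\<close>
  define T where "T a = (\<lambda>(f :: 'a \<Rightarrow> complex) u. 1 * f (u + a))" for a
  have T_power: "(T a ^^ n) f = (\<lambda>u. f (u + of_nat n * a))" for a n f
    by (induction n arbitrary: f) (simp_all add: T_def funpow_swap1 algebra_simps fun_eq_iff)
  have T_p: "(T a ^^ ?p) f = f" for a f
    by (simp add: T_power)
  define \<zeta> where "\<zeta> = cis (2 * pi / real ?p)"
  have \<zeta>_p: "\<zeta> ^ ?p = 1"
    using p by (simp add: \<zeta>_def DeMoivre)
  have "\<zeta> \<noteq> 1"
  proof
    assume "\<zeta> = 1"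
    then have "cis (2 * pi * real 1 / real ?p) = cis (2 * pi * real 0 / real ?p)"
      by (simp add: \<zeta>_def)
    moreover have "inj_on (\<lambda>k. cis (2 * pi * real k / real ?p)) {..<?p}"
      using bij_betw_roots_unity[OF p(2)] by (simp add: bij_betw_def)
    ultimately show False
      using prime_gt_1_nat[OF p(1)] by (metis inj_onD lessThan_iff p(2) zero_neq_one)
  qed
  have \<zeta>_mod: "\<zeta> ^ j = \<zeta> ^ (j mod ?p)" for j
    by (metis \<zeta>_p div_mult_mod_eq mult.commute mult_1 power_add power_mult power_one)
  have \<zeta>_cong: "\<zeta> ^ i = \<zeta> ^ j" if "(of_nat i :: 'a) = of_nat j" for i j
    using that \<zeta>_mod[of i] \<zeta>_mod[of j] by (simp add: of_nat_eq_iff_cong_CHAR cong_def)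
  \<comment> \<open>A nontrivial character of the prime field, extended by zero. By
    \<open>\<zeta>_cong\<close> the chosen representative does not matter.\<close>
  define f0 where "f0 x = (if x \<in> range of_nat then \<zeta> ^ (SOME j. of_nat j = x) else 0)" for x :: 'a
  have f0_nat: "f0 (of_nat j) = \<zeta> ^ j" for j
  proof -
    have "of_nat (SOME i. of_nat i = (of_nat j :: 'a)) = (of_nat j :: 'a)"
      by (rule someI[of "\<lambda>i. of_nat i = (of_nat j :: 'a)" j]) simp
    from \<zeta>_cong[OF this] show ?thesis
      by (simp add: f0_def)
  qed
  have f0_shift: "T 1 f0 = (\<lambda>u. \<zeta> * f0 u)"
  proof
    fix x :: 'a
    show "T 1 f0 x = \<zeta> * f0 x"
    proof (cases "x \<in> range of_nat")
      case True
      then obtain j where "x = of_nat j"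
        by auto
      then show ?thesis
        using f0_nat[of j] f0_nat[of "Suc j"] by (simp add: T_def add.commute)
    next
      case False
      have "x + 1 \<notin> range of_nat"
      proof
        assume "x + 1 \<in> range of_nat"
        then obtain j where "x + 1 = of_nat j"
          by auto
        \<comment> \<open>Adding \<open>?p - 1\<close> subtracts 1 without leaving the natural
          numbers.\<close>
        then have "x = of_nat (j + (?p - 1))"
          using p by (simp add: of_nat_diff algebra_simps)
        with False show False
          by blast
      qed
      with False show ?thesis
        by (simp add: T_def f0_def)
    qed
  qed
  have f0_nz: "f0 \<noteq> (\<lambda>_. 0)"
  proof
    assume "f0 = (\<lambda>_. 0)"
    with f0_nat[of 0] show False
      by simp
  qed
  have mono: "monomial_op (T a)" for a
    unfolding T_def by (rule monomial_opI)
  have comm: "T a (T b f) = T b (T a f)" for a b f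
    by (simp add: T_def add_ac)
  have "\<exists>n>0. \<forall>f. (T a ^^ n) f = f" for a
    using T_p p(2) by (intro exI[of _ ?p]) auto
  from joint_eigenvector[of UNIV f0 T, OF _ f0_nz mono comm this]
  obtain f where f: "f \<noteq> (\<lambda>_. 0)" "\<forall>a\<in>UNIV. \<exists>\<mu>. T a f = (\<lambda>u. \<mu> * f u)"
    and fB: "\<forall>B \<beta>. monomial_op B \<and> (\<forall>s\<in>UNIV. \<forall>f. T s (B f) = B (T s f)) \<and> B f0 = (\<lambda>u. \<beta> * f0 u)
       \<longrightarrow> B f = (\<lambda>u. \<beta> * f u)"
    by auto
  \<comment> \<open>\<open>f\<close> inherits the eigenvalue \<open>\<zeta>\<close> of
    \<open>f0\<close> under translation by 1, which makes the character nontrivial at 1, an element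
    of the subfield.\<close>
  have "\<forall>s\<in>UNIV. \<forall>f. T s (T 1 f) = T 1 (T s f)"
    by (intro ballI allI comm)
  then have f_1: "T 1 f = (\<lambda>u. \<zeta> * f u)"
    by (intro fB[THEN spec, THEN spec, of "T 1" \<zeta>, THEN mp] conjI mono f0_shift)
  from f(2) have "\<forall>a. \<exists>\<mu>. T a f = (\<lambda>u. \<mu> * f u)"
    by simp
  from choice[OF this] obtain \<mu> where \<mu>': "\<And>a. T a f = (\<lambda>u. \<mu> a * f u)"
    by auto
  have \<mu>: "f (u + a) = \<mu> a * f u" for a u
    using fun_cong[OF \<mu>'[of a], of u] by (simp add: T_def)
  obtain u where u: "f u \<noteq> 0"
    using f(1) by auto
  have \<mu>_add: "\<mu> (a + b) = \<mu> a * \<mu> b" for a b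
    using \<mu>[of u "a + b"] \<mu>[of "u + a" b] \<mu>[of u a] u by (simp add: add_ac)
  have "\<mu> 1 = \<zeta>"
    using \<mu>[of u 1] fun_cong[OF f_1, of u] u by (simp add: T_def)
  have \<mu>_0: "\<mu> 0 = 1"
    using \<mu>[of u 0] u by simp
  have \<mu>_nat: "\<mu> (of_nat n * a) = \<mu> a ^ n" for n a
    by (induction n) (simp_all add: \<mu>_0 \<mu>_add distrib_right)
  have norm_1: "norm (\<mu> a) = 1" for a
  proof -
    have "\<mu> a ^ ?p = 1"
      using \<mu>_nat[of ?p a] by (simp add: \<mu>_0)
    from power_eq_1_iff[OF this] show ?thesis
      using p(2) by simp
  qed
  show ?thesis
    by (intro exI[of _ \<mu>] conjI bexI[of _ 1])
      (use \<mu>_add norm_1 \<open>\<mu> 1 = \<zeta>\<close> \<open>\<zeta> \<noteq> 1\<close> base_field_closed in auto)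
qed

end

section \<open>Words and linear codes\<close>

lemma subspaceI:
  assumes "(\<lambda>_. 0) \<in> V" and "\<And>x y. x \<in> V \<Longrightarrow> y \<in> V \<Longrightarrow> (\<lambda>j. x j + y j) \<in> V"
    and "\<And>c x. x \<in> V \<Longrightarrow> (\<lambda>j. c * x j) \<in> V"
  shows "word_space.subspace V"
  using assms by (auto simp: word_space.subspace_def zero_fun_def plus_fun_def)

lemma
  assumes "word_space.subspace V"
  shows subspace_zero: "(\<lambda>_. 0) \<in> V"
    and subspace_add: "x \<in> V \<Longrightarrow> y \<in> V \<Longrightarrow> (\<lambda>j. x j + y j) \<in> V"
    and subspace_diff: "x \<in> V \<Longrightarrow> y \<in> V \<Longrightarrow> (\<lambda>j. x j - y j) \<in> V"
    and subspace_scale: "x \<in> V \<Longrightarrow> (\<lambda>j. c * x j) \<in> V"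
  using word_space.subspace_0[OF assms] word_space.subspace_add[OF assms, of x y]
    word_space.subspace_diff[OF assms, of x y] word_space.subspace_scale[OF assms, of x c]
  by (auto simp: zero_fun_def plus_fun_def fun_diff_def)

lemma subspace_linear_combination:
  fixes k :: nat
  assumes "word_space.subspace V" and "\<And>i. i < k \<Longrightarrow> u i \<in> V"
  shows "(\<lambda>j. \<Sum>i<k. w i * u i j) \<in> V"
  using assms(2)
proof (induction k)
  case 0
  then show ?case
    using subspace_zero[OF assms(1)] by simp
next
  case (Suc k)
  then show ?case
    using subspace_add[OF assms(1) Suc.IH subspace_scale[OF assms(1), of "u k" "w k"]] by simp
qed

text \<open>The letters are confined to a set \<open>F\<close> because two cases occur: the whole
  field for words of codes, the subfield for labels of basis states.\<close>

lemma card_words_over_valued: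
  fixes F :: "'a::{zero,finite} set"
  assumes "0 \<in> F"
  shows "card {x \<in> words_over n. \<forall>j. x j \<in> F} = card F ^ n"
proof -
  let ?W = "{x \<in> words_over n. \<forall>j. x j \<in> F}"
  have "bij_betw (\<lambda>x. restrict x {..<n}) ?W ({..<n} \<rightarrow>\<^sub>E F)"
  proof (rule bij_betw_byWitness[where f' = "\<lambda>x j. if j < n then x j else 0"])
    show "\<forall>x\<in>?W. (\<lambda>j. if j < n then restrict x {..<n} j else 0) = x"
      by (intro ballI ext) (simp add: words_over_def)
    show "\<forall>y\<in>{..<n} \<rightarrow>\<^sub>E F. restrict (\<lambda>j. if j < n then y j else 0) {..<n} = y"
      by (intro ballI ext) (simp add: PiE_def extensional_def restrict_def)
    show "(\<lambda>x. restrict x {..<n}) ` ?W \<subseteq> {..<n} \<rightarrow>\<^sub>E F"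
      by (intro image_subsetI restrict_PiE_iff[THEN iffD2]) simp
    show "(\<lambda>y j. if j < n then y j else 0) ` ({..<n} \<rightarrow>\<^sub>E F) \<subseteq> ?W"
      using assms by (intro image_subsetI CollectI conjI) (auto simp: words_over_def)
  qed
  then have "card {x \<in> words_over n. \<forall>j. x j \<in> F} = card ({..<n} \<rightarrow>\<^sub>E F)"
    by (rule bij_betw_same_card)
  then show ?thesis
    by (simp add: card_funcsetE)
qed

lemma card_words_over:
  "card (words_over n :: (nat \<Rightarrow> 'a::{zero,finite}) set) = card (UNIV :: 'a set) ^ n"
  using card_words_over_valued[of "UNIV :: 'a set" n] by simp

lemma finite_words_over: "finite (words_over n :: (nat \<Rightarrow> 'a::{zero,finite}) set)"
  by (rule card_ge_0_finite) (simp add: card_words_over finite_UNIV_card_ge_0)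

lemma card_span_independent:
  fixes B :: "(nat \<Rightarrow> 'a::{field,finite}) set"
  assumes "finite B" and "word_space.independent B"
  shows "card (word_space.span B) = card (UNIV :: 'a set) ^ card B"
  using assms
proof (induction B rule: finite_induct)
  case empty
  then show ?case
    by simp
next
  case (insert b B)
  have indep: "word_space.independent B" and b: "b \<notin> word_space.span B"
    using insert.prems insert.hyps(2) word_space.independent_insert[of b B] by simp_all
  let ?g = "\<lambda>(k, y). (\<lambda>j. k * b j) + y :: nat \<Rightarrow> 'a"
  have "inj_on ?g (UNIV \<times> word_space.span B)"
  proof (rule inj_onI, clarsimp)
    fix k y k' y'
    assume y: "y \<in> word_space.span B" "y' \<in> word_space.span B"
      and eq: "(\<lambda>j. k * b j) + y = (\<lambda>j. k' * b j) + y'"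
    have "(\<lambda>j. (k - k') * b j) = y' - y"
      using eq by (auto simp: fun_eq_iff algebra_simps)
    then have in_span: "(\<lambda>j. (k - k') * b j) \<in> word_space.span B"
      using y word_space.span_diff by metis
    have "k = k'"
    proof (rule ccontr)
      assume "k \<noteq> k'"
      then have "(\<lambda>j. inverse (k - k') * ((k - k') * b j)) = b"
        by (auto simp: fun_eq_iff)
      then have "b \<in> word_space.span B"
        using word_space.span_scale[OF in_span, of "inverse (k - k')"] by simp
      with b show False ..
    qed
    with eq show "k = k' \<and> y = y'"
      by simp
  qed
  moreover have "word_space.span (insert b B) = ?g ` (UNIV \<times> word_space.span B)"
  proof (intro equalityI subsetI)
    fix x assume "x \<in> word_space.span (insert b B)"
    then obtain k where "x - (\<lambda>j. k * b j) \<in> word_space.span B"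
      by (auto simp: word_space.span_insert)
    moreover have "x = (\<lambda>j. k * b j) + (x - (\<lambda>j. k * b j))"
      by simp
    ultimately show "x \<in> ?g ` (UNIV \<times> word_space.span B)"
      by (intro image_eqI[of _ _ "(k, x - (\<lambda>j. k * b j))"]) auto
  next
    fix x assume "x \<in> ?g ` (UNIV \<times> word_space.span B)"
    then obtain k y where "y \<in> word_space.span B" "x = (\<lambda>j. k * b j) + y"
      by auto
    then have "x - (\<lambda>j. k * b j) \<in> word_space.span B"
      by simp
    then show "x \<in> word_space.span (insert b B)"
      by (auto simp: word_space.span_insert)
  qed
  ultimately have "card (word_space.span (insert b B)) = card (UNIV :: 'a set) * card (word_space.span B)"
    by (simp add: card_image card_cartesian_product)
  with insert.IH[OF indep] insert.hyps show ?case
    by simp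
qed

text \<open>The bridge from the dimensions in the hypotheses to sizes: over a finite field each
  determines the other.\<close>

lemma card_subspace:
  fixes V :: "(nat \<Rightarrow> 'a::{field,finite}) set"
  assumes "word_space.subspace V" and "finite V"
  shows "card V = card (UNIV :: 'a set) ^ word_space.dim V"
proof -
  obtain B where B: "B \<subseteq> V" "word_space.independent B" "V \<subseteq> word_space.span B"
    "card B = word_space.dim V"
    using word_space.basis_exists by blast
  then have "word_space.span B = V"
    using assms(1) by (metis word_space.span_minimal subset_antisym)
  with B assms(2) card_span_independent[of B] show ?thesis
    using finite_subset by metis
qed

context quadratic_field
begin

text \<open>A linear functional is zero or takes all q^2 values. The inequality bounds the loss
  caused by one further equation on a hull; the equality makes the lowering of a hull exact.\<close>

lemma card_kernel_linear_functional:
  fixes V :: "(nat \<Rightarrow> 'a) set"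
  assumes V: "word_space.subspace V" "finite V"
    and add: "\<And>x y. \<phi> (\<lambda>j. x j + y j) = \<phi> x + \<phi> y"
    and scale: "\<And>c x. \<phi> (\<lambda>j. c * x j) = (c * \<phi> x :: 'a)"
  shows "card V \<le> card {x \<in> V. \<phi> x = 0} * q ^ 2"
    and "x0 \<in> V \<Longrightarrow> \<phi> x0 \<noteq> 0 \<Longrightarrow> card V = card {x \<in> V. \<phi> x = 0} * q ^ 2"
proof -
  have diff: "\<phi> (\<lambda>j. x j - y j) = \<phi> x - \<phi> y" for x y
    using add[of "\<lambda>j. x j - y j" y] by (simp add: algebra_simps)
  have eq: "card V = card {x \<in> V. \<phi> x = 0} * card (\<phi> ` V)"
    by (rule card_eq_card_kernel_times_card_image)
      (use assms subspace_add[OF V(1)] subspace_diff[OF V(1)] diff in \<open>auto simp: plus_fun_def fun_diff_def\<close>)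
  moreover have "card (\<phi> ` V) \<le> card (UNIV :: 'a set)"
    by (intro card_mono) auto
  ultimately show "card V \<le> card {x \<in> V. \<phi> x = 0} * q ^ 2"
    by (simp add: card_field)
  assume "x0 \<in> V" "\<phi> x0 \<noteq> 0"
  have "z \<in> \<phi> ` V" for z
  proof -
    have "z = \<phi> (\<lambda>j. (z / \<phi> x0) * x0 j)"
      using \<open>\<phi> x0 \<noteq> 0\<close> by (simp only: scale) simp
    with subspace_scale[OF V(1) \<open>x0 \<in> V\<close>] show ?thesis
      by blast
  qed
  then have "\<phi> ` V = UNIV"
    by blast
  with eq show "card V = card {x \<in> V. \<phi> x = 0} * q ^ 2"
    by (simp add: card_field)
qed

section \<open>Hermitian forms\<close>

definition herm :: "nat \<Rightarrow> (nat \<Rightarrow> 'a) \<Rightarrow> (nat \<Rightarrow> 'a) \<Rightarrow> 'a" where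
  "herm n x y = (\<Sum>j<n. x j * y j ^ q)"

section \<open>Sesquilinearity and conjugate symmetry of the form\<close>

lemma herm_add_left: "herm n (\<lambda>j. x j + y j) z = herm n x z + herm n y z"
  by (simp add: herm_def distrib_right sum.distrib)

lemma herm_add_right: "herm n z (\<lambda>j. x j + y j) = herm n z x + herm n z y"
  by (simp add: herm_def distrib_left sum.distrib frob_add)

lemma herm_scale_left: "herm n (\<lambda>j. c * x j) y = c * herm n x y"
  by (simp add: herm_def sum_distrib_left mult_ac)

lemma herm_scale_right: "herm n x (\<lambda>j. c * y j) = c ^ q * herm n x y"
  by (simp add: herm_def sum_distrib_left mult_ac power_mult_distrib)

lemma herm_conj: "herm n x y ^ q = herm n y x"
  by (simp add: herm_def frob_sum power_mult_distrib frob_frob mult.commute)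

lemma herm_diff_left: "herm n (\<lambda>j. x j - y j) z = herm n x z - herm n y z"
  by (simp add: herm_def left_diff_distrib sum_subtractf)

lemma herm_zero_left: "herm n (\<lambda>_. 0) y = 0"
  by (simp add: herm_def)

lemma herm_eq_0_commute: "herm n x y = 0 \<longleftrightarrow> herm n y x = 0"
  using herm_conj[of n x y] herm_conj[of n y x] q_gt_1 by (metis power_eq_0_iff)

lemma herm_linear_combination_left:
  "herm n (\<lambda>j. \<Sum>i<k. w i * u i j) y = (\<Sum>i<k. w i * herm n (u i) y)"
  by (simp add: herm_def sum_distrib_left sum_distrib_right mult.assoc) (rule sum.swap)

text \<open>Orthogonality is symmetric, so the dual word can be moved from the conjugated slot of
  the definition to the linear one.\<close>

lemma hermitian_dual_iff: "x \<in> hermitian_dual q n C \<longleftrightarrow> x \<in> words_over n \<and> (\<forall>y\<in>C. herm n x y = 0)"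
  using herm_eq_0_commute[of n x] by (auto simp: hermitian_dual_def herm_def)

lemma hermitian_hull_iff: "x \<in> hermitian_hull q n C \<longleftrightarrow> x \<in> C \<and> x \<in> words_over n \<and> (\<forall>y\<in>C. herm n x y = 0)"
  by (auto simp: hermitian_hull_def hermitian_dual_iff)

lemma subspace_hermitian_dual: "word_space.subspace (hermitian_dual q n C :: (nat \<Rightarrow> 'a) set)"
  by (rule subspaceI)
    (auto simp: hermitian_dual_iff herm_add_left herm_scale_left herm_zero_left words_over_def)

lemma subspace_hermitian_hull:
  "word_space.subspace C \<Longrightarrow> word_space.subspace (hermitian_hull q n C :: (nat \<Rightarrow> 'a) set)"
  unfolding hermitian_hull_def by (intro word_space.subspace_inter subspace_hermitian_dual)

text \<open>Double count of \<open>\<psi> (herm n x y)\<close> over \<open>x\<close> in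
  \<open>D\<close> and all words \<open>y\<close>. Summing over \<open>D\<close> first leaves the
  size of \<open>D\<close> for every \<open>y\<close> in the dual; summing over the words first
  leaves (q^2)^n for \<open>x\<close> = 0 alone.\<close>

lemma card_hermitian_dual:
  fixes D :: "(nat \<Rightarrow> 'a) set"
  assumes D: "word_space.subspace D" "D \<subseteq> words_over n"
  shows "card D * card (hermitian_dual q n D) = (q ^ 2) ^ n"
proof -
  obtain \<psi> :: "'a \<Rightarrow> complex" and t where \<psi>: "\<And>x y. \<psi> (x + y) = \<psi> x * \<psi> y" and t: "\<psi> t \<noteq> 1"
    and norm: "\<And>x. norm (\<psi> x) = 1"
    using exists_character by blast
  have "\<psi> 0 * \<psi> 0 = \<psi> 0"
    by (simp flip: \<psi>)
  then have \<psi>_0: "\<psi> 0 = 1"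
    using norm[of 0] by (metis mult_cancel_left2 norm_zero zero_neq_one)
  have dual_sub: "hermitian_dual q n D \<subseteq> words_over n"
    by (auto simp: hermitian_dual_iff)
  have 1: "(\<Sum>x\<in>D. \<psi> (herm n x y)) = (if y \<in> hermitian_dual q n D then of_nat (card D) else 0)"
    if "y \<in> words_over n" for y
  proof (cases "y \<in> hermitian_dual q n D")
    case True
    then have "herm n x y = 0" if "x \<in> D" for x
      using that herm_eq_0_commute[of n y x] by (simp add: hermitian_dual_iff)
    with True show ?thesis
      by (simp add: \<psi>_0)
  next
    case False
    with that obtain x where x: "x \<in> D" "herm n x y \<noteq> 0"
      using herm_eq_0_commute[of n y] by (auto simp: hermitian_dual_iff)
    let ?x = "\<lambda>j. (t / herm n x y) * x j"
    have "(\<Sum>x\<in>D. \<psi> (herm n x y)) = 0"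
    proof (rule sum_nontrivial_character)
      show "?x \<in> D"
        by (rule subspace_scale[OF D(1) x(1)])
      have "herm n ?x y = t"
        by (subst herm_scale_left) (use x in simp)
      then show "\<psi> (herm n ?x y) \<noteq> 1"
        using t by simp
    qed (use subspace_add[OF D(1)] subspace_diff[OF D(1)] in
        \<open>auto simp: plus_fun_def fun_diff_def herm_add_left \<psi>\<close>)
    with False show ?thesis
      by simp
  qed
  have 2: "(\<Sum>y\<in>words_over n. \<psi> (herm n x y)) = (if x = (\<lambda>_. 0) then of_nat ((q ^ 2) ^ n) else 0)"
    if "x \<in> D" for x
  proof (cases "x = (\<lambda>_. 0)")
    case True
    then show ?thesis
      by (simp add: herm_zero_left \<psi>_0 card_words_over card_field)
  next
    case False
    then obtain j where j: "x j \<noteq> 0"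
      by auto
    with that D(2) have "j < n"
      by (metis (mono_tags, lifting) mem_Collect_eq not_le subset_iff words_over_def)
    \<comment> \<open>The power \<open>q\<close> undoes the conjugation in the second slot, so that
      the form takes the value \<open>t\<close>.\<close>
    let ?y = "\<lambda>i. if i = j then (t / x j) ^ q else 0"
    have "(\<Sum>y\<in>words_over n. \<psi> (herm n x y)) = 0"
    proof (rule sum_nontrivial_character)
      show "?y \<in> words_over n"
        using \<open>j < n\<close> by (auto simp: words_over_def)
      have "herm n x ?y = (\<Sum>i<n. if i = j then t else 0)"
        unfolding herm_def by (intro sum.cong) (use j q_gt_1 in \<open>auto simp: frob_frob\<close>)
      then have "herm n x ?y = t"
        using \<open>j < n\<close> by simp
      then show "\<psi> (herm n x ?y) \<noteq> 1"
        using t by simp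
    qed (auto simp: words_over_def plus_fun_def herm_add_right \<psi>)
    with False show ?thesis
      by simp
  qed
  have "finite D"
    using D(2) finite_words_over finite_subset by blast
  have "of_nat (card D * card (hermitian_dual q n D)) =
      (\<Sum>y\<in>hermitian_dual q n D. of_nat (card D) :: complex)"
    by simp
  also have "\<dots> = (\<Sum>y\<in>words_over n. if y \<in> hermitian_dual q n D then of_nat (card D) else 0)"
    by (rule sum.mono_neutral_cong_left) (use dual_sub finite_words_over in auto)
  also have "\<dots> = (\<Sum>y\<in>words_over n. \<Sum>x\<in>D. \<psi> (herm n x y))"
    by (intro sum.cong) (simp_all add: 1)
  also have "\<dots> = (\<Sum>x\<in>D. \<Sum>y\<in>words_over n. \<psi> (herm n x y))"
    by (rule sum.swap)
  also have "\<dots> = (\<Sum>x\<in>D. if x = (\<lambda>_. 0) then of_nat ((q ^ 2) ^ n) else 0)"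
    by (intro sum.cong) (simp_all add: 2)
  also have "\<dots> = of_nat ((q ^ 2) ^ n)"
    using subspace_zero[OF D(1)] \<open>finite D\<close> by simp
  finally show ?thesis
    by (simp only: of_nat_eq_iff)
qed

text \<open>Symmetry of orthogonality gives one inclusion, and applying the size formula twice shows
  that the two sides are equally large.\<close>

lemma hermitian_dual_dual:
  fixes D :: "(nat \<Rightarrow> 'a) set"
  assumes D: "word_space.subspace D" "D \<subseteq> words_over n"
  shows "hermitian_dual q n (hermitian_dual q n D) = D"
proof -
  let ?E = "hermitian_dual q n D"
  have "?E \<subseteq> words_over n"
    by (auto simp: hermitian_dual_iff)
  then have "card ?E * card (hermitian_dual q n ?E) = card ?E * card D"
    using card_hermitian_dual[OF D] card_hermitian_dual[OF subspace_hermitian_dual, of n D]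
    by (simp add: mult.commute)
  moreover have "card ?E \<noteq> 0"
    using card_hermitian_dual[OF D] q_gt_1 by (metis mult_0_right power_not_zero not_one_less_zero)
  ultimately have "card (hermitian_dual q n ?E) = card D"
    by simp
  moreover have "D \<subseteq> hermitian_dual q n ?E"
  proof
    fix x assume "x \<in> D"
    then show "x \<in> hermitian_dual q n ?E"
      using D(2) herm_eq_0_commute[of n x] by (auto simp: hermitian_dual_iff)
  qed
  moreover have "finite (hermitian_dual q n ?E)"
    by (rule finite_subset[OF _ finite_words_over[of n]]) (auto simp: hermitian_dual_iff)
  ultimately show ?thesis
    by (metis card_subset_eq)
qed

text \<open>The coefficient map x -> (\<open>herm n x (u i)\<close>)_i has the complement as its
  kernel, and it is onto because the combination of the \<open>u i\<close> with coefficients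
  \<open>w\<close> is mapped to \<open>w\<close>.\<close>

lemma card_orthogonal_complement_orthonormal:
  fixes D :: "(nat \<Rightarrow> 'a) set"
  assumes D: "word_space.subspace D" "finite D"
    and u: "\<And>i. i < k \<Longrightarrow> u i \<in> D"
    and ortho: "\<And>i j. i < k \<Longrightarrow> j < k \<Longrightarrow> herm n (u i) (u j) = of_bool (i = j)"
  shows "card D = card {x \<in> D. \<forall>i<k. herm n x (u i) = 0} * (q ^ 2) ^ k"
proof -
  define f where "f x = (\<lambda>i. if i < k then herm n x (u i) else 0)" for x
  have "card D = card {x \<in> D. f x = 0} * card (f ` D)"
    by (rule card_eq_card_kernel_times_card_image)
      (use D(2) subspace_add[OF D(1)] subspace_diff[OF D(1)] in
        \<open>auto simp: plus_fun_def fun_diff_def f_def herm_add_left herm_diff_left fun_eq_iff\<close>)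
  moreover have "{x \<in> D. f x = 0} = {x \<in> D. \<forall>i<k. herm n x (u i) = 0}"
    by (auto simp: f_def fun_eq_iff)
  moreover have "f ` D = words_over k"
  proof (intro equalityI subsetI)
    fix w :: "nat \<Rightarrow> 'a" assume w: "w \<in> words_over k"
    let ?x = "\<lambda>j. \<Sum>i<k. w i * u i j"
    have "f ?x = w"
    proof
      fix i
      have "herm n ?x (u i) = (\<Sum>l<k. if l = i then w i else 0)" if "i < k"
        unfolding herm_linear_combination_left using that by (intro sum.cong) (auto simp: ortho)
      then show "f ?x i = w i"
        using w by (auto simp: f_def words_over_def)
    qed
    moreover have "?x \<in> D"
      by (rule subspace_linear_combination[OF D(1) u])
    ultimately show "w \<in> f ` D"
      by (intro image_eqI[of w f ?x]) simp_all
  qed (auto simp: f_def words_over_def)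
  ultimately show ?thesis
    by (simp add: card_words_over card_field)
qed

text \<open>Polarization, valid in every characteristic: expand the form at
  \<open>x + c * y\<close>. For \<open>c\<close> = 1 the two mixed terms are negatives of each
  other; for \<open>c\<close> = \<open>\<gamma>\<close> outside the subfield this forces them to
  vanish.\<close>

lemma totally_isotropic:
  fixes D :: "(nat \<Rightarrow> 'a) set"
  assumes D: "word_space.subspace D" and iso: "\<And>x. x \<in> D \<Longrightarrow> herm n x x = 0"
    and "x \<in> D" and "y \<in> D"
  shows "herm n x y = 0"
proof -
  obtain \<gamma> :: 'a where \<gamma>: "\<gamma> ^ q \<noteq> \<gamma>"
    using exists_not_base_field by blast
  have *: "c ^ q * herm n x y + c * herm n y x = 0" for c
  proof -
    have "herm n (\<lambda>j. x j + c * y j) (\<lambda>j. x j + c * y j) = 0"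
      by (intro iso subspace_add[OF D] subspace_scale[OF D] assms)
    then show ?thesis
      by (simp add: herm_add_left herm_add_right herm_scale_left herm_scale_right iso assms)
  qed
  from *[of 1] have "herm n y x = - herm n x y"
    by (simp add: add_eq_0_iff)
  with *[of \<gamma>] have "(\<gamma> ^ q - \<gamma>) * herm n x y = 0"
    by (simp add: algebra_simps)
  with \<gamma> show ?thesis
    by simp
qed

text \<open>
  A maximal orthonormal family in \<open>D\<close> splits off a totally isotropic complement, which must then be
  the radical of \<open>D\<close>.
\<close>

lemma orthonormal_basis_modulo_hull:
  fixes D :: "(nat \<Rightarrow> 'a) set"
  assumes D: "word_space.subspace D" "D \<subseteq> words_over n"
    and card_D: "card D = (q ^ 2) ^ m" and card_hull: "card (hermitian_hull q n D) = (q ^ 2) ^ r"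
  shows "\<exists>u. (\<forall>i<m - r. u i \<in> D) \<and> (\<forall>i<m - r. \<forall>j<m - r. herm n (u i) (u j) = of_bool (i = j)) \<and>
    (\<forall>x\<in>D. (\<forall>i<m - r. herm n x (u i) = 0) \<longrightarrow> x \<in> hermitian_hull q n D)"
proof -
  have Q: "q ^ 2 > 1"
    using one_less_power[OF q_gt_1, of 2] by simp
  have fin: "finite D"
    using D(2) finite_words_over finite_subset by blast
  define P where "P k \<longleftrightarrow> (\<exists>u. (\<forall>i<k. u i \<in> D) \<and> (\<forall>i<k. \<forall>j<k. herm n (u i) (u j) = of_bool (i = j)))" for k :: nat
  have bound: "k \<le> m" if "P k" for k
  proof -
    from that obtain u where "\<And>i. i < k \<Longrightarrow> u i \<in> D"
      "\<And>i j. i < k \<Longrightarrow> j < k \<Longrightarrow> herm n (u i) (u j) = of_bool (i = j)"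
      by (auto simp: P_def)
    from card_orthogonal_complement_orthonormal[OF D(1) fin this]
    have "(q ^ 2) ^ k dvd (q ^ 2) ^ m"
      by (simp add: card_D)
    then show ?thesis
      using Q by (simp add: power_dvd_imp_le)
  qed
  have "P 0"
    by (simp add: P_def)
  define k where "k = (GREATEST k. P k)"
  have "P k"
    unfolding k_def by (rule GreatestI_nat[of P 0 m, OF \<open>P 0\<close> bound])
  have max: "k' \<le> k" if "P k'" for k'
    unfolding k_def by (rule Greatest_le_nat[of P _ m, OF that bound])
  from \<open>P k\<close> obtain u where u: "\<And>i. i < k \<Longrightarrow> u i \<in> D"
      "\<And>i j. i < k \<Longrightarrow> j < k \<Longrightarrow> herm n (u i) (u j) = of_bool (i = j)"
    by (auto simp: P_def)
  define D' where "D' = {x \<in> D. \<forall>i<k. herm n x (u i) = 0}"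
  have D': "word_space.subspace D'"
    unfolding D'_def by (rule subspaceI)
      (use subspace_zero[OF D(1)] subspace_add[OF D(1)] subspace_scale[OF D(1)] in
        \<open>auto simp: herm_zero_left herm_add_left herm_scale_left\<close>)
  have iso: "herm n x x = 0" if x: "x \<in> D'" for x
  proof (rule ccontr)
    assume nz: "herm n x x \<noteq> 0"
    have "herm n x x \<in> base_field"
      by (simp add: base_field_def herm_conj)
    \<comment> \<open>The value \<open>herm n x x\<close> is its own conjugate, so by surjectivity
      of the norm a multiple of \<open>x\<close> has form value 1. It would enlarge the maximal
      family.\<close>
    then have "1 / herm n x x \<in> base_field"
      by (rule base_field_closed(6)[OF base_field_closed(2)])
    from norm_surj[OF this] obtain \<alpha> where \<alpha>: "\<alpha> ^ (q + 1) = 1 / herm n x x" ..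
    define v where "v = (\<lambda>i. if i = k then (\<lambda>j. \<alpha> * x j) else u i)"
    have "herm n (\<lambda>j. \<alpha> * x j) (\<lambda>j. \<alpha> * x j) = 1"
      using \<alpha> nz by (simp add: herm_scale_left herm_scale_right field_simps)
    moreover have "herm n (\<lambda>j. \<alpha> * x j) (u i) = 0" "herm n (u i) (\<lambda>j. \<alpha> * x j) = 0" if "i < k" for i
      using x that herm_eq_0_commute[of n "u i" x] by (simp_all add: D'_def herm_scale_left herm_scale_right)
    moreover have "(\<lambda>j. \<alpha> * x j) \<in> D"
      using x subspace_scale[OF D(1)] by (auto simp: D'_def)
    ultimately have "P (Suc k)"
      unfolding P_def by (intro exI[of _ v]) (auto simp: v_def less_Suc_eq u)
    from max[OF this] show False
      by simp
  qed
  have D'_hull: "D' = hermitian_hull q n D"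
  proof (intro equalityI subsetI)
    fix x assume x: "x \<in> D'"
    have "herm n x y = 0" if y: "y \<in> D" for y
    proof -
      \<comment> \<open>The orthogonal projection of \<open>y\<close> to the span of the family:
        \<open>x\<close> is orthogonal to it by definition of \<open>D'\<close>, and to the
        remainder because \<open>D'\<close> is totally isotropic.\<close>
      let ?p = "\<lambda>j. \<Sum>i<k. herm n y (u i) * u i j"
      have "(\<lambda>j. y j - ?p j) \<in> D"
        by (intro subspace_diff[OF D(1) y] subspace_linear_combination[OF D(1) u(1)])
      moreover have "herm n ?p (u l) = herm n y (u l)" if "l < k" for l
      proof -
        have "herm n ?p (u l) = (\<Sum>i<k. if i = l then herm n y (u i) else 0)"
          unfolding herm_linear_combination_left using that by (intro sum.cong) (auto simp: u)
        then show ?thesis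
          using that by simp
      qed
      ultimately have "(\<lambda>j. y j - ?p j) \<in> D'"
        by (simp add: D'_def herm_diff_left)
      then have "herm n (\<lambda>j. y j - ?p j) x = 0"
        using totally_isotropic[OF D' iso] x by blast
      moreover have "herm n ?p x = 0"
        unfolding herm_linear_combination_left
        using x herm_eq_0_commute[of n x] by (intro sum.neutral) (auto simp: D'_def)
      ultimately have "herm n y x = 0"
        by (simp add: herm_diff_left)
      then show ?thesis
        using herm_eq_0_commute by blast
    qed
    with x D(2) show "x \<in> hermitian_hull q n D"
      by (auto simp: hermitian_hull_iff D'_def)
  next
    fix x assume "x \<in> hermitian_hull q n D"
    then show "x \<in> D'"
      using u(1) by (auto simp: hermitian_hull_iff D'_def)
  qed
  \<comment> \<open>Comparing sizes identifies the length of the maximal family as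
    \<open>m - r\<close>.\<close>
  have "(q ^ 2) ^ m = (q ^ 2) ^ (r + k)"
    using card_orthogonal_complement_orthonormal[OF D(1) fin u] D'_hull
    by (simp add: card_D card_hull D'_def power_add)
  then have "m - r = k"
    using Q by (simp add: power_inject_exp)
  have "\<forall>x\<in>D. (\<forall>i<k. herm n x (u i) = 0) \<longrightarrow> x \<in> hermitian_hull q n D"
    unfolding D'_hull[symmetric] by (simp add: D'_def)
  with u show ?thesis
    unfolding \<open>m - r = k\<close> by (intro exI[of _ u]) simp
qed

end

section \<open>Generalized Reed-Solomon codes and their hulls\<close>

lemma exists_interpolation_poly:
  fixes a y :: "'b \<Rightarrow> 'a::field"
  assumes "finite T" and "inj_on a T"
  shows "\<exists>f. (f = 0 \<or> degree f < card T) \<and> (\<forall>j\<in>T. poly f (a j) = y j)"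
  using assms
proof (induction T rule: finite_induct)
  case empty
  then show ?case
    by auto
next
  case (insert t T)
  then obtain f where f: "f = 0 \<or> degree f < card T" "\<And>j. j \<in> T \<Longrightarrow> poly f (a j) = y j"
    by auto
  define g where "g = (\<Prod>j\<in>T. [:- a j, 1:])"
  have g_t: "poly g (a t) \<noteq> 0"
    using insert.prems insert.hyps by (auto simp: g_def poly_prod)
  have g_T: "poly g (a j) = 0" if "j \<in> T" for j
    using that insert.hyps by (auto simp: g_def poly_prod intro!: prod_zero)
  have "degree g \<le> card T"
    using degree_prod_sum_le[OF insert.hyps(1), of "\<lambda>j. [:- a j, 1:]"] by (simp add: g_def)
  \<comment> \<open>Newton's step: \<open>g\<close> vanishes at the old nodes and corrects the value
    at the new one.\<close>
  define f' where "f' = f + smult ((y t - poly f (a t)) / poly g (a t)) g"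
  have "degree f' \<le> card T"
    unfolding f'_def using f(1) \<open>degree g \<le> card T\<close>
    by (intro degree_add_le order.trans[OF degree_smult_le]) auto
  then have "degree f' < card (insert t T)"
    using insert.hyps by simp
  moreover have "poly f' (a j) = y j" if "j \<in> insert t T" for j
    using that f(2) g_t g_T by (auto simp: f'_def)
  ultimately show ?case
    by blast
qed

text \<open>Points and multipliers become arguments, since lengthening the code changes
  both.\<close>

definition grs :: "nat \<Rightarrow> nat \<Rightarrow> (nat \<Rightarrow> 'a::field) \<Rightarrow> (nat \<Rightarrow> 'a) \<Rightarrow> (nat \<Rightarrow> 'a) set" where
  "grs n k a v = {(\<lambda>j. if j < n then v j * poly f (a j) else 0) | f. f = 0 \<or> degree f < k}"

text \<open>For a code of dimension \<open>k\<close>, being full on \<open>k\<close> positions is the MDS property.\<close>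

definition full_on :: "nat \<Rightarrow> nat \<Rightarrow> (nat \<Rightarrow> 'a) set \<Rightarrow> bool" where
  "full_on n k C \<longleftrightarrow> (\<forall>T x. T \<subseteq> {..<n} \<and> card T \<le> k \<longrightarrow> (\<exists>c\<in>C. \<forall>j\<in>T. c j = x j))"

lemma full_onD:
  "full_on n k C \<Longrightarrow> T \<subseteq> {..<n} \<Longrightarrow> card T \<le> k \<Longrightarrow> \<exists>c\<in>C. \<forall>j\<in>T. c j = x j"
  unfolding full_on_def by blast

lemma grs_subset: "grs n k a v \<subseteq> words_over n"
  by (auto simp: grs_def words_over_def)

lemma degree_less_add:
  "f = 0 \<or> degree f < k \<Longrightarrow> g = 0 \<or> degree g < k \<Longrightarrow> f + g = 0 \<or> degree (f + g) < k"
  using degree_add_less[of f k g] by auto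

lemma subspace_grs: "word_space.subspace (grs n k a v)"
proof (rule subspaceI)
  show "(\<lambda>_. 0) \<in> grs n k a v"
    unfolding grs_def by (intro CollectI exI[of _ 0]) auto
next
  fix x y assume "x \<in> grs n k a v" "y \<in> grs n k a v"
  then obtain f g where fg: "f = 0 \<or> degree f < k" "g = 0 \<or> degree g < k"
    and xy: "x = (\<lambda>j. if j < n then v j * poly f (a j) else 0)"
      "y = (\<lambda>j. if j < n then v j * poly g (a j) else 0)"
    by (auto simp: grs_def)
  have "(\<lambda>j. x j + y j) = (\<lambda>j. if j < n then v j * poly (f + g) (a j) else 0)"
    by (rule ext) (simp add: xy algebra_simps)
  with degree_less_add[OF fg] show "(\<lambda>j. x j + y j) \<in> grs n k a v"
    unfolding grs_def by (intro CollectI exI[of _ "f + g"]) simp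
next
  fix c x assume "x \<in> grs n k a v"
  then obtain f where "f = 0 \<or> degree f < k" "x = (\<lambda>j. if j < n then v j * poly f (a j) else 0)"
    by (auto simp: grs_def)
  then show "(\<lambda>j. c * x j) \<in> grs n k a v"
    unfolding grs_def by (intro CollectI exI[of _ "smult c f"]) auto
qed

lemma full_on_grs:
  assumes "inj_on a {..<n}" and "\<forall>j<n. v j \<noteq> 0"
  shows "full_on n k (grs n k a v)"
  unfolding full_on_def
proof (intro allI impI, elim conjE)
  fix T and x :: "nat \<Rightarrow> 'a" assume T: "T \<subseteq> {..<n}" "card T \<le> k"
  then have "finite T" "inj_on a T"
    using assms(1) by (auto intro: finite_subset inj_on_subset)
  then obtain f where f: "f = 0 \<or> degree f < card T" "\<And>j. j \<in> T \<Longrightarrow> poly f (a j) = x j / v j"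
    using exists_interpolation_poly[of T a "\<lambda>j. x j / v j"] by auto
  let ?c = "\<lambda>j. if j < n then v j * poly f (a j) else 0"
  have "?c \<in> grs n k a v"
    using f(1) T(2) by (auto simp: grs_def)
  moreover have "\<forall>j\<in>T. ?c j = x j"
    using T(1) f(2) assms(2) by auto
  ultimately show "\<exists>c\<in>grs n k a v. \<forall>j\<in>T. c j = x j"
    by (intro bexI[of _ ?c])
qed

text \<open>The sum of \<open>C\<close> and the line through \<open>y\<close>. Lengthening at a
  finite point and at infinity both have this form, so one estimate of the hull serves both.\<close>

definition adjoin :: "(nat \<Rightarrow> 'a::field) set \<Rightarrow> (nat \<Rightarrow> 'a) \<Rightarrow> (nat \<Rightarrow> 'a) set" where
  "adjoin C y = {(\<lambda>j. c j + \<alpha> * y j) | c \<alpha>. c \<in> C}"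

lemma adjoinI: "c \<in> C \<Longrightarrow> (\<lambda>j. c j + \<alpha> * y j) \<in> adjoin C y"
  by (auto simp: adjoin_def)

lemma subspace_adjoin:
  assumes C: "word_space.subspace C"
  shows "word_space.subspace (adjoin C y)"
proof (rule subspaceI)
  show "(\<lambda>_. 0) \<in> adjoin C y"
    unfolding adjoin_def using subspace_zero[OF C] by (intro CollectI exI[of _ "\<lambda>_. 0"] exI[of _ 0]) auto
next
  fix x z assume "x \<in> adjoin C y" "z \<in> adjoin C y"
  then obtain c \<alpha> d \<beta> where "c \<in> C" "d \<in> C" "x = (\<lambda>j. c j + \<alpha> * y j)" "z = (\<lambda>j. d j + \<beta> * y j)"
    by (auto simp: adjoin_def)
  then show "(\<lambda>j. x j + z j) \<in> adjoin C y"
    unfolding adjoin_def using subspace_add[OF C]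
    by (intro CollectI exI[of _ "\<lambda>j. c j + d j"] exI[of _ "\<alpha> + \<beta>"]) (auto simp: algebra_simps)
next
  fix b x assume "x \<in> adjoin C y"
  then obtain c \<alpha> where "c \<in> C" "x = (\<lambda>j. c j + \<alpha> * y j)"
    by (auto simp: adjoin_def)
  then show "(\<lambda>j. b * x j) \<in> adjoin C y"
    unfolding adjoin_def using subspace_scale[OF C]
    by (intro CollectI exI[of _ "\<lambda>j. b * c j"] exI[of _ "b * \<alpha>"]) (auto simp: algebra_simps)
qed

text \<open>Division with remainder: a polynomial of degree at most \<open>k\<close> is (x - b) h +
  \<open>\<alpha>\<close>. At the old points the factor x - b turns the new multipliers back into
  the old ones; at \<open>b\<close> only \<open>\<alpha>\<close> remains. Hence \<open>y\<close> is
  the word of the constant 1.\<close>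

lemma adjoin_grs:
  fixes a v :: "nat \<Rightarrow> 'a::field"
  assumes b: "b \<notin> a ` {..<n}"
  defines "a' \<equiv> a(n := b)" and "v' \<equiv> (\<lambda>j. if j < n then v j / (a j - b) else 1)"
  defines "y \<equiv> (\<lambda>j. if j < Suc n then v' j else 0)"
  shows "grs (Suc n) (Suc k) a' v' = adjoin (grs n k a v) y"
proof (intro equalityI subsetI)
  have v': "v' j * (a j - b) = v j" if "j < n" for j
    using b that by (auto simp: v'_def)
  have word: "(\<lambda>j. if j < Suc n then v' j * poly ([:- b, 1:] * h + [:\<alpha>:]) (a' j) else 0) =
      (\<lambda>j. (if j < n then v j * poly h (a j) else 0) + \<alpha> * y j)" for h \<alpha>
  proof
    fix j
    show "(if j < Suc n then v' j * poly ([:- b, 1:] * h + [:\<alpha>:]) (a' j) else 0) =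
      (if j < n then v j * poly h (a j) else 0) + \<alpha> * y j"
    proof (cases "j < n")
      case True
      have "v' j * poly ([:- b, 1:] * h + [:\<alpha>:]) (a' j) = v' j * (a j - b) * poly h (a j) + \<alpha> * v' j"
        using True by (simp add: a'_def algebra_simps)
      with True show ?thesis
        by (simp add: v' y_def)
    next
      case False
      then show ?thesis
        by (auto simp: less_Suc_eq a'_def y_def)
    qed
  qed
  fix x
  {
    assume "x \<in> grs (Suc n) (Suc k) a' v'"
    then obtain f where f: "f = 0 \<or> degree f < Suc k"
      and x: "x = (\<lambda>j. if j < Suc n then v' j * poly f (a' j) else 0)"
      by (auto simp: grs_def)
    have f_eq: "f = [:- b, 1:] * synthetic_div f b + [:poly f b:]"
      by (rule synthetic_div_correct'[symmetric])
    have "synthetic_div f b = 0 \<or> degree (synthetic_div f b) < k"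
      using f by (auto simp: degree_synthetic_div synthetic_div_eq_0_iff)
    then have c: "(\<lambda>j. if j < n then v j * poly (synthetic_div f b) (a j) else 0) \<in> grs n k a v"
      by (auto simp: grs_def)
    have "x = (\<lambda>j. (if j < n then v j * poly (synthetic_div f b) (a j) else 0) + poly f b * y j)"
      unfolding x by (subst f_eq) (rule word)
    with adjoinI[OF c] show "x \<in> adjoin (grs n k a v) y"
      by simp
  }
  {
    assume "x \<in> adjoin (grs n k a v) y"
    then obtain h \<alpha> where h: "h = 0 \<or> degree h < k"
      and x: "x = (\<lambda>j. (if j < n then v j * poly h (a j) else 0) + \<alpha> * y j)"
      by (auto simp: adjoin_def grs_def)
    have "degree ([:- b, 1:] * h + [:\<alpha>:]) < Suc k"
    proof (rule degree_add_less)
      show "degree ([:- b, 1:] * h) < Suc k"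
        using h degree_mult_le[of "[:- b, 1:]" h] by (cases "h = 0") auto
    qed simp
    then show "x \<in> grs (Suc n) (Suc k) a' v'"
      unfolding x word[symmetric] grs_def
      by (intro CollectI exI[of _ "[:- b, 1:] * h + [:\<alpha>:]"]) simp
  }
qed

text \<open>
  The point at infinity: its coordinate is the coefficient of degree \<open>k\<close>, and \<open>y\<close> is the word of
  the monomial of degree \<open>k\<close>.
\<close>

lemma full_on_adjoin_infinity:
  fixes a v :: "nat \<Rightarrow> 'a::field" and n k :: nat
  assumes a: "inj_on a {..<n}" and v: "\<forall>j<n. v j \<noteq> 0"
  defines "y \<equiv> (\<lambda>j. if j < n then v j * a j ^ k else if j = n then 1 else 0)"
  shows "full_on (Suc n) (Suc k) (adjoin (grs n k a v) y)"
  unfolding full_on_def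
proof (intro allI impI, elim conjE)
  fix T and x :: "nat \<Rightarrow> 'a" assume T: "T \<subseteq> {..<Suc n}" "card T \<le> Suc k"
  have fin: "finite T"
    using T(1) finite_subset by blast
  show "\<exists>c\<in>adjoin (grs n k a v) y. \<forall>j\<in>T. c j = x j"
  proof (cases "n \<in> T")
    \<comment> \<open>The value at infinity determines the coefficient of \<open>y\<close>;
      interpolation in degree below \<open>k\<close> serves the remaining positions, at most
      \<open>k\<close> in number.\<close>
    case True
    have "T - {n} \<subseteq> {..<n}" "card (T - {n}) \<le> k"
      using T True fin by (auto simp: less_Suc_eq card_Diff_singleton)
    from full_onD[OF full_on_grs[OF a v] this, of "\<lambda>j. x j - x n * y j"]
    obtain c where c: "c \<in> grs n k a v" "\<And>j. j \<in> T - {n} \<Longrightarrow> c j = x j - x n * y j"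
      by auto
    have "c n = 0"
      using c(1) grs_subset by (fastforce simp: words_over_def)
    have "c j + x n * y j = x j" if "j \<in> T" for j
    proof (cases "j = n")
      case True
      then show ?thesis
        using \<open>c n = 0\<close> by (simp add: y_def)
    next
      case False
      then show ?thesis
        using c(2)[of j] that by simp
    qed
    with adjoinI[OF c(1), of "x n" y] show ?thesis
      by (intro bexI[of _ "\<lambda>j. c j + x n * y j"]) simp_all
  next
    \<comment> \<open>All positions are finite, so interpolation in degree at most \<open>k\<close>
      suffices, and splitting off the term of degree \<open>k\<close> exhibits the word in
      \<open>adjoin\<close>.\<close>
    case False
    then have "T \<subseteq> {..<n}"
      using T(1) by (auto simp: less_Suc_eq)
    from full_onD[OF full_on_grs[OF a v] this T(2), of x]
    obtain c where c: "c \<in> grs n (Suc k) a v" "\<And>j. j \<in> T \<Longrightarrow> c j = x j"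
      by auto
    then obtain f where f: "f = 0 \<or> degree f < Suc k"
      and cf: "c = (\<lambda>j. if j < n then v j * poly f (a j) else 0)"
      by (auto simp: grs_def)
    define h where "h = f - monom (coeff f k) k"
    have "degree h \<le> k"
      unfolding h_def using f by (intro degree_diff_le degree_monom_le) auto
    moreover have "coeff h k = 0"
      by (simp add: h_def)
    ultimately have "h = 0 \<or> degree h < k"
      by (metis le_neq_implies_less leading_coeff_0_iff)
    then have "(\<lambda>j. if j < n then v j * poly h (a j) else 0) \<in> grs n k a v"
      by (auto simp: grs_def)
    from adjoinI[OF this]
    have "(\<lambda>j. (if j < n then v j * poly h (a j) else 0) + coeff f k * y j) \<in> adjoin (grs n k a v) y" .
    moreover have "(if j < n then v j * poly h (a j) else 0) + coeff f k * y j = x j" if "j \<in> T" for j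
      using that \<open>T \<subseteq> {..<n}\<close> c(2)[OF that]
      by (auto simp: cf h_def y_def poly_monom algebra_simps)
    ultimately show ?thesis
      by (intro bexI[of _ "\<lambda>j. (if j < n then v j * poly h (a j) else 0) + coeff f k * y j"]) auto
  qed
qed

context quadratic_field
begin

text \<open>
  Since \<open>C\<close> is contained in \<open>adjoin C y\<close>, a word of the hull of \<open>C\<close> stays in the hull as soon as it
  is orthogonal to \<open>y\<close>.
\<close>

lemma hull_adjoin:
  fixes C :: "(nat \<Rightarrow> 'a) set"
  assumes C: "word_space.subspace C" "C \<subseteq> words_over n"
    and y: "y \<in> words_over (Suc n)" "y n \<noteq> 0"
  shows "card (adjoin C y) = q ^ 2 * card C"
    and "card (hermitian_hull q n C) \<le> card (hermitian_hull q (Suc n) (adjoin C y)) * q ^ 2"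
    and "adjoin C y \<subseteq> words_over (Suc n)"
proof -
  have C_n: "c n = 0" if "c \<in> C" for c
    using that C(2) by (auto simp: words_over_def)
  show sub: "adjoin C y \<subseteq> words_over (Suc n)"
    using C(2) y(1) by (fastforce simp: adjoin_def words_over_def)
  let ?g = "\<lambda>(\<alpha>, c). (\<lambda>j. c j + \<alpha> * y j)"
  have "inj_on ?g (UNIV \<times> C)"
  proof (rule inj_onI, clarsimp)
    fix \<alpha> c \<beta> d assume cd: "c \<in> C" "d \<in> C" and eq: "(\<lambda>j. c j + \<alpha> * y j) = (\<lambda>j. d j + \<beta> * y j)"
    \<comment> \<open>Words of \<open>C\<close> vanish at position \<open>n\<close> and
      \<open>y\<close> does not, so the coefficient of \<open>y\<close> can be read off
      there.\<close>
    from fun_cong[OF eq, of n] have "\<alpha> = \<beta>"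
      using y(2) by (simp add: C_n cd)
    with eq show "\<alpha> = \<beta> \<and> c = d"
      by (simp add: fun_eq_iff)
  qed
  moreover have "adjoin C y = ?g ` (UNIV \<times> C)"
    by (auto simp: adjoin_def)
  ultimately show "card (adjoin C y) = q ^ 2 * card C"
    by (simp add: card_image card_cartesian_product card_field)
  let ?H = "{x \<in> hermitian_hull q n C. herm (Suc n) x y = 0}"
  have fin: "finite (hermitian_hull q n' D)" for n' and D :: "(nat \<Rightarrow> 'a) set"
    by (rule finite_subset[OF _ finite_words_over[of n']]) (auto simp: hermitian_hull_iff)
  have "card (hermitian_hull q n C) \<le> card ?H * q ^ 2"
    by (rule card_kernel_linear_functional(1)[OF subspace_hermitian_hull[OF C(1)] fin])
      (simp_all add: herm_add_left herm_scale_left)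
  also have "card ?H \<le> card (hermitian_hull q (Suc n) (adjoin C y))"
  proof (rule card_mono[OF fin], intro subsetI)
    fix x assume x: "x \<in> ?H"
    then have xC: "x \<in> C"
      by (simp add: hermitian_hull_iff)
    have "x = (\<lambda>j. x j + 0 * y j)"
      by simp
    with adjoinI[OF xC, of 0 y] have "x \<in> adjoin C y"
      by simp
    moreover have "herm (Suc n) x z = 0" if "z \<in> adjoin C y" for z
    proof -
      from that obtain c \<alpha> where c: "c \<in> C" and z: "z = (\<lambda>j. c j + \<alpha> * y j)"
        by (auto simp: adjoin_def)
      have "herm (Suc n) x c = herm n x c"
        by (simp add: herm_def C_n xC)
      also have "\<dots> = 0"
        using x c by (simp add: hermitian_hull_iff)
      finally show ?thesis
        using x by (simp add: z herm_add_right herm_scale_right)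
    qed
    ultimately show "x \<in> hermitian_hull q (Suc n) (adjoin C y)"
      using sub by (auto simp: hermitian_hull_iff)
  qed
  finally show "card (hermitian_hull q n C) \<le> card (hermitian_hull q (Suc n) (adjoin C y)) * q ^ 2"
    by simp
qed

lemma grs_extend_finite:
  fixes a v :: "nat \<Rightarrow> 'a"
  assumes "inj_on a {..<n}" and "\<forall>j<n. v j \<noteq> 0" and "n + i \<le> q ^ 2"
  shows "\<exists>a' v' :: nat \<Rightarrow> 'a. inj_on a' {..<n + i} \<and> (\<forall>j<n + i. v' j \<noteq> 0) \<and>
    card (grs (n + i) (k + i) a' v') = (q ^ 2) ^ i * card (grs n k a v) \<and>
    card (hermitian_hull q n (grs n k a v)) \<le> card (hermitian_hull q (n + i) (grs (n + i) (k + i) a' v')) * (q ^ 2) ^ i"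
  using assms(3)
proof (induction i)
  case 0
  with assms show ?case
    by (rule_tac x = a in exI, rule_tac x = v in exI) simp
next
  case (Suc i)
  let ?n = "n + i" and ?k = "k + i"
  from Suc obtain a' v' :: "nat \<Rightarrow> 'a" where a': "inj_on a' {..<?n}" and v': "\<forall>j<?n. v' j \<noteq> 0"
    and card: "card (grs ?n ?k a' v') = (q ^ 2) ^ i * card (grs n k a v)"
    and hull: "card (hermitian_hull q n (grs n k a v)) \<le> card (hermitian_hull q ?n (grs ?n ?k a' v')) * (q ^ 2) ^ i"
    by auto
  have "card (a' ` {..<?n}) = ?n"
    using a' by (simp add: card_image)
  then have "a' ` {..<?n} \<noteq> UNIV"
    using Suc.prems card_field by auto
  then obtain b where b: "b \<notin> a' ` {..<?n}"
    by blast
  define a2 where "a2 = a'(?n := b)"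
  define v2 where "v2 = (\<lambda>j. if j < ?n then v' j / (a' j - b) else 1)"
  define y where "y = (\<lambda>j. if j < Suc ?n then v2 j else 0)"
  have ext: "grs (Suc ?n) (Suc ?k) a2 v2 = adjoin (grs ?n ?k a' v') y"
    unfolding a2_def v2_def y_def by (rule adjoin_grs[OF b])
  have y: "y \<in> words_over (Suc ?n)" "y ?n \<noteq> 0"
    by (auto simp: y_def words_over_def v2_def)
  note step = hull_adjoin[OF subspace_grs grs_subset y, of ?k a' v', folded ext]
  have "inj_on a2 {..<Suc ?n}"
    using a' b unfolding a2_def lessThan_Suc by (auto simp: inj_on_def)
  moreover have "v2 j \<noteq> 0" if "j < Suc ?n" for j
    using that v' b by (auto simp: v2_def)
  moreover have "card (hermitian_hull q n (grs n k a v)) \<le>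
      card (hermitian_hull q (Suc ?n) (grs (Suc ?n) (Suc ?k) a2 v2)) * (q ^ 2) ^ Suc i"
    using order.trans[OF hull mult_le_mono1[OF step(2)]] by (simp add: mult.assoc)
  ultimately show ?case
    using step(1) card by (rule_tac x = a2 in exI, rule_tac x = v2 in exI) (simp add: mult.assoc)
qed

text \<open>Besides the q^2 field elements there is the point at infinity, which explains the bound
  q^2 + 1. It is used only as the last point. As the result need not have the form
  \<open>grs\<close> then, only its linearity, size, hull and \<open>full_on\<close> are
  recorded.\<close>

lemma grs_extend:
  fixes C :: "(nat \<Rightarrow> 'a) set"
  assumes "is_grs_code n k C" and "i \<le> q ^ 2 + 1 - n"
  shows "\<exists>C' :: (nat \<Rightarrow> 'a) set. word_space.subspace C' \<and> C' \<subseteq> words_over (n + i) \<and> full_on (n + i) (k + i) C' \<and>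
    card C' = (q ^ 2) ^ i * card C \<and>
    card (hermitian_hull q n C) \<le> card (hermitian_hull q (n + i) C') * (q ^ 2) ^ i"
proof -
  from assms(1) obtain a v where a: "inj_on a {..<n}" and v: "\<forall>j<n. v j \<noteq> 0"
    and C: "C = grs n k a v"
    by (auto simp: is_grs_code_def grs_def)
  have "card (a ` {..<n}) \<le> card (UNIV :: 'a set)"
    by (intro card_mono) auto
  then have n: "n \<le> q ^ 2"
    using a by (simp add: card_image card_field)
  show ?thesis
  proof (cases "n + i \<le> q ^ 2")
    case True
    from grs_extend_finite[OF a v True, where k = k] obtain a' v' :: "nat \<Rightarrow> 'a" where
      "inj_on a' {..<n + i}" "\<forall>j<n + i. v' j \<noteq> 0"
      "card (grs (n + i) (k + i) a' v') = (q ^ 2) ^ i * card C"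
      "card (hermitian_hull q n C) \<le> card (hermitian_hull q (n + i) (grs (n + i) (k + i) a' v')) * (q ^ 2) ^ i"
      unfolding C by blast
    then show ?thesis
      by (intro exI[of _ "grs (n + i) (k + i) a' v'"] conjI subspace_grs grs_subset full_on_grs)
  next
    case False
    with assms(2) n have "0 < i"
      by auto
    then obtain i' where i: "i = Suc i'"
      by (cases i) auto
    have i': "n + i' \<le> q ^ 2"
      using assms(2) n i by auto
    let ?n = "n + i'" and ?k = "k + i'"
    from grs_extend_finite[OF a v i', where k = k] obtain a' v' :: "nat \<Rightarrow> 'a" where
      a': "inj_on a' {..<?n}" and v': "\<forall>j<?n. v' j \<noteq> 0"
      and card: "card (grs ?n ?k a' v') = (q ^ 2) ^ i' * card C"
      and hull: "card (hermitian_hull q n C) \<le> card (hermitian_hull q ?n (grs ?n ?k a' v')) * (q ^ 2) ^ i'"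
      unfolding C by blast
    define y where "y = (\<lambda>j. if j < ?n then v' j * a' j ^ ?k else if j = ?n then 1 else 0)"
    have y: "y \<in> words_over (Suc ?n)" "y ?n \<noteq> 0"
      by (auto simp: y_def words_over_def)
    note step = hull_adjoin[OF subspace_grs grs_subset y, of ?k a' v']
    have "full_on (Suc ?n) (Suc ?k) (adjoin (grs ?n ?k a' v') y)"
      unfolding y_def by (rule full_on_adjoin_infinity[OF a' v'])
    moreover have "card (hermitian_hull q n C) \<le>
        card (hermitian_hull q (Suc ?n) (adjoin (grs ?n ?k a' v') y)) * (q ^ 2) ^ Suc i'"
      using order.trans[OF hull mult_le_mono1[OF step(2)]] by (simp add: mult.assoc)
    ultimately show ?thesis
      using step(1,3) card subspace_adjoin[OF subspace_grs] unfolding i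
      by (intro exI[of _ "adjoin (grs ?n ?k a' v') y"]) (simp add: mult.assoc)
  qed
qed

text \<open>
  Scaling a coordinate in which some hull word is nonzero by \<open>\<alpha>\<close> with \<open>\<alpha> ^ (q + 1) \<noteq> 1\<close> leaves
  exactly the hull words vanishing in that coordinate.
\<close>

lemma reduce_hull:
  fixes C :: "(nat \<Rightarrow> 'a) set"
  assumes "q > 2" and C: "word_space.subspace C" "C \<subseteq> words_over n" and full: "full_on n k C"
    and hull: "card (hermitian_hull q n C) = (q ^ 2) ^ Suc h"
  shows "\<exists>C' :: (nat \<Rightarrow> 'a) set. word_space.subspace C' \<and> C' \<subseteq> words_over n \<and> full_on n k C' \<and> card C' = card C \<and>
    card (hermitian_hull q n C') = (q ^ 2) ^ h"
proof -
  obtain \<alpha> :: 'a where \<alpha>: "\<alpha> \<noteq> 0" "\<alpha> ^ (q + 1) \<noteq> 1"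
    using norm_not_one[OF \<open>q > 2\<close>] by blast
  let ?H = "hermitian_hull q n C"
  have fin: "finite ?H"
    by (rule finite_subset[OF _ finite_words_over[of n]]) (auto simp: hermitian_hull_iff)
  have "\<not> ?H \<subseteq> {\<lambda>_. 0}"
  proof
    assume "?H \<subseteq> {\<lambda>_. 0}"
    then have "card ?H \<le> card {(\<lambda>_. 0) :: nat \<Rightarrow> 'a}"
      by (intro card_mono) auto
    moreover have "(q ^ 2) ^ Suc h > 1"
      using one_less_power[OF one_less_power[OF q_gt_1, of 2], of "Suc h"] by simp
    ultimately show False
      using hull by simp
  qed
  then obtain h0 j where h0: "h0 \<in> ?H" "h0 j \<noteq> 0"
    by auto
  then have "j < n"
    by (metis (mono_tags, lifting) hermitian_hull_iff mem_Collect_eq not_le words_over_def)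
  define g where "g x = (\<lambda>i. if i = j then \<alpha> * x i else x i)" for x :: "nat \<Rightarrow> 'a"
  have inj: "inj_on g D" for D
  proof (rule inj_onI, rule ext)
    fix x y i assume "g x = g y"
    then have "g x i = g y i"
      by simp
    with \<alpha>(1) show "x i = y i"
      by (simp add: g_def split: if_splits)
  qed
  have g_add: "g (\<lambda>i. x i + y i) = (\<lambda>i. g x i + g y i)" for x y
    by (auto simp: g_def fun_eq_iff algebra_simps)
  have g_scale: "g (\<lambda>i. c * x i) = (\<lambda>i. c * g x i)" for c x
    by (auto simp: g_def fun_eq_iff algebra_simps)
  have g_zero: "g (\<lambda>_. 0) = (\<lambda>_. 0)"
    by (auto simp: g_def fun_eq_iff)
  have g_words: "g x \<in> words_over n \<longleftrightarrow> x \<in> words_over n" for x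
    using \<alpha>(1) \<open>j < n\<close> by (auto simp: g_def words_over_def)
  \<comment> \<open>Rescaling disturbs the form by a rank-one term supported on the coordinate
    \<open>j\<close>.\<close>
  have herm_g: "herm n (g x) (g y) = herm n x y + (\<alpha> ^ (q + 1) - 1) * x j * y j ^ q" for x y
  proof -
    have "herm n (g x) (g y) = (\<Sum>i<n. x i * y i ^ q + (if i = j then (\<alpha> ^ (q + 1) - 1) * x j * y j ^ q else 0))"
      unfolding herm_def by (intro sum.cong) (auto simp: g_def power_mult_distrib algebra_simps)
    then show ?thesis
      using \<open>j < n\<close> by (simp add: sum.distrib herm_def)
  qed
  have sub: "word_space.subspace (g ` C)"
  proof (rule subspaceI)
    show "(\<lambda>_. 0) \<in> g ` C"
      using subspace_zero[OF C(1)] g_zero by (intro image_eqI[of _ g "\<lambda>_. 0"]) simp_all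
  next
    fix x y assume "x \<in> g ` C" "y \<in> g ` C"
    then show "(\<lambda>i. x i + y i) \<in> g ` C"
      using subspace_add[OF C(1)] by (auto simp flip: g_add)
  next
    fix c x assume "x \<in> g ` C"
    then show "(\<lambda>i. c * x i) \<in> g ` C"
      using subspace_scale[OF C(1)] by (auto simp flip: g_scale)
  qed
  have full': "full_on n k (g ` C)"
    unfolding full_on_def
  proof (intro allI impI, elim conjE)
    fix T and x :: "nat \<Rightarrow> 'a" assume T: "T \<subseteq> {..<n}" "card T \<le> k"
    from full_onD[OF full this, of "\<lambda>i. if i = j then x i / \<alpha> else x i"]
    obtain c where c: "c \<in> C" "\<And>i. i \<in> T \<Longrightarrow> c i = (if i = j then x i / \<alpha> else x i)"
      by blast
    then have "g c i = x i" if "i \<in> T" for i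
      using that \<alpha>(1) by (auto simp: g_def)
    with c(1) show "\<exists>c\<in>g ` C. \<forall>i\<in>T. c i = x i"
      by blast
  qed
  have hull_eq: "hermitian_hull q n (g ` C) = g ` {x \<in> ?H. x j = 0}"
  proof (intro equalityI subsetI)
    fix z assume z: "z \<in> hermitian_hull q n (g ` C)"
    then obtain x where x: "x \<in> C" "z = g x"
      by (auto simp: hermitian_hull_iff)
    have *: "herm n x y + (\<alpha> ^ (q + 1) - 1) * x j * y j ^ q = 0" if "y \<in> C" for y
      using z that unfolding herm_g[symmetric] by (simp add: hermitian_hull_iff x(2))
    \<comment> \<open>Testing against \<open>h0\<close>, a hull word with nonzero entry at
      \<open>j\<close>, isolates the disturbance and forces \<open>x j\<close> = 0.\<close>
    have "herm n x h0 = 0"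
      using h0(1) x(1) herm_eq_0_commute[of n x h0] by (simp add: hermitian_hull_iff)
    moreover have "h0 \<in> C"
      using h0(1) by (simp add: hermitian_hull_iff)
    ultimately have "(\<alpha> ^ (q + 1) - 1) * x j * h0 j ^ q = 0"
      using *[of h0] by simp
    then have "x j = 0"
      using \<alpha>(2) h0(2) by simp
    then have "x \<in> {x \<in> ?H. x j = 0}"
      using * x(1) C(2) by (auto simp: hermitian_hull_iff)
    then show "z \<in> g ` {x \<in> ?H. x j = 0}"
      by (simp add: x(2))
  next
    fix z assume "z \<in> g ` {x \<in> ?H. x j = 0}"
    then obtain x where x: "x \<in> ?H" "x j = 0" "z = g x"
      by auto
    then show "z \<in> hermitian_hull q n (g ` C)"
      by (auto simp: hermitian_hull_iff herm_g g_words)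
  qed
  have "card ?H = card {x \<in> ?H. x j = 0} * q ^ 2"
    by (rule card_kernel_linear_functional(2)[of ?H "\<lambda>x. x j" h0])
      (simp_all add: subspace_hermitian_hull[OF C(1)] fin h0)
  then have "card {x \<in> ?H. x j = 0} = (q ^ 2) ^ h"
    using hull q_gt_1 by simp
  then have "card (hermitian_hull q n (g ` C)) = (q ^ 2) ^ h"
    by (simp add: hull_eq card_image[OF inj])
  moreover have "g ` C \<subseteq> words_over n"
    using C(2) g_words by auto
  ultimately show ?thesis
    using sub full' card_image[OF inj, of C] by (intro exI[of _ "g ` C"]) auto
qed

lemma reduce_hull_to:
  fixes C :: "(nat \<Rightarrow> 'a) set"
  assumes "q > 2" and "word_space.subspace C" "C \<subseteq> words_over n" "full_on n k C"
    and "card (hermitian_hull q n C) = (q ^ 2) ^ (s + m)"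
  shows "\<exists>C' :: (nat \<Rightarrow> 'a) set. word_space.subspace C' \<and> C' \<subseteq> words_over n \<and> full_on n k C' \<and> card C' = card C \<and>
    card (hermitian_hull q n C') = (q ^ 2) ^ s"
  using assms(2-5)
proof (induction m arbitrary: C)
  case (Suc m)
  then have "card (hermitian_hull q n C) = (q ^ 2) ^ Suc (s + m)"
    by simp
  from reduce_hull[OF \<open>q > 2\<close> Suc.prems(1-3) this] obtain C1 :: "(nat \<Rightarrow> 'a) set" where
    C1: "word_space.subspace C1" "C1 \<subseteq> words_over n" "full_on n k C1" "card C1 = card C"
    "card (hermitian_hull q n C1) = (q ^ 2) ^ (s + m)"
    by auto
  from Suc.IH[OF C1(1-3,5)] show ?case
    by (simp add: C1(4))
qed auto

text \<open>The extension only guarantees a hull dimension \<open>h\<close> with \<open>h\<close> >=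
  \<open>l - i\<close> >= \<open>s\<close>. Whatever \<open>h\<close> is, lowering it
  \<open>h - s\<close> times reaches \<open>s\<close>.\<close>

lemma grs_extend_with_hull:
  fixes C :: "(nat \<Rightarrow> 'a) set"
  assumes "q > 2" and "is_grs_code n k C" and "i \<le> q ^ 2 + 1 - n" and "card C = (q ^ 2) ^ k"
    and "card (hermitian_hull q n C) = (q ^ 2) ^ l" and "i + s \<le> l"
  shows "\<exists>C' :: (nat \<Rightarrow> 'a) set. word_space.subspace C' \<and> C' \<subseteq> words_over (n + i) \<and> full_on (n + i) (k + i) C' \<and>
    card C' = (q ^ 2) ^ (k + i) \<and> card (hermitian_hull q (n + i) C') = (q ^ 2) ^ s"
proof -
  have Q: "q ^ 2 > 1"
    using one_less_power[OF q_gt_1, of 2] by simp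
  from grs_extend[OF assms(2,3)] obtain C1 :: "(nat \<Rightarrow> 'a) set" where
    C1: "word_space.subspace C1" "C1 \<subseteq> words_over (n + i)" "full_on (n + i) (k + i) C1"
    and card: "card C1 = (q ^ 2) ^ i * card C"
    and hull: "card (hermitian_hull q n C) \<le> card (hermitian_hull q (n + i) C1) * (q ^ 2) ^ i"
    by blast
  define h where "h = word_space.dim (hermitian_hull q (n + i) C1)"
  have "finite (hermitian_hull q (n + i) C1)"
    by (rule finite_subset[OF _ finite_words_over[of "n + i"]]) (auto simp: hermitian_hull_iff)
  then have h: "card (hermitian_hull q (n + i) C1) = (q ^ 2) ^ h"
    unfolding h_def using card_subspace[OF subspace_hermitian_hull[OF C1(1)]] card_field by simp
  have "(q ^ 2) ^ l \<le> (q ^ 2) ^ (h + i)"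
    using hull by (simp add: assms(5) h power_add)
  then have "l \<le> h + i"
    using Q by (simp add: power_increasing_iff)
  then have "s \<le> h"
    using assms(6) by simp
  then obtain m where "h = s + m"
    using le_Suc_ex by blast
  from reduce_hull_to[OF \<open>q > 2\<close> C1 h[unfolded this]] show ?thesis
    by (simp add: card assms(4) power_add mult.commute)
qed

end

section \<open>Weyl operators and stabilizer states\<close>

text \<open>\<open>\<psi>\<close> must be nontrivial on the subfield because basis states and phases
  are labelled there; \<open>\<gamma>\<close> completes 1 to a basis of the field over it.\<close>

locale weyl_system = quadratic_field q ty for q :: nat and ty :: "'a::{field,finite} itself" +
  fixes \<psi> :: "'a \<Rightarrow> complex" and \<gamma> :: 'a
  assumes \<psi>_add: "\<psi> (x + y) = \<psi> x * \<psi> y" and norm_\<psi>: "norm (\<psi> x) = 1"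
    and \<psi>_nontrivial: "\<exists>t\<in>base_field. \<psi> t \<noteq> 1" and \<gamma>: "\<gamma> ^ q \<noteq> \<gamma>"
begin

lemma \<psi>_0: "\<psi> 0 = 1"
proof -
  have "\<psi> 0 * \<psi> 0 = \<psi> 0"
    by (simp flip: \<psi>_add)
  then show ?thesis
    using norm_\<psi>[of 0] by auto
qed

lemma cnj_\<psi>: "cnj (\<psi> x) = \<psi> (- x)"
proof -
  have "\<psi> x * \<psi> (- x) = 1"
    by (simp flip: \<psi>_add add: \<psi>_0)
  moreover have "\<psi> x * cnj (\<psi> x) = 1"
    by (simp add: complex_norm_square[symmetric] norm_\<psi>)
  moreover have "\<psi> x \<noteq> 0"
    using norm_\<psi>[of x] by auto
  ultimately show ?thesis
    by (metis mult_left_cancel)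
qed

lemma \<psi>_of_nat_mult: "\<psi> (of_nat n * x) = \<psi> x ^ n"
  by (induction n) (simp_all add: \<psi>_0 \<psi>_add distrib_right)

text \<open>
  \<open>xpart\<close> and \<open>zpart\<close> are the coordinates of an element of the big field over the base field;
  \<open>s\<close> labels the product of the shifts by \<open>xpart (s j)\<close> and the phases given by \<open>zpart (s j)\<close>.
\<close>

definition xpart :: "'a \<Rightarrow> 'a" where
  "xpart x = x + x ^ q"

definition zpart :: "'a \<Rightarrow> 'a" where
  "zpart x = xpart (\<gamma> * x)"

text \<open>The labels of the basis states of \<open>M\<close> qudits: a qudit has dimension q,
  hence one basis state for each element of the subfield.\<close>

definition configs :: "nat \<Rightarrow> (nat \<Rightarrow> 'a) set" where
  "configs M = {u \<in> words_over M. \<forall>j. u j \<in> base_field}"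

definition zdot :: "nat \<Rightarrow> (nat \<Rightarrow> 'a) \<Rightarrow> (nat \<Rightarrow> 'a) \<Rightarrow> 'a" where
  "zdot M s u = (\<Sum>j<M. zpart (s j) * u j)"

text \<open>The operator acts on functions of arbitrary arguments, so that identities between
  operators carry no side conditions; only \<open>inner_prod\<close> refers to
  \<open>configs\<close>.\<close>

definition weyl :: "nat \<Rightarrow> (nat \<Rightarrow> 'a) \<Rightarrow> ((nat \<Rightarrow> 'a) \<Rightarrow> complex) \<Rightarrow> (nat \<Rightarrow> 'a) \<Rightarrow> complex" where
  "weyl M s f = (\<lambda>u. \<psi> (zdot M s u) * f (\<lambda>j. u j + xpart (s j)))"

definition inner_prod :: "nat \<Rightarrow> ((nat \<Rightarrow> 'a) \<Rightarrow> complex) \<Rightarrow> ((nat \<Rightarrow> 'a) \<Rightarrow> complex) \<Rightarrow> complex" where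
  "inner_prod M f g = (\<Sum>u\<in>configs M. cnj (f u) * g u)"

section \<open>Coordinates of the field over its subfield\<close>

lemma xpart_add: "xpart (x + y) = xpart x + xpart y"
  by (simp add: xpart_def frob_add)

lemma zpart_add: "zpart (x + y) = zpart x + zpart y"
  by (simp add: zpart_def distrib_left xpart_add)

lemma xpart_0 [simp]: "xpart 0 = 0"
  using q_gt_1 by (simp add: xpart_def)

lemma zpart_0 [simp]: "zpart 0 = 0"
  by (simp add: zpart_def)

lemma xpart_base_field: "xpart x \<in> base_field"
  by (simp add: xpart_def base_field_def frob_add frob_frob add.commute)

lemma zpart_base_field: "zpart x \<in> base_field"
  by (simp add: zpart_def xpart_base_field)

lemma parts_eq_0:
  assumes "xpart x = 0" and "zpart x = 0"
  shows "x = 0"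
proof -
  from assms(1) have "x ^ q = - x"
    by (simp add: xpart_def add_eq_0_iff)
  with assms(2) have "(\<gamma> - \<gamma> ^ q) * x = 0"
    by (simp add: zpart_def xpart_def power_mult_distrib algebra_simps)
  with \<gamma> show ?thesis
    by simp
qed

text \<open>The pair of coordinates is an injective function between sets of size q^2. A label can
  therefore prescribe shift and phase independently at each position.\<close>

lemma exists_parts:
  assumes "\<alpha> \<in> base_field" and "\<beta> \<in> base_field"
  shows "\<exists>x. xpart x = \<alpha> \<and> zpart x = \<beta>"
proof -
  let ?f = "\<lambda>x. (xpart x, zpart x)"
  have "inj ?f"
  proof (rule injI)
    fix x y assume "?f x = ?f y"
    then have "xpart (x - y) = 0" "zpart (x - y) = 0"
      using xpart_add[of "x - y" y] zpart_add[of "x - y" y] by simp_all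
    then have "x - y = 0"
      by (rule parts_eq_0)
    then show "x = y"
      by simp
  qed
  then have "card (range ?f) = q ^ 2"
    by (simp add: card_image card_field)
  moreover have "card (base_field \<times> base_field :: ('a \<times> 'a) set) = q ^ 2"
    by (simp add: card_cartesian_product card_base_field power2_eq_square)
  moreover have "range ?f \<subseteq> base_field \<times> base_field"
    using xpart_base_field zpart_base_field by auto
  ultimately have "range ?f = base_field \<times> base_field"
    by (intro card_subset_eq) auto
  then have "(\<alpha>, \<beta>) \<in> range ?f"
    using assms by simp
  then show ?thesis
    by auto
qed

section \<open>Configurations and translations of them\<close>

lemma finite_configs: "finite (configs M)"
  by (rule finite_subset[OF _ finite_words_over[of M]]) (auto simp: configs_def)

lemma configs_add: "u \<in> configs M \<Longrightarrow> v \<in> configs M \<Longrightarrow> (\<lambda>j. u j + v j) \<in> configs M"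
  by (simp add: configs_def words_over_def base_field_closed)

lemma configs_diff: "u \<in> configs M \<Longrightarrow> v \<in> configs M \<Longrightarrow> (\<lambda>j. u j - v j) \<in> configs M"
  by (simp add: configs_def words_over_def base_field_closed)

lemma configs_zero: "(\<lambda>_. 0) \<in> configs M"
  by (simp add: configs_def words_over_def base_field_closed)

lemma xpart_configs: "s \<in> words_over M \<Longrightarrow> (\<lambda>j. xpart (s j)) \<in> configs M"
  by (simp add: configs_def words_over_def xpart_base_field)

lemma zdot_add_right: "zdot M s (\<lambda>j. u j + v j) = zdot M s u + zdot M s v"
  by (simp add: zdot_def distrib_left sum.distrib)

lemma zdot_diff_right: "zdot M s (\<lambda>j. u j - v j) = zdot M s u - zdot M s v"
  by (simp add: zdot_def right_diff_distrib sum_subtractf)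

lemma sum_configs_shift:
  assumes "s \<in> words_over M"
  shows "(\<Sum>u\<in>configs M. F (\<lambda>j. u j + xpart (s j))) = (\<Sum>u\<in>configs M. F u)"
  by (rule sum.reindex_bij_witness[of _ "\<lambda>u j. u j - xpart (s j)" "\<lambda>u j. u j + xpart (s j)"])
    (use xpart_configs[OF assms] in \<open>simp_all add: configs_add configs_diff\<close>)

section \<open>Commutation and finite order of Weyl operators\<close>

lemma monomial_weyl: "monomial_op (weyl M s)"
  unfolding weyl_def by (rule monomial_opI)

lemma weyl_scale: "weyl M s (\<lambda>u. c * f u) = (\<lambda>u. c * weyl M s f u)"
  by (rule monomial_op_scale[OF monomial_weyl])

text \<open>The link between codes and operators: in these coordinates the symplectic form that
  governs commutation is the antisymmetric part of the Hermitian form, up to a nonzero constant.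
  Orthogonal labels give commuting operators.\<close>

lemma zdot_xpart_commutator:
  "zdot M s (\<lambda>j. xpart (t j)) - zdot M t (\<lambda>j. xpart (s j)) = (\<gamma> - \<gamma> ^ q) * (herm M s t - herm M t s)"
proof -
  have "zpart x * xpart y - zpart y * xpart x = (\<gamma> - \<gamma> ^ q) * (x * y ^ q - y * x ^ q)" for x y
    by (simp add: zpart_def xpart_def power_mult_distrib algebra_simps)
  then show ?thesis
    by (simp add: zdot_def herm_def flip: sum_subtractf) (simp add: sum_distrib_left)
qed

lemma weyl_weyl:
  "weyl M s (weyl M t f) = (\<lambda>u. \<psi> ((\<gamma> - \<gamma> ^ q) * (herm M t s - herm M s t)) * weyl M t (weyl M s f) u)"
proof
  fix u
  have "zdot M s u + zdot M t (\<lambda>j. u j + xpart (s j)) =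
      (zdot M t (\<lambda>j. xpart (s j)) - zdot M s (\<lambda>j. xpart (t j))) + (zdot M t u + zdot M s (\<lambda>j. u j + xpart (t j)))"
    by (simp add: zdot_add_right)
  then have "\<psi> (zdot M s u) * \<psi> (zdot M t (\<lambda>j. u j + xpart (s j))) =
      \<psi> ((\<gamma> - \<gamma> ^ q) * (herm M t s - herm M s t)) * (\<psi> (zdot M t u) * \<psi> (zdot M s (\<lambda>j. u j + xpart (t j))))"
    unfolding zdot_xpart_commutator by (simp flip: \<psi>_add)
  moreover have "(\<lambda>j. u j + xpart (s j) + xpart (t j)) = (\<lambda>j. u j + xpart (t j) + xpart (s j))"
    by (simp add: add_ac)
  ultimately show "weyl M s (weyl M t f) u =
      \<psi> ((\<gamma> - \<gamma> ^ q) * (herm M t s - herm M s t)) * weyl M t (weyl M s f) u"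
    by (simp add: weyl_def mult.assoc)
qed

lemma weyl_commute:
  assumes "herm M s t = herm M t s"
  shows "weyl M s (weyl M t f) = weyl M t (weyl M s f)"
  using weyl_weyl[of M s t f] assms by (simp add: \<psi>_0)

text \<open>The accumulated phase \<open>\<kappa>\<close> depends on neither \<open>f\<close> nor
  \<open>u\<close>; its value does not matter later.\<close>

lemma weyl_power_form:
  "\<exists>\<kappa>. \<forall>f u. (weyl M s ^^ n) f u = \<psi> (\<kappa> + of_nat n * zdot M s u) * f (\<lambda>j. u j + of_nat n * xpart (s j))"
proof (induction n)
  case 0
  show ?case
    by (intro exI[of _ 0]) (simp add: \<psi>_0)
next
  case (Suc n)
  then obtain \<kappa> where IH: "\<And>f u. (weyl M s ^^ n) f u =
      \<psi> (\<kappa> + of_nat n * zdot M s u) * f (\<lambda>j. u j + of_nat n * xpart (s j))"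
    by blast
  show ?case
  proof (intro exI allI)
    fix f u
    have "(weyl M s ^^ Suc n) f u = \<psi> (zdot M s u) * (weyl M s ^^ n) f (\<lambda>j. u j + xpart (s j))"
      by (simp add: weyl_def)
    also have "\<dots> = \<psi> (zdot M s u + (\<kappa> + of_nat n * zdot M s (\<lambda>j. u j + xpart (s j)))) *
        f (\<lambda>j. u j + xpart (s j) + of_nat n * xpart (s j))"
      by (simp add: IH \<psi>_add)
    also have "zdot M s u + (\<kappa> + of_nat n * zdot M s (\<lambda>j. u j + xpart (s j))) =
        (\<kappa> + of_nat n * zdot M s (\<lambda>j. xpart (s j))) + of_nat (Suc n) * zdot M s u"
      by (simp add: zdot_add_right algebra_simps)
    also have "(\<lambda>j. u j + xpart (s j) + of_nat n * xpart (s j)) = (\<lambda>j. u j + of_nat (Suc n) * xpart (s j))"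
      by (simp add: algebra_simps)
    finally show "(weyl M s ^^ Suc n) f u =
        \<psi> ((\<kappa> + of_nat n * zdot M s (\<lambda>j. xpart (s j))) + of_nat (Suc n) * zdot M s u) *
        f (\<lambda>j. u j + of_nat (Suc n) * xpart (s j))" .
  qed
qed

text \<open>The p-th power, p the characteristic, is only a scalar \<open>\<psi> \<kappa>\<close>
  (possibly -1 for p = 2). The scalar is a p-th root of unity, hence the exponent p * p.\<close>

lemma weyl_finite_order: "\<exists>n>0. \<forall>f. (weyl M s ^^ n) f = f"
proof -
  let ?p = "CHAR('a)"
  have p: "?p > 0"
    using char_power(1) prime_gt_0_nat by blast
  obtain \<kappa> where \<kappa>: "\<And>f u. (weyl M s ^^ ?p) f u =
      \<psi> (\<kappa> + of_nat ?p * zdot M s u) * f (\<lambda>j. u j + of_nat ?p * xpart (s j))"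
    using weyl_power_form by blast
  then have pow: "(weyl M s ^^ ?p) f = (\<lambda>u. \<psi> \<kappa> * f u)" for f
    by (simp add: fun_eq_iff)
  have "((weyl M s ^^ ?p) ^^ n) f = (\<lambda>u. \<psi> \<kappa> ^ n * f u)" for n f
    by (induction n) (simp_all add: pow mult.assoc)
  then have "((weyl M s ^^ ?p) ^^ ?p) f = f" for f
    using \<psi>_of_nat_mult[of ?p \<kappa>] by (simp add: \<psi>_0)
  then have "(weyl M s ^^ (?p * ?p)) f = f" for f
    by (simp add: funpow_mult)
  with p show ?thesis
    by (intro exI[of _ "?p * ?p"]) simp
qed

section \<open>Unitarity, eigenvalues and stabilizer states\<close>

lemma inner_prod_weyl:
  assumes "s \<in> words_over M"
  shows "inner_prod M (weyl M s f) (weyl M s g) = inner_prod M f g"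
proof -
  have "cnj (weyl M s f u) * weyl M s g u = cnj (f (\<lambda>j. u j + xpart (s j))) * g (\<lambda>j. u j + xpart (s j))" for u
  proof -
    have "cnj (\<psi> (zdot M s u)) * \<psi> (zdot M s u) = 1"
      by (simp add: cnj_\<psi> \<psi>_0 flip: \<psi>_add)
    then show ?thesis
      by (simp add: weyl_def algebra_simps)
  qed
  then show ?thesis
    unfolding inner_prod_def using sum_configs_shift[OF assms, of "\<lambda>u. cnj (f u) * g u"] by simp
qed

lemma inner_prod_scale:
  "inner_prod M (\<lambda>u. a * f u) (\<lambda>u. b * g u) = cnj a * b * inner_prod M f g"
  by (simp add: inner_prod_def sum_distrib_left mult_ac)

lemma norm_eigenvalue:
  assumes "s \<in> words_over M" and "weyl M s f = (\<lambda>u. \<mu> * f u)" and "inner_prod M f f \<noteq> 0"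
  shows "norm \<mu> = 1"
proof -
  have "cnj \<mu> * \<mu> * inner_prod M f f = inner_prod M f f"
    using inner_prod_weyl[OF assms(1), of f f] by (simp add: assms(2) inner_prod_scale)
  then have "\<mu> * cnj \<mu> = 1"
    using assms(3) by (simp add: mult.commute)
  then have "complex_of_real ((norm \<mu>)\<^sup>2) = 1"
    by (simp only: complex_norm_square)
  then have "(norm \<mu>)\<^sup>2 = 1"
    by (simp only: of_real_eq_1_iff)
  then show ?thesis
    by (intro power2_eq_imp_eq[of "norm \<mu>" 1]) simp_all
qed

lemma inner_prod_distinct_eigenvalues:
  assumes "s \<in> words_over M" and "weyl M s f = (\<lambda>u. \<mu> * f u)" and "weyl M s g = (\<lambda>u. \<nu> * g u)"
    and "cnj \<mu> * \<nu> \<noteq> 1"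
  shows "inner_prod M f g = 0"
proof -
  have "cnj \<mu> * \<nu> * inner_prod M f g = inner_prod M f g"
    using inner_prod_weyl[OF assms(1), of f g] by (simp add: assms(2,3) inner_prod_scale)
  with assms(4) show ?thesis
    by simp
qed

text \<open>
  Given a self-orthogonal \<open>S\<close> and an orthonormal family \<open>t\<close> orthogonal to it, the operators labelled
  by \<open>S\<close> and by the multiples of the \<open>t i\<close> over the base field commute. A joint eigenvector is moved
  by the operators labelled by the multiples of the \<open>\<gamma> t i\<close>, which commute with those labelled
  by \<open>S\<close> but change the other eigenvalues.
\<close>

lemma stabilizer_states:
  fixes S :: "(nat \<Rightarrow> 'a) set" and t :: "nat \<Rightarrow> nat \<Rightarrow> 'a"
  assumes S: "S \<subseteq> words_over M" and iso: "\<And>x y. x \<in> S \<Longrightarrow> y \<in> S \<Longrightarrow> herm M x y = 0"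
    and t: "\<And>i. i < \<kappa> \<Longrightarrow> t i \<in> words_over M"
    and t_S: "\<And>i x. i < \<kappa> \<Longrightarrow> x \<in> S \<Longrightarrow> herm M (t i) x = 0"
    and t_t: "\<And>i j. i < \<kappa> \<Longrightarrow> j < \<kappa> \<Longrightarrow> herm M (t i) (t j) = of_bool (i = j)"
  shows "\<exists>(\<Psi> :: (nat \<Rightarrow> 'a) \<Rightarrow> (nat \<Rightarrow> 'a) \<Rightarrow> complex) \<chi>.
    (\<forall>w s. s \<in> S \<longrightarrow> weyl M s (\<Psi> w) = (\<lambda>u. \<chi> s * \<Psi> w u)) \<and> (\<forall>s\<in>S. norm (\<chi> s) = 1) \<and>
    (\<forall>w\<in>configs \<kappa>. \<forall>w'\<in>configs \<kappa>. inner_prod M (\<Psi> w) (\<Psi> w') = of_bool (w = w'))"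
proof -
  have S_t: "herm M x (t i) = 0" if "i < \<kappa>" "x \<in> S" for i x
    using t_S[OF that] herm_eq_0_commute by blast
  define L where "L = S \<union> {(\<lambda>j. \<alpha> * t i j) | \<alpha> i. \<alpha> \<in> base_field \<and> i < \<kappa>}"
  have L_words: "x \<in> words_over M" if "x \<in> L" for x
    using that S t by (auto simp: L_def words_over_def)
  have "finite L"
    by (rule finite_subset[OF _ finite_words_over[of M]]) (use L_words in blast)
  \<comment> \<open>Commutation asks for symmetry of the form only. Multiples of the
    \<open>t i\<close> over the subfield have form values in the subfield, which conjugation
    fixes.\<close>
  have L_sym: "herm M x y = herm M y x" if "x \<in> L" "y \<in> L" for x y
    using that by (auto simp: L_def iso t_S S_t t_t herm_scale_left herm_scale_right base_field_def)
  define f0 where "f0 = (\<lambda>u :: nat \<Rightarrow> 'a. if u = (\<lambda>_. 0) then 1 else 0 :: complex)"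
  have f0: "f0 \<noteq> (\<lambda>_. 0)"
  proof
    assume "f0 = (\<lambda>_. 0)"
    from fun_cong[OF this, of "\<lambda>_. 0"] show False
      by (simp add: f0_def)
  qed
  \<comment> \<open>Restriction to the configurations. It fixes \<open>f0\<close> and commutes with
    the Weyl operators of \<open>L\<close>, so it also fixes the joint eigenvector: \<open>f\<close>
    is supported on \<open>configs M\<close>, and its norm there is positive.\<close>
  define B where "B f = (\<lambda>u. of_bool (u \<in> configs M) * f u)" for f :: "(nat \<Rightarrow> 'a) \<Rightarrow> complex"
  from joint_eigenvector[of L f0 "weyl M", OF \<open>finite L\<close> f0 monomial_weyl weyl_commute[OF L_sym] weyl_finite_order]
  obtain f where f: "f \<noteq> (\<lambda>_. 0)" "\<forall>s\<in>L. \<exists>\<mu>. weyl M s f = (\<lambda>u. \<mu> * f u)"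
    and inv: "\<forall>B \<beta>. monomial_op B \<and> (\<forall>s\<in>L. \<forall>f. weyl M s (B f) = B (weyl M s f)) \<and>
      B f0 = (\<lambda>u. \<beta> * f0 u) \<longrightarrow> B f = (\<lambda>u. \<beta> * f u)"
    by auto
  have B_f: "B f = (\<lambda>u. 1 * f u)"
  proof (intro inv[THEN spec, THEN spec, of B 1, THEN mp] conjI ballI allI)
    show "monomial_op B"
      unfolding B_def by (rule monomial_opI[of _ "\<lambda>u. u"])
    show "weyl M s (B f) = B (weyl M s f)" if "s \<in> L" for s f
    proof
      fix u
      have "(\<lambda>j. u j + xpart (s j)) \<in> configs M \<longleftrightarrow> u \<in> configs M"
        using configs_add[of u M "\<lambda>j. xpart (s j)"] xpart_configs[OF L_words[OF that]]
          configs_diff[of "\<lambda>j. u j + xpart (s j)" M "\<lambda>j. xpart (s j)"] by auto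
      then show "weyl M s (B f) u = B (weyl M s f) u"
        by (simp add: B_def weyl_def)
    qed
    show "B f0 = (\<lambda>u. 1 * f0 u)"
      by (rule ext) (simp add: B_def f0_def configs_zero)
  qed
  have f_supp: "f u = 0" if "u \<notin> configs M" for u
    using fun_cong[OF B_f, of u] that by (simp add: B_def)
  obtain u0 where u0: "f u0 \<noteq> 0"
    using f(1) by auto
  define N where "N = (\<Sum>u\<in>configs M. (norm (f u))\<^sup>2)"
  have "N > 0"
    unfolding N_def
    by (rule sum_pos2[of _ u0]) (use u0 f_supp finite_configs in auto)
  have ip_f: "inner_prod M f f = of_real N"
    by (simp add: inner_prod_def N_def mult.commute flip: complex_norm_square)
  define c where "c = complex_of_real (1 / sqrt N)"
  have c: "cnj c * c * of_real N = 1"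
    using \<open>N > 0\<close> by (simp add: c_def flip: of_real_mult)
  from f(2) obtain \<chi> where \<chi>: "\<forall>s\<in>L. weyl M s f = (\<lambda>u. \<chi> s * f u)"
    using bchoice[of L "\<lambda>s \<mu>. weyl M s f = (\<lambda>u. \<mu> * f u)"] by blast
  have norm_\<chi>: "norm (\<chi> s) = 1" if "s \<in> L" for s
    by (rule norm_eigenvalue[OF L_words[OF that]]) (use \<chi> that ip_f \<open>N > 0\<close> in auto)
  \<comment> \<open>With the factor \<open>\<gamma>\<close> the form values against
    \<open>t i\<close> are \<open>\<gamma> * w i\<close> and \<open>\<gamma> ^ q * w i\<close> in
    the two orders. Their difference is what distinguishes the logical states.\<close>
  define tw where "tw w = (\<lambda>j. \<Sum>i<\<kappa>. (\<gamma> * w i) * t i j)" for w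
  define \<Psi> where "\<Psi> w = weyl M (tw w) (\<lambda>u. c * f u)" for w
  have tw_words: "tw w \<in> words_over M" for w
    using t by (auto simp: tw_def words_over_def intro!: sum.neutral)
  have eig: "weyl M l (\<Psi> w) =
      (\<lambda>u. (\<psi> ((\<gamma> - \<gamma> ^ q) * (herm M (tw w) l - herm M l (tw w))) * \<chi> l) * \<Psi> w u)" if "l \<in> L" for l w
  proof -
    have "weyl M l (\<lambda>u. c * f u) = (\<lambda>u. \<chi> l * (c * f u))"
      using \<chi> that by (simp add: weyl_scale mult_ac)
    then show ?thesis
      unfolding \<Psi>_def weyl_weyl[of M l] by (simp add: weyl_scale mult.assoc)
  qed
  have "weyl M s (\<Psi> w) = (\<lambda>u. \<chi> s * \<Psi> w u)" if "s \<in> S" for s w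
  proof -
    have "herm M (tw w) s = 0"
      unfolding tw_def herm_linear_combination_left using that by (intro sum.neutral) (simp add: t_S)
    moreover from this have "herm M s (tw w) = 0"
      using herm_eq_0_commute by blast
    ultimately show ?thesis
      using eig[of s w] that by (simp add: L_def \<psi>_0)
  qed
  moreover have "norm (\<chi> s) = 1" if "s \<in> S" for s
    by (rule norm_\<chi>) (use that in \<open>simp add: L_def\<close>)
  moreover have "inner_prod M (\<Psi> w) (\<Psi> w') = of_bool (w = w')"
    if w: "w \<in> configs \<kappa>" "w' \<in> configs \<kappa>" for w w'
  proof (cases "w = w'")
    case True
    have "inner_prod M (\<Psi> w) (\<Psi> w) = cnj c * c * of_real N"
      unfolding \<Psi>_def inner_prod_weyl[OF tw_words] inner_prod_scale ip_f ..
    with True c show ?thesis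
      by simp
  next
    case False
    then obtain i where i: "w i \<noteq> w' i"
      by auto
    have "w i = w' i" if "\<kappa> \<le> i"
      using w that by (simp add: configs_def words_over_def)
    with i have "i < \<kappa>"
      by (meson not_le)
    obtain t0 where t0: "t0 \<in> base_field" "\<psi> t0 \<noteq> 1"
      using \<psi>_nontrivial by blast
    \<comment> \<open>One factor comes from the commutator and one from the two orders of the form.
      Conjugation negates \<open>\<gamma> - \<gamma> ^ q\<close>, so its square lies in the
      subfield.\<close>
    define \<delta> where "\<delta> = (\<gamma> - \<gamma> ^ q) * (\<gamma> - \<gamma> ^ q)"
    have "\<delta> \<noteq> 0"
      using \<gamma> by (simp add: \<delta>_def)
    have "(\<gamma> - \<gamma> ^ q) ^ q = - (\<gamma> - \<gamma> ^ q)"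
      by (simp add: frob_diff frob_frob)
    then have "\<delta> \<in> base_field"
      unfolding \<delta>_def base_field_def mem_Collect_eq power_mult_distrib by (simp only: minus_mult_minus)
    \<comment> \<open>Chosen so that the eigenvalues of the operator labelled by
      \<open>\<alpha> * t i\<close> on the two states differ by the factor \<open>\<psi> t0\<close>,
      which is not 1.\<close>
    define \<alpha> where "\<alpha> = t0 / (\<delta> * (w' i - w i))"
    have w_base: "w i \<in> base_field" "w' i \<in> base_field"
      using w by (auto simp: configs_def)
    then have "\<alpha> \<in> base_field"
      using t0(1) \<open>\<delta> \<in> base_field\<close> unfolding \<alpha>_def by (intro base_field_closed)
    let ?l = "\<lambda>j. \<alpha> * t i j"
    have l: "?l \<in> L"
      using \<open>\<alpha> \<in> base_field\<close> \<open>i < \<kappa>\<close> by (auto simp: L_def)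
    have comm: "(\<gamma> - \<gamma> ^ q) * (herm M (tw v) ?l - herm M ?l (tw v)) = \<delta> * \<alpha> * v i"
      if "v i \<in> base_field" for v
    proof -
      have "herm M (tw v) (t i) = (\<Sum>i'<\<kappa>. if i' = i then \<gamma> * v i else 0)"
        unfolding tw_def herm_linear_combination_left using \<open>i < \<kappa>\<close>
        by (intro sum.cong) (auto simp: t_t)
      then have 1: "herm M (tw v) (t i) = \<gamma> * v i"
        using \<open>i < \<kappa>\<close> by simp
      have 2: "herm M (t i) (tw v) = \<gamma> ^ q * v i"
        using herm_conj[of M "tw v" "t i"] that by (simp add: 1 power_mult_distrib base_field_def)
      show ?thesis
        using \<open>\<alpha> \<in> base_field\<close>
        by (simp add: herm_scale_left herm_scale_right 1 2 base_field_def \<delta>_def algebra_simps)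
    qed
    have "inner_prod M (\<Psi> w) (\<Psi> w') = 0"
    proof (rule inner_prod_distinct_eigenvalues[OF L_words[OF l] eig[OF l] eig[OF l]])
      have "cnj (\<chi> ?l) * \<chi> ?l = 1"
        using norm_\<chi>[OF l] by (simp add: mult.commute complex_norm_square[symmetric])
      moreover have "cnj (\<psi> (\<delta> * \<alpha> * w i)) * \<psi> (\<delta> * \<alpha> * w' i) = \<psi> t0"
      proof -
        have "- (\<delta> * \<alpha> * w i) + \<delta> * \<alpha> * w' i = \<delta> * \<alpha> * (w' i - w i)"
          by (simp add: algebra_simps)
        also have "\<dots> = t0"
          using i \<open>\<delta> \<noteq> 0\<close> by (simp add: \<alpha>_def)
        finally show ?thesis
          by (simp add: cnj_\<psi> flip: \<psi>_add)
      qed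
      ultimately have "cnj (\<psi> (\<delta> * \<alpha> * w i) * \<chi> ?l) * (\<psi> (\<delta> * \<alpha> * w' i) * \<chi> ?l) = \<psi> t0"
        by (simp add: mult_ac)
      then show "cnj (\<psi> ((\<gamma> - \<gamma> ^ q) * (herm M (tw w) ?l - herm M ?l (tw w))) * \<chi> ?l) *
          (\<psi> ((\<gamma> - \<gamma> ^ q) * (herm M (tw w') ?l - herm M ?l (tw w'))) * \<chi> ?l) \<noteq> 1"
        unfolding comm[of w, OF w_base(1)] comm[of w', OF w_base(2)] using t0(2) by simp
    qed
    with False show ?thesis
      by simp
  qed
  ultimately show ?thesis
    by (intro exI[of _ \<Psi>] exI[of _ \<chi>]) simp
qed

text \<open>The kernel of an operator on \<open>T\<close> tensored with the identity, described
  intrinsically so that it fits both errors on the sender's qudits and matrix units on the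
  receiver's.\<close>

definition local_on :: "nat \<Rightarrow> nat set \<Rightarrow> ((nat \<Rightarrow> 'a) \<Rightarrow> (nat \<Rightarrow> 'a) \<Rightarrow> complex) \<Rightarrow> bool" where
  "local_on M T E \<longleftrightarrow>
     (\<forall>u\<in>configs M. \<forall>v\<in>configs M. E u v \<noteq> 0 \<longrightarrow> (\<forall>j. j \<notin> T \<longrightarrow> u j = v j)) \<and>
     (\<forall>u\<in>configs M. \<forall>v\<in>configs M. \<forall>u'\<in>configs M. \<forall>v'\<in>configs M.
        (\<forall>j\<in>T. u j = u' j \<and> v j = v' j) \<longrightarrow> (\<forall>j. j \<notin> T \<longrightarrow> u j = v j \<and> u' j = v' j)
        \<longrightarrow> E u v = E u' v')"

text \<open>Plays three roles below: phases to average over, shifts to average over, and the basis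
  for the trace on \<open>T\<close>.\<close>

definition configs_on :: "nat \<Rightarrow> nat set \<Rightarrow> (nat \<Rightarrow> 'a) set" where
  "configs_on M T = {u \<in> configs M. \<forall>j. j \<notin> T \<longrightarrow> u j = 0}"

lemma configs_on_closed:
  "(\<lambda>_. 0) \<in> configs_on M T"
  "u \<in> configs_on M T \<Longrightarrow> v \<in> configs_on M T \<Longrightarrow> (\<lambda>j. u j + v j) \<in> configs_on M T"
  "u \<in> configs_on M T \<Longrightarrow> v \<in> configs_on M T \<Longrightarrow> (\<lambda>j. u j - v j) \<in> configs_on M T"
  by (simp_all add: configs_on_def configs_zero configs_add configs_diff)

lemma finite_configs_on: "finite (configs_on M T)"
  by (rule finite_subset[OF _ finite_configs[of M]]) (auto simp: configs_on_def)

text \<open>The letters stay in the subfield, so the pairing separates points only because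
  \<open>\<psi>\<close> is nontrivial there.\<close>

lemma sum_characters_configs_on:
  assumes w: "w \<in> configs_on M T"
  shows "(\<Sum>\<beta>\<in>configs_on M T. \<psi> (\<Sum>j<M. \<beta> j * w j)) =
    (if w = (\<lambda>_. 0) then of_nat (card (configs_on M T)) else 0)"
proof (cases "w = (\<lambda>_. 0)")
  case True
  then show ?thesis
    by (simp add: \<psi>_0)
next
  case False
  then obtain j where j: "w j \<noteq> 0"
    by auto
  have "w j = 0" if "M \<le> j"
    using w that by (simp add: configs_on_def configs_def words_over_def)
  with j have "j < M"
    by (meson not_le)
  obtain t where t: "t \<in> base_field" "\<psi> t \<noteq> 1"
    using \<psi>_nontrivial by blast
  let ?\<beta> = "\<lambda>i. if i = j then t / w j else 0"
  have "(\<Sum>\<beta>\<in>configs_on M T. \<psi> (\<Sum>j<M. \<beta> j * w j)) = 0"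
  proof (rule sum_nontrivial_character)
    have "t / w j \<in> base_field"
      using t(1) w by (auto simp: configs_on_def configs_def intro: base_field_closed)
    then show "?\<beta> \<in> configs_on M T"
      using j w \<open>j < M\<close> base_field_closed(1) by (auto simp: configs_on_def configs_def words_over_def)
    have "(\<Sum>i<M. ?\<beta> i * w i) = (\<Sum>i<M. if i = j then t else 0)"
      using j by (intro sum.cong) auto
    also have "\<dots> = t"
      using \<open>j < M\<close> by simp
    finally show "\<psi> (\<Sum>i<M. ?\<beta> i * w i) \<noteq> 1"
      using t(2) by simp
  next
    fix x y assume "x \<in> configs_on M T" "y \<in> configs_on M T"
    then show "x - y \<in> configs_on M T" "x + y \<in> configs_on M T"
      using configs_on_closed(2,3)[of x M T y] by (simp_all add: plus_fun_def fun_diff_def)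
    show "\<psi> (\<Sum>j<M. (x + y) j * w j) = \<psi> (\<Sum>j<M. x j * w j) * \<psi> (\<Sum>j<M. y j * w j)"
      by (simp add: distrib_right sum.distrib \<psi>_add)
  qed
  with False show ?thesis
    by simp
qed

text \<open>
  Averaging over the operators labelled by \<open>S\<close>, which act on \<open>T\<close> as all Weyl operators, replaces a
  kernel that is local on \<open>T\<close> by its normalized trace.
\<close>

lemma local_kernel_expectation:
  fixes S :: "(nat \<Rightarrow> 'a) set" and f g :: "(nat \<Rightarrow> 'a) \<Rightarrow> complex"
  assumes S: "S \<subseteq> words_over M" and surj: "\<And>x. \<exists>s\<in>S. \<forall>j\<in>T. s j = x j" and E: "local_on M T E"
    and f: "\<And>s. s \<in> S \<Longrightarrow> weyl M s f = (\<lambda>u. \<chi> s * f u)"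
    and g: "\<And>s. s \<in> S \<Longrightarrow> weyl M s g = (\<lambda>u. \<chi> s * g u)"
    and \<chi>: "\<And>s. s \<in> S \<Longrightarrow> norm (\<chi> s) = 1"
  shows "(\<Sum>u\<in>configs M. \<Sum>v\<in>configs M. cnj (f u) * E u v * g v) =
    (\<Sum>\<alpha>\<in>configs_on M T. E \<alpha> \<alpha>) / of_nat (card (configs_on M T)) * inner_prod M f g"
proof -
  let ?C = "configs M" and ?CT = "configs_on M T"
  have card_CT: "card ?CT \<noteq> 0"
    using configs_on_closed(1) finite_configs_on by (metis card_eq_0_iff empty_iff)
  have E_off: "u j = v j" if "u \<in> ?C" "v \<in> ?C" "E u v \<noteq> 0" "j \<notin> T" for u v j
    using E that unfolding local_on_def by blast
  have E_loc: "E u v = E u' v'" if "u \<in> ?C" "v \<in> ?C" "u' \<in> ?C" "v' \<in> ?C"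
    "\<And>j. j \<in> T \<Longrightarrow> u j = u' j \<and> v j = v' j" "\<And>j. j \<notin> T \<Longrightarrow> u j = v j \<and> u' j = v' j" for u v u' v'
    using E that unfolding local_on_def by blast
  have surj': "\<exists>s\<in>S. \<forall>j\<in>T. xpart (s j) = \<alpha> j \<and> zpart (s j) = \<beta> j"
    if "\<alpha> \<in> ?C" "\<beta> \<in> ?C" for \<alpha> \<beta>
  proof -
    have "\<forall>j. \<exists>x. xpart x = \<alpha> j \<and> zpart x = \<beta> j"
      using that by (intro allI exists_parts) (auto simp: configs_def)
    then obtain x where "\<And>j. xpart (x j) = \<alpha> j \<and> zpart (x j) = \<beta> j"
      by metis
    moreover obtain s where "s \<in> S" "\<forall>j\<in>T. s j = x j"
      using surj[of x] by blast
    ultimately show ?thesis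
      by (intro bexI[of _ s]) simp_all
  qed
  have shift: "(\<Sum>u\<in>?C. \<Sum>v\<in>?C. cnj (f u) * K u v * g v) =
      (\<Sum>u\<in>?C. \<Sum>v\<in>?C. \<psi> (zdot M s (\<lambda>j. v j - u j)) * cnj (f u) *
         K (\<lambda>j. u j - xpart (s j)) (\<lambda>j. v j - xpart (s j)) * g v)" (is "?l = ?r") if s: "s \<in> S" for K s
  proof -
    let ?x = "\<lambda>u j. u j + xpart (s j)"
    have sM: "s \<in> words_over M"
      using s S by blast
    \<comment> \<open>Both functions have the same eigenvalue of modulus 1, so replacing them by
      their images under \<open>weyl M s\<close> leaves the sum unchanged and conjugates the
      kernel.\<close>
    have "cnj (\<chi> s) * \<chi> s = 1"
      using \<chi>[OF s] by (simp add: mult.commute complex_norm_square[symmetric])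
    then have *: "cnj (f u) * g v = cnj (\<chi> s * f u) * (\<chi> s * g v)" for u v
      by (simp add: algebra_simps)
    have eq: "cnj (f u) * g v = \<psi> (zdot M s (\<lambda>j. ?x v j - ?x u j)) * cnj (f (?x u)) * g (?x v)" for u v
    proof -
      have "cnj (f u) * g v = cnj (weyl M s f u) * weyl M s g v"
        unfolding * f[OF s] g[OF s] ..
      also have "\<dots> = (cnj (\<psi> (zdot M s u)) * \<psi> (zdot M s v)) * cnj (f (?x u)) * g (?x v)"
        by (simp add: weyl_def)
      also have "cnj (\<psi> (zdot M s u)) * \<psi> (zdot M s v) = \<psi> (zdot M s (\<lambda>j. ?x v j - ?x u j))"
        by (simp add: cnj_\<psi> zdot_diff_right flip: \<psi>_add)
      finally show ?thesis .
    qed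
    define G where "G u v = \<psi> (zdot M s (\<lambda>j. v j - u j)) * cnj (f u) *
         K (\<lambda>j. u j - xpart (s j)) (\<lambda>j. v j - xpart (s j)) * g v" for u v
    have G_eq: "cnj (f u) * K u v * g v = G (?x u) (?x v)" for u v
      using eq[of u v] by (simp add: G_def mult_ac)
    have "?l = (\<Sum>u\<in>?C. \<Sum>v\<in>?C. G (?x u) (?x v))"
      unfolding G_eq ..
    also have "\<dots> = (\<Sum>u\<in>?C. \<Sum>v\<in>?C. G (?x u) v)"
      by (intro sum.cong[OF refl] sum_configs_shift[OF sM])
    also have "\<dots> = (\<Sum>u\<in>?C. \<Sum>v\<in>?C. G u v)"
      by (rule sum_configs_shift[OF sM, of "\<lambda>u. \<Sum>v\<in>?C. G u v"])
    finally show ?thesis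
      by (simp add: G_def)
  qed
  define I where "I = (\<Sum>u\<in>?C. \<Sum>v\<in>?C. cnj (f u) * E u v * g v)"
  have phase: "I = (\<Sum>u\<in>?C. \<Sum>v\<in>?C. \<psi> (\<Sum>j<M. \<beta> j * (v j - u j)) * (cnj (f u) * E u v * g v))"
    if \<beta>: "\<beta> \<in> ?CT" for \<beta>
  proof -
    have "\<beta> \<in> ?C"
      using \<beta> by (simp add: configs_on_def)
    \<comment> \<open>A label acting on \<open>T\<close> as the pure phase \<open>\<beta>\<close>.
      Its effect off \<open>T\<close> is harmless: \<open>E\<close> vanishes unless \<open>u\<close>
      and \<open>v\<close> agree there, and otherwise depends only on their values on
      \<open>T\<close>.\<close>
    from surj'[OF configs_zero this] obtain s where s: "s \<in> S"
      and xz: "\<And>j. j \<in> T \<Longrightarrow> xpart (s j) = 0" "\<And>j. j \<in> T \<Longrightarrow> zpart (s j) = \<beta> j"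
      by auto
    have sM: "(\<lambda>j. xpart (s j)) \<in> ?C"
      using s S xpart_configs by blast
    show ?thesis
      unfolding I_def shift[OF s]
    proof (intro sum.cong refl)
      fix u v assume uv: "u \<in> ?C" "v \<in> ?C"
      let ?u = "\<lambda>j. u j - xpart (s j)" and ?v = "\<lambda>j. v j - xpart (s j)"
      have uv': "?u \<in> ?C" "?v \<in> ?C"
        using uv sM by (simp_all add: configs_diff)
      show "\<psi> (zdot M s (\<lambda>j. v j - u j)) * cnj (f u) * E ?u ?v * g v =
        \<psi> (\<Sum>j<M. \<beta> j * (v j - u j)) * (cnj (f u) * E u v * g v)"
      proof (cases "\<forall>j. j \<notin> T \<longrightarrow> u j = v j")
        case True
        have "E ?u ?v = E u v"
          by (rule E_loc[OF uv' uv]) (use True xz in auto)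
        moreover have "zdot M s (\<lambda>j. v j - u j) = (\<Sum>j<M. \<beta> j * (v j - u j))"
          unfolding zdot_def
        proof (intro sum.cong refl)
          fix j
          show "zpart (s j) * (v j - u j) = \<beta> j * (v j - u j)"
            using True xz by (cases "j \<in> T") auto
        qed
        ultimately show ?thesis
          by (simp add: mult_ac)
      next
        case False
        then have "E u v = 0" "E ?u ?v = 0"
          using E_off[OF uv] E_off[OF uv'] by auto
        then show ?thesis
          by simp
      qed
    qed
  qed
  have "of_nat (card ?CT) * I = (\<Sum>\<beta>\<in>?CT. I)"
    by simp
  also have "\<dots> = (\<Sum>\<beta>\<in>?CT. \<Sum>u\<in>?C. \<Sum>v\<in>?C. \<psi> (\<Sum>j<M. \<beta> j * (v j - u j)) * (cnj (f u) * E u v * g v))"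
    by (rule sum.cong[OF refl phase])
  also have "\<dots> = (\<Sum>u\<in>?C. \<Sum>v\<in>?C. (\<Sum>\<beta>\<in>?CT. \<psi> (\<Sum>j<M. \<beta> j * (v j - u j))) * (cnj (f u) * E u v * g v))"
    unfolding sum_distrib_right by (subst sum.swap) (intro sum.cong refl sum.swap)
  \<comment> \<open>Averaging over the phases removes the entries off the diagonal.\<close>
  also have "\<dots> = (\<Sum>u\<in>?C. \<Sum>v\<in>?C. if v = u then of_nat (card ?CT) * (cnj (f u) * E u u * g u) else 0)"
  proof (intro sum.cong refl)
    fix u v assume uv: "u \<in> ?C" "v \<in> ?C"
    show "(\<Sum>\<beta>\<in>?CT. \<psi> (\<Sum>j<M. \<beta> j * (v j - u j))) * (cnj (f u) * E u v * g v) =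
      (if v = u then of_nat (card ?CT) * (cnj (f u) * E u u * g u) else 0)"
    proof (cases "E u v = 0")
      case False
      then have "(\<lambda>j. v j - u j) \<in> ?CT"
        using E_off[OF uv] uv by (auto simp: configs_on_def configs_diff)
      moreover have "(\<lambda>j. v j - u j) = (\<lambda>_. 0) \<longleftrightarrow> v = u"
        by (auto simp: fun_eq_iff)
      ultimately show ?thesis
        using sum_characters_configs_on[of "\<lambda>j. v j - u j" M T] by simp
    qed auto
  qed
  also have "\<dots> = of_nat (card ?CT) * (\<Sum>u\<in>?C. cnj (f u) * E u u * g u)"
    using finite_configs by (simp add: sum_distrib_left)
  finally have diag: "I = (\<Sum>u\<in>?C. cnj (f u) * E u u * g u)"
    using card_CT by simp
  have translate: "I = (\<Sum>u\<in>?C. cnj (f u) * g u * E (\<lambda>j. u j - \<alpha> j) (\<lambda>j. u j - \<alpha> j))"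
    if \<alpha>: "\<alpha> \<in> ?CT" for \<alpha>
  proof -
    have \<alpha>C: "\<alpha> \<in> ?C"
      using \<alpha> by (simp add: configs_on_def)
    \<comment> \<open>Now a label acting on \<open>T\<close> as the pure shift by
      \<open>\<alpha>\<close>, applied to the diagonal kernel; averaging over
      \<open>\<alpha>\<close> makes the diagonal constant.\<close>
    from surj'[OF this configs_zero] obtain s where s: "s \<in> S"
      and x: "\<And>j. j \<in> T \<Longrightarrow> xpart (s j) = \<alpha> j"
      by auto
    have sM: "(\<lambda>j. xpart (s j)) \<in> ?C"
      using s S xpart_configs by blast
    define K where "K u v = (if v = u then E u u else 0)" for u v
    have "I = (\<Sum>u\<in>?C. \<Sum>v\<in>?C. cnj (f u) * K u v * g v)"
      unfolding diag K_def using finite_configs by (simp add: if_distrib if_distribR cong: if_cong)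
    also have "\<dots> = (\<Sum>u\<in>?C. \<Sum>v\<in>?C. if v = u then
         cnj (f u) * g u * E (\<lambda>j. u j - \<alpha> j) (\<lambda>j. u j - \<alpha> j) else 0)"
      unfolding shift[OF s]
    proof (intro sum.cong refl)
      fix u v assume uv: "u \<in> ?C" "v \<in> ?C"
      let ?u = "\<lambda>j. u j - xpart (s j)" and ?v = "\<lambda>j. v j - xpart (s j)"
      show "\<psi> (zdot M s (\<lambda>j. v j - u j)) * cnj (f u) * K ?u ?v * g v =
        (if v = u then cnj (f u) * g u * E (\<lambda>j. u j - \<alpha> j) (\<lambda>j. u j - \<alpha> j) else 0)"
      proof (cases "v = u")
        case True
        have "E ?u ?u = E (\<lambda>j. u j - \<alpha> j) (\<lambda>j. u j - \<alpha> j)"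
          by (rule E_loc) (use uv sM \<alpha>C x in \<open>auto simp: configs_diff\<close>)
        with True show ?thesis
          by (simp add: K_def zdot_def \<psi>_0)
      next
        case False
        then have "?v \<noteq> ?u"
          by (auto simp: fun_eq_iff)
        with False show ?thesis
          by (simp add: K_def)
      qed
    qed
    finally show ?thesis
      using finite_configs by simp
  qed
  have trace: "(\<Sum>\<alpha>\<in>?CT. E (\<lambda>j. u j - \<alpha> j) (\<lambda>j. u j - \<alpha> j)) = (\<Sum>\<alpha>\<in>?CT. E \<alpha> \<alpha>)"
    if u: "u \<in> ?C" for u
  proof -
    \<comment> \<open>Diagonal entries see only the part of \<open>u\<close> on \<open>T\<close>,
      and subtraction from that part permutes the configurations on \<open>T\<close>.\<close>
    let ?u = "\<lambda>j. if j \<in> T then u j else 0"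
    have uT: "?u \<in> ?CT"
      using u by (auto simp: configs_on_def configs_def words_over_def base_field_closed)
    have "(\<Sum>\<alpha>\<in>?CT. E (\<lambda>j. u j - \<alpha> j) (\<lambda>j. u j - \<alpha> j)) =
        (\<Sum>\<alpha>\<in>?CT. E (\<lambda>j. ?u j - \<alpha> j) (\<lambda>j. ?u j - \<alpha> j))"
    proof (intro sum.cong refl)
      fix \<alpha> assume \<alpha>: "\<alpha> \<in> ?CT"
      then have "\<alpha> \<in> ?C" "(\<lambda>j. ?u j - \<alpha> j) \<in> ?C"
        using configs_on_closed(3)[OF uT \<alpha>] by (simp_all add: configs_on_def)
      then show "E (\<lambda>j. u j - \<alpha> j) (\<lambda>j. u j - \<alpha> j) = E (\<lambda>j. ?u j - \<alpha> j) (\<lambda>j. ?u j - \<alpha> j)"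
        using u by (intro E_loc) (auto simp: configs_diff)
    qed
    also have "\<dots> = (\<Sum>\<alpha>\<in>?CT. E \<alpha> \<alpha>)"
      by (rule sum.reindex_bij_witness[of _ "\<lambda>\<alpha> j. ?u j - \<alpha> j" "\<lambda>\<alpha> j. ?u j - \<alpha> j"])
        (use configs_on_closed(3)[OF uT] in auto)
    finally show ?thesis .
  qed
  have "of_nat (card ?CT) * I = (\<Sum>\<alpha>\<in>?CT. I)"
    by simp
  also have "\<dots> = (\<Sum>\<alpha>\<in>?CT. \<Sum>u\<in>?C. cnj (f u) * g u * E (\<lambda>j. u j - \<alpha> j) (\<lambda>j. u j - \<alpha> j))"
    by (rule sum.cong[OF refl translate])
  also have "\<dots> = (\<Sum>u\<in>?C. cnj (f u) * g u * (\<Sum>\<alpha>\<in>?CT. E (\<lambda>j. u j - \<alpha> j) (\<lambda>j. u j - \<alpha> j)))"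
    unfolding sum_distrib_left by (rule sum.swap)
  also have "\<dots> = (\<Sum>u\<in>?C. cnj (f u) * g u * (\<Sum>\<alpha>\<in>?CT. E \<alpha> \<alpha>))"
    by (intro sum.cong refl) (simp add: trace)
  also have "\<dots> = (\<Sum>\<alpha>\<in>?CT. E \<alpha> \<alpha>) * inner_prod M f g"
    unfolding inner_prod_def by (subst mult.commute) (rule sum_distrib_right[symmetric])
  finally show ?thesis
    using card_CT unfolding I_def by (simp add: field_simps)
qed

end

section \<open>Entanglement-assisted codes from orthonormal families\<close>

lemma finite_qbasis: "finite (qbasis q m)"
  using finite_lists_length_eq[of "{..<q}" m] by (simp add: qbasis_def conj_commute)

lemma card_qbasis: "card (qbasis q m) = q ^ m"
  using card_lists_length_eq[of "{..<q}" m] by (simp add: qbasis_def conj_commute)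

lemma sum_Times: "(\<Sum>p\<in>A \<times> B. F p) = (\<Sum>x\<in>A. \<Sum>y\<in>B. F (x, y))"
  by (simp add: sum.cartesian_product)

lemma max_entangled_eq:
  assumes "z \<in> qbasis q c" and "y \<in> qbasis q c"
  shows "max_entangled q c z y = of_bool (z = y) * (1 / complex_of_real (sqrt (real q))) ^ c"
proof (cases "z = y")
  case True
  then show ?thesis
    using assms by (simp add: max_entangled_def)
next
  case False
  then obtain j where "j < c" "z ! j \<noteq> y ! j"
    using assms nth_equalityI[of z y] by (auto simp: qbasis_def)
  then have "(\<Prod>j<c. (if z ! j = y ! j then 1 / complex_of_real (sqrt (real q)) else 0)) = 0"
    by (intro prod_zero) auto
  with False show ?thesis
    using assms by (simp add: max_entangled_def)
qed

text \<open>
  The states \<open>V w\<close> span the code space. Their slices along the receiver's basis are, up to the factor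
  \<open>q ^ (c / 2)\<close>, the columns of the encoding isometry.
\<close>

lemma eaqecc_from_states:
  fixes V :: "nat list \<Rightarrow> nat list \<times> nat list \<Rightarrow> complex"
  assumes "q > 0"
    and supp: "\<And>w x y. w \<notin> qbasis q \<kappa> \<or> x \<notin> qbasis q n \<or> y \<notin> qbasis q c \<Longrightarrow> V w (x, y) = 0"
    and slices: "\<And>w w' z z'. w \<in> qbasis q \<kappa> \<Longrightarrow> w' \<in> qbasis q \<kappa> \<Longrightarrow> z \<in> qbasis q c \<Longrightarrow> z' \<in> qbasis q c \<Longrightarrow>
      (\<Sum>x\<in>qbasis q n. cnj (V w (x, z)) * V w' (x, z')) = of_bool (w = w' \<and> z = z') / of_nat (q ^ c)"
    and detect: "\<And>S E. S \<subseteq> {..<n} \<Longrightarrow> card S < d \<Longrightarrow> acts_only_on q n S E \<Longrightarrow>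
      \<exists>\<mu>. \<forall>w\<in>qbasis q \<kappa>. \<forall>w'\<in>qbasis q \<kappa>.
        (\<Sum>x\<in>qbasis q n. \<Sum>y\<in>qbasis q c. \<Sum>x'\<in>qbasis q n. cnj (V w (x, y)) * E x x' * V w' (x', y)) =
        \<mu> * of_bool (w = w')"
  shows "eaqecc_exists q n \<kappa> d c"
proof -
  define W where "W = qbasis q \<kappa>"
  define X where "X = qbasis q n"
  define Y where "Y = qbasis q c"
  have fin: "finite W" "finite X" "finite Y"
    by (simp_all add: W_def X_def Y_def finite_qbasis)
  note supp = supp[folded W_def X_def Y_def]
  note slices = slices[folded W_def X_def Y_def]
  have V_nz: "w \<in> W \<and> x \<in> X \<and> y \<in> Y" if "V w (x, y) \<noteq> 0" for w x y
    using supp[of w x y] that by blast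
  have ortho: "(\<Sum>p\<in>X \<times> Y. cnj (V w p) * V w' p) = of_bool (w = w')" if "w \<in> W" "w' \<in> W" for w w'
  proof -
    have "(\<Sum>p\<in>X \<times> Y. cnj (V w p) * V w' p) = (\<Sum>x\<in>X. \<Sum>y\<in>Y. cnj (V w (x, y)) * V w' (x, y))"
      by (rule sum_Times)
    also have "\<dots> = (\<Sum>y\<in>Y. \<Sum>x\<in>X. cnj (V w (x, y)) * V w' (x, y))"
      by (rule sum.swap)
    also have "\<dots> = (\<Sum>y\<in>Y. of_bool (w = w') / of_nat (q ^ c))"
      by (intro sum.cong refl) (simp add: slices that)
    also have "\<dots> = of_bool (w = w')"
      using \<open>q > 0\<close> by (simp add: Y_def card_qbasis)
    finally show ?thesis .
  qed
  define s where "s = complex_of_real (sqrt (real q))"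
  have s_sq: "s * s = of_nat q"
    by (simp add: s_def flip: of_real_mult)
  have s_nz: "s \<noteq> 0"
    using \<open>q > 0\<close> by (simp add: s_def)
  have cnj_s: "cnj s = s"
    by (simp add: s_def)
  have s_pow: "s ^ c * s ^ c = of_nat (q ^ c)"
    by (simp add: s_sq flip: power_mult_distrib)
  define U where "U x = (\<lambda>(w, z). s ^ c * V w (x, z))" for x
  define P where "P a b = (\<Sum>w\<in>W. V w a * cnj (V w b))" for a b
  have "is_isometry X (W \<times> Y) U"
    unfolding is_isometry_def
  proof
    show "U \<in> opers X (W \<times> Y)"
      unfolding opers_def U_def using V_nz by fastforce
    show "op_mult X (op_adjoint U) U = op_id (W \<times> Y)"
    proof (intro ext)
      fix a b :: "nat list \<times> nat list"
      obtain w z w' z' where ab: "a = (w, z)" "b = (w', z')"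
        by (cases a, cases b) auto
      have eq: "op_mult X (op_adjoint U) U a b = of_nat (q ^ c) * (\<Sum>x\<in>X. cnj (V w (x, z)) * V w' (x, z'))"
        unfolding s_pow[symmetric]
        by (simp add: op_mult_def op_adjoint_def U_def ab cnj_s sum_distrib_left mult_ac)
      show "op_mult X (op_adjoint U) U a b = op_id (W \<times> Y) a b"
      proof (cases "w \<in> W \<and> w' \<in> W \<and> z \<in> Y \<and> z' \<in> Y")
        case True
        then show ?thesis
          unfolding eq using \<open>q > 0\<close> by (auto simp: slices op_id_def ab)
      next
        case False
        have "(\<Sum>x\<in>X. cnj (V w (x, z)) * V w' (x, z')) = 0"
        proof (intro sum.neutral ballI)
          fix x
          show "cnj (V w (x, z)) * V w' (x, z') = 0"
            using False V_nz[of w x z] V_nz[of w' x z'] by auto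
        qed
        with False show ?thesis
          unfolding eq by (auto simp: op_id_def ab)
      qed
    qed
  qed
  moreover have "is_projector_onto (X \<times> Y) P (code_space q \<kappa> c U)"
  proof -
    define comb where "comb \<phi> = (\<lambda>p. \<Sum>w\<in>W. \<phi> w * V w p)" for \<phi> :: "nat list \<Rightarrow> complex"
    have comb_cong: "comb \<phi> = comb \<phi>'" if "\<And>w. w \<in> W \<Longrightarrow> \<phi> w = \<phi>' w" for \<phi> \<phi>'
      unfolding comb_def by (intro ext sum.cong) (simp_all add: that)
    \<comment> \<open>The identity fixes the receiver's label and the entangled state makes the
      sender's half equal to it; its coefficient cancels the factor \<open>s ^ c\<close> of
      \<open>U\<close>.\<close>
    have space: "op_apply ((W \<times> Y) \<times> Y) (op_tensor U (op_id Y))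
        (\<lambda>((w, z), y). \<phi> w * max_entangled q c z y) = comb \<phi>" for \<phi>
    proof
      fix p :: "nat list \<times> nat list"
      obtain x y where p: "p = (x, y)"
        by (cases p)
      have "op_apply ((W \<times> Y) \<times> Y) (op_tensor U (op_id Y))
          (\<lambda>((w, z), y). \<phi> w * max_entangled q c z y) p =
        (\<Sum>w\<in>W. \<Sum>z\<in>Y. \<Sum>y'\<in>Y. U x (w, z) * op_id Y y y' * (\<phi> w * max_entangled q c z y'))"
        unfolding op_apply_def p
        by (simp add: sum_Times op_tensor_def)
      also have "\<dots> = (\<Sum>w\<in>W. \<Sum>z\<in>Y. \<Sum>y'\<in>Y. if y' = y then
          (if z = y then \<phi> w * V w (x, y) else 0) else 0)"
      proof (intro sum.cong refl)
        fix w z y' assume "w \<in> W" and zy: "z \<in> Y" "y' \<in> Y"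
        have "max_entangled q c z y' = of_bool (z = y') * (1 / s) ^ c"
          using max_entangled_eq[of z q c y'] zy by (simp add: Y_def s_def)
        then show "U x (w, z) * op_id Y y y' * (\<phi> w * max_entangled q c z y') =
          (if y' = y then (if z = y then \<phi> w * V w (x, y) else 0) else 0)"
          using zy s_nz by (auto simp: op_id_def U_def power_one_over field_simps)
      qed
      also have "\<dots> = (\<Sum>w\<in>W. \<phi> w * V w (x, y))"
      proof (intro sum.cong refl)
        fix w
        show "(\<Sum>z\<in>Y. \<Sum>y'\<in>Y. if y' = y then (if z = y then \<phi> w * V w (x, y) else 0) else 0) =
          \<phi> w * V w (x, y)"
          using fin supp[of w x y] by (cases "y \<in> Y") simp_all
      qed
      finally show "op_apply ((W \<times> Y) \<times> Y) (op_tensor U (op_id Y))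
          (\<lambda>((w, z), y). \<phi> w * max_entangled q c z y) p = comb \<phi> p"
        by (simp add: comb_def p)
    qed
    have code_space: "code_space q \<kappa> c U = comb ` hilb W"
      unfolding code_space_def W_def[symmetric] Y_def[symmetric] space by blast
    have P_opers: "P \<in> opers (X \<times> Y) (X \<times> Y)"
    proof -
      have "P a b = 0" if "a \<notin> X \<times> Y \<or> b \<notin> X \<times> Y" for a b
      proof -
        obtain x y x' y' where "a = (x, y)" "b = (x', y')"
          by (cases a, cases b) auto
        then show ?thesis
          unfolding P_def using that supp[of _ x y] supp[of _ x' y'] by (intro sum.neutral) auto
      qed
      then show ?thesis
        by (simp add: opers_def)
    qed
    have P_adj: "op_adjoint P = P"
      by (intro ext) (simp add: op_adjoint_def P_def mult.commute)
    have P_comb: "op_apply (X \<times> Y) P f = comb (\<lambda>w. \<Sum>b\<in>X \<times> Y. cnj (V w b) * f b)" for f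
    proof
      fix a
      have "op_apply (X \<times> Y) P f a = (\<Sum>b\<in>X \<times> Y. \<Sum>w\<in>W. V w a * cnj (V w b) * f b)"
        by (simp add: op_apply_def P_def sum_distrib_right)
      also have "\<dots> = (\<Sum>w\<in>W. \<Sum>b\<in>X \<times> Y. V w a * cnj (V w b) * f b)"
        by (rule sum.swap)
      finally show "op_apply (X \<times> Y) P f a = comb (\<lambda>w. \<Sum>b\<in>X \<times> Y. cnj (V w b) * f b) a"
        by (simp add: comb_def sum_distrib_left mult_ac)
    qed
    have proj: "(\<Sum>b\<in>X \<times> Y. cnj (V w b) * comb \<phi> b) = \<phi> w" if "w \<in> W" for w \<phi>
    proof -
      have "(\<Sum>b\<in>X \<times> Y. cnj (V w b) * comb \<phi> b) =
          (\<Sum>b\<in>X \<times> Y. \<Sum>w'\<in>W. \<phi> w' * (cnj (V w b) * V w' b))"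
        by (simp add: comb_def sum_distrib_left mult_ac)
      also have "\<dots> = (\<Sum>w'\<in>W. \<Sum>b\<in>X \<times> Y. \<phi> w' * (cnj (V w b) * V w' b))"
        by (rule sum.swap)
      also have "\<dots> = (\<Sum>w'\<in>W. \<phi> w' * of_bool (w = w'))"
        by (intro sum.cong refl) (simp add: ortho that flip: sum_distrib_left)
      also have "\<dots> = (\<Sum>w'\<in>W. if w' = w then \<phi> w else 0)"
        by (intro sum.cong) auto
      finally show ?thesis
        using fin that by simp
    qed
    have P_fix: "op_apply (X \<times> Y) P (comb \<phi>) = comb \<phi>" for \<phi>
      unfolding P_comb by (rule comb_cong) (rule proj)
    have "op_mult (X \<times> Y) P P = P"
    proof (intro ext)
      fix a b
      have P_b: "(\<lambda>p. P p b) = comb (\<lambda>w. cnj (V w b))"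
        by (simp add: comb_def P_def mult.commute)
      have "op_mult (X \<times> Y) P P a b = op_apply (X \<times> Y) P (\<lambda>p. P p b) a"
        by (simp add: op_mult_def op_apply_def)
      also have "\<dots> = comb (\<lambda>w. cnj (V w b)) a"
        unfolding P_b P_fix ..
      also have "\<dots> = P a b"
        unfolding P_b[symmetric] ..
      finally show "op_mult (X \<times> Y) P P a b = P a b" .
    qed
    moreover have "op_apply (X \<times> Y) P ` hilb (X \<times> Y) = comb ` hilb W"
    proof (intro equalityI subsetI)
      fix f assume "f \<in> op_apply (X \<times> Y) P ` hilb (X \<times> Y)"
      then obtain g where f: "f = comb (\<lambda>w. \<Sum>b\<in>X \<times> Y. cnj (V w b) * g b)"
        by (auto simp: P_comb)
      have "f = comb (\<lambda>w. if w \<in> W then \<Sum>b\<in>X \<times> Y. cnj (V w b) * g b else 0)"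
        unfolding f by (rule comb_cong) simp
      then show "f \<in> comb ` hilb W"
        by (rule image_eqI[of f comb]) (simp add: hilb_def)
    next
      fix f assume "f \<in> comb ` hilb W"
      then obtain \<phi> where f: "f = comb \<phi>"
        by auto
      have "comb \<phi> p = 0" if "p \<notin> X \<times> Y" for p
        using that supp by (cases p) (auto simp: comb_def intro!: sum.neutral)
      then have "comb \<phi> \<in> hilb (X \<times> Y)"
        by (simp add: hilb_def)
      then show "f \<in> op_apply (X \<times> Y) P ` hilb (X \<times> Y)"
        unfolding f by (rule image_eqI[of _ "op_apply (X \<times> Y) P", OF P_fix[symmetric]])
    qed
    ultimately show ?thesis
      unfolding is_projector_onto_def code_space using P_opers P_adj by blast
  qed
  moreover have "detects_errors q n c d P"
    unfolding detects_errors_def Let_def X_def[symmetric] Y_def[symmetric]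
  proof (intro allI impI, elim conjE)
    fix S E assume "S \<subseteq> {..<n}" "card S < d" "acts_only_on q n S E"
    from detect[OF this, folded W_def X_def Y_def] obtain \<mu> where \<mu>: "\<And>w w'. w \<in> W \<Longrightarrow> w' \<in> W \<Longrightarrow>
        (\<Sum>x\<in>X. \<Sum>y\<in>Y. \<Sum>x'\<in>X. cnj (V w (x, y)) * E x x' * V w' (x', y)) = \<mu> * of_bool (w = w')"
      by blast
    let ?F = "op_tensor E (op_id Y)"
    have F: "(\<Sum>a\<in>X \<times> Y. \<Sum>b\<in>X \<times> Y. cnj (V w a) * ?F a b * V w' b) = \<mu> * of_bool (w = w')"
      if "w \<in> W" "w' \<in> W" for w w'
    proof -
      have "(\<Sum>a\<in>X \<times> Y. \<Sum>b\<in>X \<times> Y. cnj (V w a) * ?F a b * V w' b) =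
        (\<Sum>x\<in>X. \<Sum>y\<in>Y. \<Sum>x'\<in>X. \<Sum>y'\<in>Y. cnj (V w (x, y)) * (E x x' * op_id Y y y') * V w' (x', y'))"
        by (simp add: sum_Times op_tensor_def)
      also have "\<dots> = (\<Sum>x\<in>X. \<Sum>y\<in>Y. \<Sum>x'\<in>X. \<Sum>y'\<in>Y. if y' = y then cnj (V w (x, y)) * E x x' * V w' (x', y) else 0)"
        by (intro sum.cong refl) (auto simp: op_id_def)
      also have "\<dots> = (\<Sum>x\<in>X. \<Sum>y\<in>Y. \<Sum>x'\<in>X. cnj (V w (x, y)) * E x x' * V w' (x', y))"
        using fin by (intro sum.cong refl) simp
      finally show ?thesis
        by (simp add: \<mu> that)
    qed
    have "op_mult (X \<times> Y) P (op_mult (X \<times> Y) ?F P) a b = \<mu> * P a b" for a b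
    proof -
      \<comment> \<open>The sums are reordered to isolate the matrix elements of the error between
        code states; \<open>F\<close>, the Knill-Laflamme condition, then evaluates them.\<close>
      have expand: "P a a' * (?F a' b' * P b' b) = (\<Sum>w\<in>W. \<Sum>w'\<in>W.
           V w a * (cnj (V w a') * ?F a' b' * V w' b') * cnj (V w' b))" for a' b'
      proof -
        have "P a a' * (?F a' b' * P b' b) = ?F a' b' * (P a a' * P b' b)"
          by (simp add: mult_ac)
        also have "\<dots> = (\<Sum>w\<in>W. \<Sum>w'\<in>W. ?F a' b' * ((V w a * cnj (V w a')) * (V w' b' * cnj (V w' b))))"
          by (simp only: P_def sum_product) (simp only: sum_distrib_left)
        finally show ?thesis
          by (simp add: mult_ac)
      qed
      have "op_mult (X \<times> Y) P (op_mult (X \<times> Y) ?F P) a b =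
        (\<Sum>a'\<in>X \<times> Y. \<Sum>b'\<in>X \<times> Y. \<Sum>w\<in>W. \<Sum>w'\<in>W.
           V w a * (cnj (V w a') * ?F a' b' * V w' b') * cnj (V w' b))"
        by (simp add: op_mult_def sum_distrib_left flip: expand)
      also have "\<dots> = (\<Sum>a'\<in>X \<times> Y. \<Sum>w\<in>W. \<Sum>b'\<in>X \<times> Y. \<Sum>w'\<in>W.
           V w a * (cnj (V w a') * ?F a' b' * V w' b') * cnj (V w' b))"
        by (intro sum.cong refl sum.swap)
      also have "\<dots> = (\<Sum>w\<in>W. \<Sum>a'\<in>X \<times> Y. \<Sum>w'\<in>W. \<Sum>b'\<in>X \<times> Y.
           V w a * (cnj (V w a') * ?F a' b' * V w' b') * cnj (V w' b))"
        by (subst sum.swap) (intro sum.cong refl sum.swap)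
      also have "\<dots> = (\<Sum>w\<in>W. \<Sum>w'\<in>W. \<Sum>a'\<in>X \<times> Y. \<Sum>b'\<in>X \<times> Y.
           V w a * (cnj (V w a') * ?F a' b' * V w' b') * cnj (V w' b))"
        by (intro sum.cong refl sum.swap)
      also have "\<dots> = (\<Sum>w\<in>W. \<Sum>w'\<in>W. V w a *
          (\<Sum>a'\<in>X \<times> Y. \<Sum>b'\<in>X \<times> Y. cnj (V w a') * ?F a' b' * V w' b') * cnj (V w' b))"
        by (simp add: sum_distrib_left sum_distrib_right)
      also have "\<dots> = (\<Sum>w\<in>W. \<Sum>w'\<in>W. if w' = w then \<mu> * (V w a * cnj (V w b)) else 0)"
        by (intro sum.cong refl) (auto simp: F)
      also have "\<dots> = \<mu> * P a b"
        using fin by (simp add: P_def sum_distrib_left)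
      finally show ?thesis .
    qed
    then show "\<exists>\<mu>. op_mult (X \<times> Y) P (op_mult (X \<times> Y) ?F P) = (\<lambda>x y. \<mu> * P x y)"
      by (intro exI[of _ \<mu>] ext)
  qed
  ultimately show ?thesis
    unfolding eaqecc_exists_def W_def X_def Y_def by blast
qed

section \<open>Sublists, split sums and concatenation of labels\<close>

lemma nths_cong:
  assumes "length xs = length ys" and "\<And>j. j \<in> S \<Longrightarrow> j < length xs \<Longrightarrow> xs ! j = ys ! j"
  shows "nths xs S = nths ys S"
proof -
  have *: "nths zs S = map (\<lambda>j. zs ! j) (nths [0..<length zs] S)" for zs :: "'b list"
    by (simp add: map_nth flip: nths_map)
  show ?thesis
    unfolding *[of xs] *[of ys] assms(1)[symmetric]
    by (rule map_cong) (auto simp: set_nths assms(2))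
qed

lemma sum_lessThan_add: "(\<Sum>j<m + n. F j) = (\<Sum>j<m. F j) + (\<Sum>i<n. F (m + i))"
  for F :: "nat \<Rightarrow> 'b::comm_monoid_add"
  by (induction n) (simp_all add: add.assoc)

lemma bij_betw_append_qbasis:
  "bij_betw (\<lambda>(x, y). x @ y) (qbasis q n \<times> qbasis q c) (qbasis q (n + c))"
proof (rule bij_betw_byWitness[where f' = "\<lambda>z. (take n z, drop n z)"])
  show "(\<lambda>z. (take n z, drop n z)) ` qbasis q (n + c) \<subseteq> qbasis q n \<times> qbasis q c"
    using set_take_subset set_drop_subset by (fastforce simp: qbasis_def)
qed (auto simp: qbasis_def)

section \<open>The Hermitian construction\<close>

context weyl_system
begin

text \<open>Qudit labels are digits below q, Weyl operators need field elements. Any bijection will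
  do.\<close>

definition letter :: "nat \<Rightarrow> 'a" where
  "letter = (SOME e. bij_betw e {..<q} base_field)"

lemma bij_betw_letter: "bij_betw letter {..<q} base_field"
proof -
  have "\<exists>e. bij_betw e {..<q} (base_field :: 'a set)"
    by (rule finite_same_card_bij) (simp_all add: card_base_field)
  then show ?thesis
    unfolding letter_def by (rule someI_ex)
qed

definition decode :: "nat list \<Rightarrow> nat \<Rightarrow> 'a" where
  "decode xs = (\<lambda>j. if j < length xs then letter (xs ! j) else 0)"

text \<open>The length is an argument so that a configuration of all qudits can be cut to the
  sender's \<open>n\<close>.\<close>

definition encode :: "nat \<Rightarrow> (nat \<Rightarrow> 'a) \<Rightarrow> nat list" where
  "encode m u = map (\<lambda>j. inv_into {..<q} letter (u j)) [0..<m]"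

section \<open>Translation between digit lists and configurations\<close>

lemma letter_base_field: "i < q \<Longrightarrow> letter i \<in> base_field"
  using bij_betw_letter by (auto simp: bij_betw_def)

lemma inv_letter_letter: "i < q \<Longrightarrow> inv_into {..<q} letter (letter i) = i"
  using bij_betw_letter by (auto simp: bij_betw_def intro: inv_into_f_f)

lemma letter_inv_letter: "x \<in> base_field \<Longrightarrow> letter (inv_into {..<q} letter x) = x"
  using bij_betw_letter by (auto simp: bij_betw_def intro: f_inv_into_f)

lemma inv_letter_less: "x \<in> base_field \<Longrightarrow> inv_into {..<q} letter x < q"
  using bij_betw_letter inv_into_into[of x letter "{..<q}"] by (auto simp: bij_betw_def)

lemma decode_configs: "xs \<in> qbasis q m \<Longrightarrow> decode xs \<in> configs m"
  by (auto simp: decode_def qbasis_def configs_def words_over_def base_field_closed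
      intro!: letter_base_field dest: nth_mem)

lemma encode_qbasis: "u \<in> configs m \<Longrightarrow> encode m u \<in> qbasis q m"
  by (auto simp: encode_def qbasis_def configs_def intro: inv_letter_less)

lemma encode_decode: "xs \<in> qbasis q m \<Longrightarrow> encode m (decode xs) = xs"
  by (rule nth_equalityI) (auto simp: encode_def decode_def qbasis_def intro!: inv_letter_letter dest: nth_mem)

lemma decode_encode: "u \<in> configs m \<Longrightarrow> decode (encode m u) = u"
  by (rule ext) (auto simp: encode_def decode_def configs_def words_over_def letter_inv_letter)

lemma bij_betw_decode: "bij_betw decode (qbasis q m) (configs m)"
  by (rule bij_betw_byWitness[where f' = "encode m"])
    (auto simp: encode_decode decode_encode decode_configs encode_qbasis)

lemma decode_eq_iff: "x \<in> qbasis q m \<Longrightarrow> y \<in> qbasis q m \<Longrightarrow> decode x = decode y \<longleftrightarrow> x = y"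
  using bij_betw_decode[of m] by (auto simp: bij_betw_def inj_on_def)

lemma sum_configs_decode:
  "(\<Sum>u\<in>configs (n + c). F u) = (\<Sum>x\<in>qbasis q n. \<Sum>y\<in>qbasis q c. F (decode (x @ y)))"
proof -
  have "(\<Sum>u\<in>configs (n + c). F u) = (\<Sum>z\<in>qbasis q (n + c). F (decode z))"
    by (rule sum.reindex_bij_betw[OF bij_betw_decode, symmetric])
  also have "\<dots> = (\<Sum>p\<in>qbasis q n \<times> qbasis q c. F (decode (case p of (x, y) \<Rightarrow> x @ y)))"
    by (rule sum.reindex_bij_betw[OF bij_betw_append_qbasis, symmetric])
  finally show ?thesis
    by (simp add: sum_Times)
qed

lemma decode_append_left: "x \<in> qbasis q n \<Longrightarrow> j < n \<Longrightarrow> decode (x @ y) j = decode x j"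
  by (simp add: decode_def qbasis_def nth_append)

lemma decode_append_right: "x \<in> qbasis q n \<Longrightarrow> decode (x @ y) (n + i) = decode y i"
  by (simp add: decode_def qbasis_def nth_append)

lemma encode_decode_append:
  assumes "x \<in> qbasis q n"
  shows "encode n (decode (x @ y)) = x"
proof -
  have "encode n (decode (x @ y)) = encode n (decode x)"
    unfolding encode_def by (rule map_cong) (auto simp: decode_append_left[OF assms])
  then show ?thesis
    by (simp add: encode_decode assms)
qed

lemma card_configs: "card (configs m) = q ^ m"
  using card_words_over_valued[OF base_field_closed(1), of m] by (simp add: configs_def card_base_field)

lemma card_configs_on_tail: "card (configs_on (n + c) {n..<n + c}) = q ^ c"
proof -
  have "bij_betw (\<lambda>w j. if j < n then 0 else w (j - n)) (configs c) (configs_on (n + c) {n..<n + c})"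
  proof (rule bij_betw_byWitness[where f' = "\<lambda>u i. u (n + i)"])
    show "\<forall>u\<in>configs_on (n + c) {n..<n + c}. (\<lambda>j. if j < n then 0 else u (n + (j - n))) = u"
      by (intro ballI ext) (auto simp: configs_on_def)
  qed (auto simp: configs_on_def configs_def words_over_def base_field_closed)
  then show ?thesis
    by (simp add: card_configs flip: bij_betw_same_card)
qed

text \<open>The hypothesis \<open>full_on n m C\<close> expresses the dual distance:
  \<open>C\<close> takes all values on every set of at most \<open>m\<close> positions exactly if
  its dual has no nonzero word of weight at most \<open>m\<close>. Hence the distance
  \<open>m + 1\<close>.\<close>

theorem hermitian_construction_from_weyl:
  fixes C :: "(nat \<Rightarrow> 'a) set"
  assumes C: "word_space.subspace C" "C \<subseteq> words_over n"
    and card_C: "card C = (q ^ 2) ^ k" and card_hull: "card (hermitian_hull q n C) = (q ^ 2) ^ r"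
    and full: "full_on n m C"
  shows "eaqecc_exists q n (n - k - r) (m + 1) (k - r)"
proof -
  define c where "c = k - r"
  define \<kappa> where "\<kappa> = n - k - r"
  let ?M = "n + c"
  have Q: "q ^ 2 > 1"
    using one_less_power[OF q_gt_1, of 2] by simp
  let ?D = "hermitian_dual q n C"
  have D: "word_space.subspace ?D" "?D \<subseteq> words_over n"
    using subspace_hermitian_dual by (auto simp: hermitian_dual_iff)
  have "(q ^ 2) ^ k * card ?D = (q ^ 2) ^ n"
    using card_hermitian_dual[OF C] by (simp add: card_C)
  moreover from this have "k \<le> n"
    using Q by (intro power_dvd_imp_le[of "q ^ 2"]) (auto intro: dvdI[OF sym])
  ultimately have card_D: "card ?D = (q ^ 2) ^ (n - k)"
    using q_gt_1 by (metis le_add_diff_inverse mult_left_cancel not_one_less_zero power_add power_not_zero)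
  \<comment> \<open>By double duality both hulls are the intersection of the code and its dual, so
    the same \<open>r\<close> governs the logical operators.\<close>
  have "hermitian_hull q n ?D = hermitian_hull q n C"
    unfolding hermitian_hull_def hermitian_dual_dual[OF C] by (rule Int_commute)
  then have card_hull_D: "card (hermitian_hull q n ?D) = (q ^ 2) ^ r"
    using card_hull by simp
  obtain u where u: "\<And>i. i < c \<Longrightarrow> u i \<in> C"
    and u_u: "\<And>i j. i < c \<Longrightarrow> j < c \<Longrightarrow> herm n (u i) (u j) = of_bool (i = j)"
    and u_hull: "\<forall>x\<in>C. (\<forall>i<c. herm n x (u i) = 0) \<longrightarrow> x \<in> hermitian_hull q n C"
    using orthonormal_basis_modulo_hull[OF C card_C card_hull, folded c_def] by auto
  obtain t where t: "\<And>i. i < \<kappa> \<Longrightarrow> t i \<in> ?D"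
    and t_t: "\<And>i j. i < \<kappa> \<Longrightarrow> j < \<kappa> \<Longrightarrow> herm n (t i) (t j) = of_bool (i = j)"
    using orthonormal_basis_modulo_hull[OF D card_D card_hull_D, folded \<kappa>_def] by auto
  \<comment> \<open>An element of norm -1 flips the sign of the receiver's contribution to the form,
    so that it cancels the sender's.\<close>
  have "(- 1 :: 'a) \<in> base_field"
    by (intro base_field_closed)
  from norm_surj[OF this] obtain \<eta> :: 'a where \<eta>: "\<eta> ^ (q + 1) = - 1" ..
  then have "\<eta> \<noteq> 0"
    using q_gt_1 by auto
  define ext where "ext x = (\<lambda>j. if j < n then x j else if j < ?M then \<eta> * herm n x (u (j - n)) else 0)" for x
  define S where "S = ext ` C"
  have S: "S \<subseteq> words_over ?M"
    by (auto simp: S_def ext_def words_over_def)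
  have herm_split: "herm ?M x y = herm n x y + (\<Sum>i<c. x (n + i) * y (n + i) ^ q)" for x y :: "nat \<Rightarrow> 'a"
    unfolding herm_def by (rule sum_lessThan_add)
  have herm_ext: "herm ?M x (ext y) = herm n x y" if "x \<in> words_over n" for x y
  proof -
    have "x (n + i) = 0" for i
      using that by (simp add: words_over_def)
    then have "herm ?M x (ext y) = herm n x (ext y)"
      by (simp add: herm_split)
    then show ?thesis
      by (simp add: herm_def ext_def)
  qed
  have iso: "herm ?M x y = 0" if "x \<in> S" "y \<in> S" for x y
  proof -
    from that obtain x' y' where x': "x' \<in> C" "x = ext x'" and y': "y' \<in> C" "y = ext y'"
      by (auto simp: S_def)
    \<comment> \<open>Modulo the hull \<open>x'\<close> equals this projection, so its form with
      \<open>y'\<close> is computed from the coefficients that \<open>ext\<close> stores in the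
      receiver's coordinates.\<close>
    let ?p = "\<lambda>j. \<Sum>i<c. herm n x' (u i) * u i j"
    have "(\<lambda>j. x' j - ?p j) \<in> hermitian_hull q n C"
    proof (rule u_hull[rule_format])
      show "(\<lambda>j. x' j - ?p j) \<in> C"
        by (intro subspace_diff[OF C(1) x'(1)] subspace_linear_combination[OF C(1) u])
      fix l assume "l < c"
      then have "herm n ?p (u l) = (\<Sum>i<c. if i = l then herm n x' (u i) else 0)"
        unfolding herm_linear_combination_left by (intro sum.cong) (auto simp: u_u)
      then show "herm n (\<lambda>j. x' j - ?p j) (u l) = 0"
        using \<open>l < c\<close> by (simp add: herm_diff_left)
    qed
    then have "herm n (\<lambda>j. x' j - ?p j) y' = 0"
      using y'(1) by (simp add: hermitian_hull_iff)
    then have x'_y': "herm n x' y' = (\<Sum>i<c. herm n x' (u i) * herm n (u i) y')"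
      by (simp add: herm_diff_left herm_linear_combination_left)
    have "herm n x y = herm n x' y'"
      by (simp add: x' y' ext_def herm_def)
    moreover have "x (n + i) * y (n + i) ^ q = - (herm n x' (u i) * herm n (u i) y')" if "i < c" for i
    proof -
      have "x (n + i) * y (n + i) ^ q = \<eta> ^ (q + 1) * (herm n x' (u i) * herm n y' (u i) ^ q)"
        using that by (simp add: x' y' ext_def power_mult_distrib mult_ac)
      then show ?thesis
        unfolding \<eta> herm_conj by simp
    qed
    then have "(\<Sum>i<c. x (n + i) * y (n + i) ^ q) = - (\<Sum>i<c. herm n x' (u i) * herm n (u i) y')"
      by (simp add: sum_negf)
    ultimately show ?thesis
      by (simp add: herm_split x'_y')
  qed
  have t_words: "t i \<in> words_over n" if "i < \<kappa>" for i
    using t[OF that] D(2) by blast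
  have words_le: "x \<in> words_over ?M" if "x \<in> words_over n" for x :: "nat \<Rightarrow> 'a"
    using that by (simp add: words_over_def)
  \<comment> \<open>The \<open>t i\<close> are dual to \<open>C\<close> and vanish on the receiver's
    coordinates, so extending the words of \<open>C\<close> does not affect their
    orthogonality.\<close>
  have t_S: "herm ?M (t i) x = 0" if "i < \<kappa>" "x \<in> S" for i x
    using that t[OF that(1)] herm_ext[OF t_words[OF that(1)]] by (auto simp: S_def hermitian_dual_iff)
  have t_t': "herm ?M (t i) (t j) = of_bool (i = j)" if "i < \<kappa>" "j < \<kappa>" for i j
  proof -
    have "t i (n + l) = 0" for l
      using t_words[OF that(1)] by (simp add: words_over_def)
    then show ?thesis
      using t_t[OF that] by (simp add: herm_split)
  qed
  have full_sender: "\<exists>s\<in>S. \<forall>j\<in>T. s j = x j" if T: "T \<subseteq> {..<n}" "card T < m + 1" for T x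
  proof -
    have "card T \<le> m"
      using T by simp
    from full_onD[OF full T(1) this] obtain y where y: "y \<in> C" "\<forall>j\<in>T. y j = x j"
      by blast
    have "\<forall>j\<in>T. ext y j = x j"
      using y(2) T(1) by (auto simp: ext_def)
    with y(1) show ?thesis
      unfolding S_def by blast
  qed
  have full_receiver: "\<exists>s\<in>S. \<forall>j\<in>{n..<?M}. s j = x j" for x
  proof -
    \<comment> \<open>The receiver's coordinates are \<open>\<eta>\<close> times the coefficients
      along the orthonormal family, and these can be prescribed freely.\<close>
    let ?y = "\<lambda>j. \<Sum>i<c. (x (n + i) / \<eta>) * u i j"
    have "?y \<in> C"
      by (rule subspace_linear_combination[OF C(1) u])
    moreover have "ext ?y j = x j" if "j \<in> {n..<?M}" for j
    proof -
      have j: "j - n < c" "n + (j - n) = j"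
        using that by auto
      have "herm n ?y (u (j - n)) = (\<Sum>i<c. if i = j - n then x (n + i) / \<eta> else 0)"
        unfolding herm_linear_combination_left by (intro sum.cong) (use j in \<open>auto simp: u_u\<close>)
      also have "\<dots> = x j / \<eta>"
        using j by simp
      finally show ?thesis
        using that \<open>\<eta> \<noteq> 0\<close> by (simp add: ext_def)
    qed
    ultimately show ?thesis
      unfolding S_def by (intro bexI[of _ "ext ?y"] ballI imageI)
  qed
  obtain \<Psi> :: "(nat \<Rightarrow> 'a) \<Rightarrow> (nat \<Rightarrow> 'a) \<Rightarrow> complex" and \<chi> where states:
    "\<forall>w s. s \<in> S \<longrightarrow> weyl ?M s (\<Psi> w) = (\<lambda>u. \<chi> s * \<Psi> w u)" "\<forall>s\<in>S. norm (\<chi> s) = 1"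
    "\<forall>w\<in>configs \<kappa>. \<forall>w'\<in>configs \<kappa>. inner_prod ?M (\<Psi> w) (\<Psi> w') = of_bool (w = w')"
    using stabilizer_states[where \<kappa> = \<kappa>, OF S iso words_le[OF t_words] t_S t_t'] by auto
  note eig = states(1)[rule_format] and \<chi> = states(2)[rule_format] and ortho = states(3)[rule_format]
  define V where "V w = (\<lambda>(x, y). if w \<in> qbasis q \<kappa> \<and> x \<in> qbasis q n \<and> y \<in> qbasis q c
    then \<Psi> (decode w) (decode (x @ y)) else 0)" for w
  have expectation: "(\<Sum>x\<in>qbasis q n. \<Sum>y\<in>qbasis q c. \<Sum>x'\<in>qbasis q n. \<Sum>y'\<in>qbasis q c.
        cnj (V w (x, y)) * K (decode (x @ y)) (decode (x' @ y')) * V w' (x', y')) =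
      (\<Sum>\<alpha>\<in>configs_on ?M T. K \<alpha> \<alpha>) / of_nat (card (configs_on ?M T)) * of_bool (w = w')"
    if w: "w \<in> qbasis q \<kappa>" "w' \<in> qbasis q \<kappa>" and K: "local_on ?M T K"
      and surj: "\<And>x. \<exists>s\<in>S. \<forall>j\<in>T. s j = x j" for w w' T K
  proof -
    have "inner_prod ?M (\<Psi> (decode w)) (\<Psi> (decode w')) = of_bool (w = w')"
      using ortho[OF decode_configs[OF w(1)] decode_configs[OF w(2)]] decode_eq_iff[OF w] by simp
    then have "(\<Sum>\<alpha>\<in>configs_on ?M T. K \<alpha> \<alpha>) / of_nat (card (configs_on ?M T)) * of_bool (w = w') =
      (\<Sum>u\<in>configs ?M. \<Sum>v\<in>configs ?M. cnj (\<Psi> (decode w) u) * K u v * \<Psi> (decode w') v)"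
      using local_kernel_expectation[OF S surj K eig[of _ "decode w"] eig[of _ "decode w'"] \<chi>] by simp
    also have "\<dots> = (\<Sum>x\<in>qbasis q n. \<Sum>y\<in>qbasis q c. \<Sum>x'\<in>qbasis q n. \<Sum>y'\<in>qbasis q c.
        cnj (\<Psi> (decode w) (decode (x @ y))) * K (decode (x @ y)) (decode (x' @ y')) *
          \<Psi> (decode w') (decode (x' @ y')))"
      unfolding sum_configs_decode ..
    also have "\<dots> = (\<Sum>x\<in>qbasis q n. \<Sum>y\<in>qbasis q c. \<Sum>x'\<in>qbasis q n. \<Sum>y'\<in>qbasis q c.
        cnj (V w (x, y)) * K (decode (x @ y)) (decode (x' @ y')) * V w' (x', y'))"
      using w by (intro sum.cong refl) (simp add: V_def)
    finally show ?thesis ..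
  qed
  have "eaqecc_exists q n \<kappa> (m + 1) c"
  proof (rule eaqecc_from_states)
    show "q > 0"
      using q_gt_1 by simp
    show "V w (x, y) = 0" if "w \<notin> qbasis q \<kappa> \<or> x \<notin> qbasis q n \<or> y \<notin> qbasis q c" for w x y
      using that by (auto simp: V_def)
  next
    fix w w' z z' assume w: "w \<in> qbasis q \<kappa>" "w' \<in> qbasis q \<kappa>" and z: "z \<in> qbasis q c" "z' \<in> qbasis q c"
    let ?T = "{n..<?M}"
    \<comment> \<open>The matrix unit from \<open>z'\<close> to \<open>z\<close> on the receiver's
      qudits. Its expectation is the inner product of two slices, and its normalized trace is the
      required value.\<close>
    define K :: "(nat \<Rightarrow> 'a) \<Rightarrow> (nat \<Rightarrow> 'a) \<Rightarrow> complex" where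
      "K u v = of_bool ((\<forall>j. j \<notin> ?T \<longrightarrow> u j = v j) \<and>
         (\<forall>j\<in>?T. u j = decode z (j - n) \<and> v j = decode z' (j - n)))" for u v
    have K: "local_on ?M ?T K"
      unfolding local_on_def K_def by auto
    have K_decode: "K (decode (x @ y)) (decode (x' @ y')) = of_bool (x' = x \<and> y = z \<and> y' = z')"
      if x: "x \<in> qbasis q n" "x' \<in> qbasis q n" and y: "y \<in> qbasis q c" "y' \<in> qbasis q c" for x x' y y'
    proof -
      have tail: "(\<forall>j\<in>?T. decode (x @ y) j = decode z (j - n)) \<longleftrightarrow> y = z"
        if "x \<in> qbasis q n" "y \<in> qbasis q c" "z \<in> qbasis q c" for x y z
      proof
        assume *: "\<forall>j\<in>?T. decode (x @ y) j = decode z (j - n)"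
        have "decode y i = decode z i" for i
        proof (cases "i < c")
          case True
          then show ?thesis
            using bspec[OF *, of "n + i"] decode_append_right[OF that(1)] by simp
        next
          case False
          then show ?thesis
            using that by (simp add: decode_def qbasis_def)
        qed
        then have "decode y = decode z" ..
        then show "y = z"
          using decode_eq_iff that by blast
      next
        assume "y = z"
        show "\<forall>j\<in>?T. decode (x @ y) j = decode z (j - n)"
        proof
          fix j assume "j \<in> ?T"
          then have "n + (j - n) = j"
            by simp
          then show "decode (x @ y) j = decode z (j - n)"
            using decode_append_right[OF that(1), of y "j - n"] \<open>y = z\<close> by simp
        qed
      qed
      have head: "(\<forall>j. j \<notin> ?T \<longrightarrow> decode (x @ y) j = decode (x' @ y') j) \<longleftrightarrow> x' = x"
      proof
        assume *: "\<forall>j. j \<notin> ?T \<longrightarrow> decode (x @ y) j = decode (x' @ y') j"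
        have "encode n (decode (x @ y)) = encode n (decode (x' @ y'))"
          using * by (simp add: encode_def)
        then show "x' = x"
          by (simp add: encode_decode_append x)
      next
        assume "x' = x"
        then show "\<forall>j. j \<notin> ?T \<longrightarrow> decode (x @ y) j = decode (x' @ y') j"
          using x y by (auto simp: decode_def qbasis_def nth_append)
      qed
      have "K (decode (x @ y)) (decode (x' @ y')) =
        of_bool ((\<forall>j. j \<notin> ?T \<longrightarrow> decode (x @ y) j = decode (x' @ y') j) \<and>
          (\<forall>j\<in>?T. decode (x @ y) j = decode z (j - n)) \<and> (\<forall>j\<in>?T. decode (x' @ y') j = decode z' (j - n)))"
        unfolding K_def by (intro arg_cong[of _ _ of_bool]) blast
      then show ?thesis
        unfolding head tail[OF x(1) y(1) z(1)] tail[OF x(2) y(2) z(2)] .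
    qed
    have trace: "(\<Sum>\<alpha>\<in>configs_on ?M ?T. K \<alpha> \<alpha>) = of_bool (z = z')"
    proof (cases "z = z'")
      case True
      let ?a = "\<lambda>j. if j \<in> ?T then decode z (j - n) else 0"
      have "?a \<in> configs_on ?M ?T"
        using decode_configs[OF z(1)]
        by (auto simp: configs_on_def configs_def words_over_def base_field_closed)
      moreover have "K \<alpha> \<alpha> = (if \<alpha> = ?a then 1 else 0)" if "\<alpha> \<in> configs_on ?M ?T" for \<alpha>
      proof -
        have "(\<forall>j\<in>?T. \<alpha> j = decode z (j - n)) \<longleftrightarrow> \<alpha> = ?a"
          using that by (auto simp: configs_on_def fun_eq_iff)
        then show ?thesis
          using True by (simp add: K_def)
      qed
      ultimately show ?thesis
        using True finite_configs_on by simp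
    next
      case False
      have "K \<alpha> \<alpha> = 0" for \<alpha>
      proof -
        have "\<exists>i. decode z i \<noteq> decode z' i"
          using False decode_eq_iff[OF z] by (auto simp: fun_eq_iff)
        then obtain i where i: "decode z i \<noteq> decode z' i" ..
        then have "i < c"
          using z by (auto simp: decode_def qbasis_def split: if_splits)
        with i have "\<not> (\<forall>j\<in>?T. \<alpha> j = decode z (j - n) \<and> \<alpha> j = decode z' (j - n))"
          by (auto intro!: bexI[of _ "n + i"])
        then show ?thesis
          unfolding K_def by simp
      qed
      with False show ?thesis
        by simp
    qed
    have "(\<Sum>x\<in>qbasis q n. cnj (V w (x, z)) * V w' (x, z')) =
      (\<Sum>x\<in>qbasis q n. \<Sum>y\<in>qbasis q c. \<Sum>x'\<in>qbasis q n. \<Sum>y'\<in>qbasis q c.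
        cnj (V w (x, y)) * K (decode (x @ y)) (decode (x' @ y')) * V w' (x', y'))"
    proof (rule sum.cong[OF refl])
      fix x assume x: "x \<in> qbasis q n"
      have "(\<Sum>y\<in>qbasis q c. \<Sum>x'\<in>qbasis q n. \<Sum>y'\<in>qbasis q c.
          cnj (V w (x, y)) * K (decode (x @ y)) (decode (x' @ y')) * V w' (x', y')) =
        (\<Sum>y\<in>qbasis q c. \<Sum>x'\<in>qbasis q n. \<Sum>y'\<in>qbasis q c.
          if y' = z' then if x' = x then if y = z then cnj (V w (x, z)) * V w' (x, z') else 0 else 0 else 0)"
        using x by (intro sum.cong refl) (auto simp: K_decode)
      also have "\<dots> = cnj (V w (x, z)) * V w' (x, z')"
        using x z finite_qbasis by simp
      finally show "cnj (V w (x, z)) * V w' (x, z') = (\<Sum>y\<in>qbasis q c. \<Sum>x'\<in>qbasis q n. \<Sum>y'\<in>qbasis q c.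
          cnj (V w (x, y)) * K (decode (x @ y)) (decode (x' @ y')) * V w' (x', y'))" ..
    qed
    also have "\<dots> = of_bool (z = z') / of_nat (q ^ c) * of_bool (w = w')"
      using expectation[OF w K full_receiver] unfolding trace card_configs_on_tail .
    finally show "(\<Sum>x\<in>qbasis q n. cnj (V w (x, z)) * V w' (x, z')) = of_bool (w = w' \<and> z = z') / of_nat (q ^ c)"
      by auto
  next
    fix T E assume T: "T \<subseteq> {..<n}" "card T < m + 1" and "acts_only_on q n T E"
    then obtain N where E: "\<And>x y. x \<in> qbasis q n \<Longrightarrow> y \<in> qbasis q n \<Longrightarrow>
        E x y = (if \<forall>j<n. j \<notin> T \<longrightarrow> x ! j = y ! j then N (nths x T) (nths y T) else 0)"
      by (auto simp: acts_only_on_def)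
    \<comment> \<open>The error tensored with the identity on the receiver's qudits, transported to
      configurations. Demanding agreement at all \<open>j\<close> >= \<open>n\<close> is harmless
      beyond \<open>?M\<close>, where configurations vanish.\<close>
    define K :: "(nat \<Rightarrow> 'a) \<Rightarrow> (nat \<Rightarrow> 'a) \<Rightarrow> complex" where
      "K u v = (if \<forall>j\<ge>n. u j = v j then E (encode n u) (encode n v) else 0)" for u v
    have encode_n: "encode n u \<in> qbasis q n" if "u \<in> configs ?M" for u
      using that by (auto simp: encode_def qbasis_def configs_def intro: inv_letter_less)
    have encode_nth: "letter (encode n u ! j) = u j" if "u \<in> configs ?M" "j < n" for u j
      using that by (simp add: encode_def configs_def letter_inv_letter)
    have K: "local_on ?M T K"
      unfolding local_on_def
    proof (intro conjI ballI impI allI)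
      fix u v j assume uv: "u \<in> configs ?M" "v \<in> configs ?M" and "K u v \<noteq> 0" and "j \<notin> T"
      then have "\<forall>j\<ge>n. u j = v j" "E (encode n u) (encode n v) \<noteq> 0"
        by (auto simp: K_def split: if_splits)
      moreover from this(2) have "\<forall>j<n. j \<notin> T \<longrightarrow> encode n u ! j = encode n v ! j"
        unfolding E[OF encode_n[OF uv(1)] encode_n[OF uv(2)]] by (auto split: if_splits)
      ultimately show "u j = v j"
        using \<open>j \<notin> T\<close> encode_nth[OF uv(1)] encode_nth[OF uv(2)] by (metis not_le)
    next
      fix u v u' v'
      assume uv: "u \<in> configs ?M" "v \<in> configs ?M" "u' \<in> configs ?M" "v' \<in> configs ?M"
        and on_T: "\<forall>j\<in>T. u j = u' j \<and> v j = v' j" and off_T: "\<forall>j. j \<notin> T \<longrightarrow> u j = v j \<and> u' j = v' j"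
      have K_eq: "K x y = N (nths (encode n x) T) (nths (encode n y) T)"
        if xy: "x \<in> configs ?M" "y \<in> configs ?M" "\<forall>j. j \<notin> T \<longrightarrow> x j = y j" for x y
      proof -
        have "\<forall>j\<ge>n. x j = y j"
          using xy(3) T(1) by auto
        moreover have "\<forall>j<n. j \<notin> T \<longrightarrow> encode n x ! j = encode n y ! j"
          using xy(3) by (simp add: encode_def)
        ultimately show ?thesis
          by (simp add: K_def E[OF encode_n[OF xy(1)] encode_n[OF xy(2)]])
      qed
      have "nths (encode n u) T = nths (encode n u') T" "nths (encode n v) T = nths (encode n v') T"
        by (rule nths_cong; use on_T in \<open>simp add: encode_def\<close>)+
      then show "K u v = K u' v'"
        using off_T by (simp add: K_eq uv)
    qed
    have K_decode: "K (decode (x @ y)) (decode (x' @ y')) = (if y' = y then E x x' else 0)"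
      if x: "x \<in> qbasis q n" "x' \<in> qbasis q n" and y: "y \<in> qbasis q c" "y' \<in> qbasis q c" for x x' y y'
    proof -
      have "(\<forall>j\<ge>n. decode (x @ y) j = decode (x' @ y') j) \<longleftrightarrow> (\<forall>i. decode (x @ y) (n + i) = decode (x' @ y') (n + i))"
        by (metis le_add1 le_add_diff_inverse)
      also have "\<dots> \<longleftrightarrow> decode y = decode y'"
        by (simp add: decode_append_right x fun_eq_iff)
      also have "\<dots> \<longleftrightarrow> y' = y"
        using decode_eq_iff[OF y] by auto
      finally show ?thesis
        by (simp add: K_def encode_decode_append x)
    qed
    show "\<exists>\<mu>. \<forall>w\<in>qbasis q \<kappa>. \<forall>w'\<in>qbasis q \<kappa>.
        (\<Sum>x\<in>qbasis q n. \<Sum>y\<in>qbasis q c. \<Sum>x'\<in>qbasis q n. cnj (V w (x, y)) * E x x' * V w' (x', y)) =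
        \<mu> * of_bool (w = w')"
    proof (intro exI ballI)
      fix w w' assume w: "w \<in> qbasis q \<kappa>" "w' \<in> qbasis q \<kappa>"
      have "(\<Sum>x\<in>qbasis q n. \<Sum>y\<in>qbasis q c. \<Sum>x'\<in>qbasis q n. cnj (V w (x, y)) * E x x' * V w' (x', y)) =
        (\<Sum>x\<in>qbasis q n. \<Sum>y\<in>qbasis q c. \<Sum>x'\<in>qbasis q n. \<Sum>y'\<in>qbasis q c.
          cnj (V w (x, y)) * K (decode (x @ y)) (decode (x' @ y')) * V w' (x', y'))"
      proof (intro sum.cong refl)
        fix x y x' assume xy: "x \<in> qbasis q n" "y \<in> qbasis q c" "x' \<in> qbasis q n"
        have "(\<Sum>y'\<in>qbasis q c. cnj (V w (x, y)) * K (decode (x @ y)) (decode (x' @ y')) * V w' (x', y')) =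
          (\<Sum>y'\<in>qbasis q c. if y' = y then cnj (V w (x, y)) * E x x' * V w' (x', y) else 0)"
          using xy by (intro sum.cong refl) (simp add: K_decode)
        then show "cnj (V w (x, y)) * E x x' * V w' (x', y) =
          (\<Sum>y'\<in>qbasis q c. cnj (V w (x, y)) * K (decode (x @ y)) (decode (x' @ y')) * V w' (x', y'))"
          using xy(2) finite_qbasis by simp
      qed
      also have "\<dots> = (\<Sum>\<alpha>\<in>configs_on ?M T. K \<alpha> \<alpha>) / of_nat (card (configs_on ?M T)) * of_bool (w = w')"
        by (rule expectation[OF w K full_sender[OF T]])
      finally show "(\<Sum>x\<in>qbasis q n. \<Sum>y\<in>qbasis q c. \<Sum>x'\<in>qbasis q n. cnj (V w (x, y)) * E x x' * V w' (x', y)) =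
        (\<Sum>\<alpha>\<in>configs_on ?M T. K \<alpha> \<alpha>) / of_nat (card (configs_on ?M T)) * of_bool (w = w')" .
    qed
  qed
  then show ?thesis
    by (simp add: \<kappa>_def c_def)
qed

end

context quadratic_field
begin

theorem hermitian_construction:
  fixes C :: "(nat \<Rightarrow> 'a) set"
  assumes "word_space.subspace C" "C \<subseteq> words_over n"
    and "card C = (q ^ 2) ^ k" and "card (hermitian_hull q n C) = (q ^ 2) ^ r"
    and "full_on n m C"
  shows "eaqecc_exists q n (n - k - r) (m + 1) (k - r)"
proof -
  obtain \<psi> :: "'a \<Rightarrow> complex" where \<psi>: "\<And>x y. \<psi> (x + y) = \<psi> x * \<psi> y" "\<And>x. norm (\<psi> x) = 1"
    "\<exists>x\<in>base_field. \<psi> x \<noteq> 1"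
    using exists_character by blast
  obtain \<gamma> :: 'a where \<gamma>: "\<gamma> ^ q \<noteq> \<gamma>"
    using exists_not_base_field by blast
  interpret weyl_system q ty \<psi> \<gamma>
    by unfold_locales (fact \<psi> \<gamma>)+
  show ?thesis
    using assms by (rule hermitian_construction_from_weyl)
qed

end

theorem theorem8:
  fixes q n k l i s :: nat
    and C :: "(nat \<Rightarrow> 'a::{field,finite}) set"
  assumes "primepow q" and "q > 2" and "card (UNIV :: 'a set) = q ^ 2"
    and "2 * k \<le> n" and "l \<le> k"
    and "is_grs_code n k C"
    and "word_space.dim (hermitian_hull q n C) = l"
    and "hermitian_construction_params q n C (n - k - l) (k + 1) (k - l)"
    and "mds_eaqecc_exists q n (n - k - l) (k + 1) (k - l)"
    and "i \<le> min l (min (q ^ 2 + 1 - n) (n - 2 * k))"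
    and "s \<le> l - i"
  shows "mds_eaqecc_exists q (n + i) (n - k - s) (k + i + 1) (k + i - s)"
proof -
  interpret quadratic_field q "TYPE('a)"
    using assms(1,3) by unfold_locales
  obtain a v where "C = grs n k a v"
    using assms(6) by (auto simp: is_grs_code_def grs_def)
  then have C: "word_space.subspace C" "C \<subseteq> words_over n"
    by (simp_all add: subspace_grs grs_subset)
  \<comment> \<open>Read off from the parameter \<open>k - l\<close> of the construction;
    \<open>l\<close> <= \<open>k\<close> keeps the subtraction exact.\<close>
  have "word_space.dim C = k"
    using assms(5,7,8) by (simp add: hermitian_construction_params_def)
  then have card_C: "card C = (q ^ 2) ^ k"
    using card_subspace[OF C(1) finite_subset[OF C(2) finite_words_over]] assms(3) by simp
  have "finite (hermitian_hull q n C)"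
    by (rule finite_subset[OF _ finite_words_over[of n]]) (auto simp: hermitian_hull_iff)
  then have "card (hermitian_hull q n C) = (q ^ 2) ^ l"
    using card_subspace[OF subspace_hermitian_hull[OF C(1)]] assms(3,7) by simp
  moreover have "i + s \<le> l" "i \<le> q ^ 2 + 1 - n" "i \<le> n - 2 * k"
    using assms(10,11) by auto
  ultimately obtain C' :: "(nat \<Rightarrow> 'a) set" where
    "word_space.subspace C'" "C' \<subseteq> words_over (n + i)" "full_on (n + i) (k + i) C'"
    "card C' = (q ^ 2) ^ (k + i)" "card (hermitian_hull q (n + i) C') = (q ^ 2) ^ s"
    using grs_extend_with_hull[OF assms(2,6) _ card_C] by metis
  \<comment> \<open>Applied with length \<open>n + i\<close>, dimension \<open>k + i\<close> and
    hull dimension \<open>s\<close>; the increments cancel in the number of information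
    qudits.\<close>
  from hermitian_construction[OF this(1,2,4,5,3)]
  have "eaqecc_exists q (n + i) (n - k - s) (k + i + 1) (k + i - s)"
    by simp
  moreover have "2 * (k + i + 1) \<le> n + i + 2"
    using \<open>i \<le> n - 2 * k\<close> assms(4) by simp
  \<comment> \<open>No subtraction is truncated: \<open>s\<close> <= \<open>l\<close> <=
    \<open>k\<close>, and \<open>2 * k\<close> <= \<open>n\<close>.\<close>
  moreover have "n - k - s + 2 * (k + i + 1) = k + i - s + (n + i) + 2"
    using \<open>i + s \<le> l\<close> assms(4,5) by simp
  ultimately show ?thesis
    by (simp add: mds_eaqecc_exists_def)
qed

end
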